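(* Suppose $1<b\le 2$. Then there exist unique $r,s\in\mathbb{R}$ such that $\exp(-rx^2-sx)$ is integrable on $[0,\infty)$ and the probability density on $[0,\infty)$ proportional to $\exp(-rx^2-sx)$ has first moment $1$ and second moment $b$. Let $Z_1,Z_2,\ldots$ be i.i.d. random variables with this density and, for each integer $n>b$, let $X=X^{(n)}=(X_1,\ldots,X_n)$ be uniformly distributed on $K=K_{n,b}$. The following hold: (a) For any fixed $k$, the random vector $(X_1,\ldots,X_k)$ converges in law to $(Z_1,\ldots,Z_k)$ as $n\to\infty$. (b) For any fixed $k$, all joint moments of $(X_1,\ldots,X_k)$ converge, as $n\to\infty$, to the corresponding moments of $(Z_1,\ldots,Z_k)$. (c) If $b<2$, there is a constant $C$, possibly depending on $b$, such that $$\lim_{n\to\infty}\mathbb{P}\Bigl(\max_{1\le i\le n}X_i> C\sqrt{\log n}\Bigr)=0.$$ (d) If $b=2$, there is a constant $C$ such that $$\lim_{n\to\infty}\mathbb{P}\Bigl(\max_{1\le i\le n}X_i> C\log n\Bigr)=0.$$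
   Context: $\mathbb{R}_+$ denotes the set of (strictly) positive real numbers. For real $b>1$ and an integer $n>b$ (which makes the set non-empty), $$K=K_{n,b}:=\Bigl\{x=(x_1,\ldots,x_n)\in\mathbb{R}_+^n:\ \sum_{i=1}^n x_i=n,\ \sum_{i=1}^n x_i^2=nb\Bigr\}.$$ The uniform distribution on $K$ is the limit of normalized Lebesgue measures on thin shells around $K$ as the thickness tends to zero; equivalently, the set $\{x\in\mathbb{R}^n:\sum x_i=n,\ \sum x_i^2=nb\}$ is a sphere centered at $(1,\ldots,1)$ in the hyperplane $\{\sum x_i=n\}$, $K$ is a relatively open non-empty subset of it, and the uniform distribution on $K$ is the rotation-invariant probability measure of this sphere conditioned on (restricted to and normalized on) $K$. The number $b$ is fixed and does not depend on $n$. *)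

theory Defs
  imports "HOL-Probability.Probability"
begin

text \<open>
  Vectors of length \<open>n\<close> are the elements of \<open>{..<n} \<rightarrow>\<^sub>E UNIV\<close>, of type \<open>nat \<Rightarrow> real\<close>, with
  coordinates numbered from 0; the Borel sets of this space are those of
  \<open>PiM {..<n} (\<lambda>_. borel)\<close>.
\<close>

definition K :: "nat \<Rightarrow> real \<Rightarrow> (nat \<Rightarrow> real) set" where
  "K n b = {x \<in> {..<n} \<rightarrow>\<^sub>E {0<..}. (\<Sum>i<n. x i) = real n \<and> (\<Sum>i<n. (x i)\<^sup>2) = real n * b}"

definition shell :: "nat \<Rightarrow> real \<Rightarrow> real \<Rightarrow> (nat \<Rightarrow> real) set" where
  "shell n b \<epsilon> = {x \<in> {..<n} \<rightarrow>\<^sub>E {0<..}.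
     \<bar>(\<Sum>i<n. x i) - real n\<bar> < \<epsilon> \<and> \<bar>(\<Sum>i<n. (x i)\<^sup>2) - real n * b\<bar> < \<epsilon>}"

text \<open>
  Weak convergence, tested on bounded continuous functions. It is used at type \<open>nat \<Rightarrow> real\<close>,
  which carries the product topology, for measures on \<open>{..<k} \<rightarrow>\<^sub>E UNIV\<close>. Restricting
  continuous functions on \<open>nat \<Rightarrow> real\<close> to this subspace yields exactly the continuous functions
  of \<open>k\<close> real variables (the other coordinates are the constant \<open>undefined\<close>), so this is
  convergence in law of random vectors of length \<open>k\<close>.
\<close>

definition converges_weakly ::
    "('i \<Rightarrow> 'a::topological_space measure) \<Rightarrow> 'a measure \<Rightarrow> 'i filter \<Rightarrow> bool" where
  "converges_weakly M N F \<longleftrightarrow>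
     (\<forall>f :: 'a \<Rightarrow> real. continuous_on UNIV f \<and> bounded (range f) \<longrightarrow>
        ((\<lambda>i. integral\<^sup>L (M i) f) \<longlongrightarrow> integral\<^sup>L N f) F)"

text \<open>
  The uniform distribution on \<open>K n b\<close>, as the limit of normalized Lebesgue measure on thin
  shells. The choice of shells introduces no distortion: apart from the positivity
  constraint, a shell is cut out by conditions on \<open>\<Sum> x\<^sub>i\<close> and \<open>\<Sum> x\<^sub>i\<^sup>2\<close> only, hence is invariant
  under all orthogonal maps fixing \<open>(1, \<dots>, 1)\<close>. So the limit is the rotation-invariant
  probability measure of the sphere \<open>\<Sum> x\<^sub>i = n, \<Sum> x\<^sub>i\<^sup>2 = n b\<close>, conditioned on \<open>K n b\<close>.
\<close>

definition is_uniform_on_K :: "nat \<Rightarrow> real \<Rightarrow> (nat \<Rightarrow> real) measure \<Rightarrow> bool" where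
  "is_uniform_on_K n b \<mu> \<longleftrightarrow>
     sets \<mu> = sets (PiM {..<n} (\<lambda>_. borel)) \<and> prob_space \<mu> \<and> (AE x in \<mu>. x \<in> K n b) \<and>
     converges_weakly (\<lambda>\<epsilon>. uniform_measure (PiM {..<n} (\<lambda>_. lborel)) (shell n b \<epsilon>)) \<mu> (at_right 0)"

definition joint_law :: "'w measure \<Rightarrow> nat \<Rightarrow> (nat \<Rightarrow> 'w \<Rightarrow> real) \<Rightarrow> (nat \<Rightarrow> real) measure" where
  "joint_law M k Y = distr M (PiM {..<k} (\<lambda>_. borel)) (\<lambda>\<omega>. \<lambda>i\<in>{..<k}. Y i \<omega>)"

definition uniform_vector_on_K ::
    "nat \<Rightarrow> real \<Rightarrow> 'w measure \<Rightarrow> (nat \<Rightarrow> 'w \<Rightarrow> real) \<Rightarrow> bool" where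
  "uniform_vector_on_K n b M X \<longleftrightarrow>
     prob_space M \<and> (\<forall>i<n. X i \<in> borel_measurable M) \<and> is_uniform_on_K n b (joint_law M n X)"

text \<open>The vectors \<open>X\<^sup>(\<^sup>n\<^sup>)\<close> for different \<open>n\<close> may live on different probability spaces.\<close>

definition uniform_vectors ::
    "real \<Rightarrow> (nat \<Rightarrow> 'w measure) \<Rightarrow> (nat \<Rightarrow> nat \<Rightarrow> 'w \<Rightarrow> real) \<Rightarrow> bool" where
  "uniform_vectors b P X \<longleftrightarrow> (\<forall>n. real n > b \<longrightarrow> uniform_vector_on_K n b (P n) (X n))"

definition gibbs_weight :: "real \<Rightarrow> real \<Rightarrow> real \<Rightarrow> real" where
  "gibbs_weight r s x = exp (- r * x\<^sup>2 - s * x)"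

definition gibbs_density :: "real \<Rightarrow> real \<Rightarrow> real \<Rightarrow> real" where
  "gibbs_density r s x =
     indicator {0..} x * gibbs_weight r s x / (LINT y:{0..}|lborel. gibbs_weight r s y)"

definition moment_match :: "real \<Rightarrow> real \<Rightarrow> real \<Rightarrow> bool" where
  "moment_match b r s \<longleftrightarrow>
     set_integrable lborel {0..} (gibbs_weight r s) \<and>
     has_bochner_integral lborel (\<lambda>x. x * gibbs_density r s x) 1 \<and>
     has_bochner_integral lborel (\<lambda>x. x\<^sup>2 * gibbs_density r s x) b"

definition iid_with_density ::
    "'w measure \<Rightarrow> (nat \<Rightarrow> 'w \<Rightarrow> real) \<Rightarrow> (real \<Rightarrow> real) \<Rightarrow> bool" where
  "iid_with_density Q Z p \<longleftrightarrow>
     prob_space Q \<and> prob_space.indep_vars Q (\<lambda>_. borel) Z UNIV \<and>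
     (\<forall>i. distributed Q lborel (Z i) (\<lambda>x. ennreal (p x)))"

end

theory Submission
  imports Defs "HOL-Real_Asymp.Real_Asymp"
begin

text \<open>
  On \<open>K n b\<close> the density of independent \<open>Z\<^sub>1, \<dots>, Z\<^sub>n\<close>, which is proportional to
  \<open>exp (- r \<Sum> x\<^sub>i\<^sup>2 - s \<Sum> x\<^sub>i)\<close>, is constant. So the uniform distribution on \<open>K n b\<close> is the law of
  \<open>(Z\<^sub>1, \<dots>, Z\<^sub>n)\<close> conditioned on the pair \<open>(\<Sum> Z\<^sub>i, \<Sum> Z\<^sub>i\<^sup>2)\<close> being equal to \<open>(n, n b)\<close>, and by
  the choice of \<open>r\<close> and \<open>s\<close> this value is the mean of the pair. Conditioning
  on the mean value should be cheap, and the proof makes this precise: for events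
  that ignore three of the coordinates, it multiplies probabilities by at most a power of \<open>n\<close>
  (lemma \<open>uniform_shell_comparison\<close>). Such an event is negligible on \<open>K n b\<close> if it is
  superpolynomially unlikely for independent variables.

  The comparison is between probabilities that the pair lies in a square of side \<open>2 \<epsilon>\<close>. For the
  numerator, three free coordinates already give a bounded density to the pair, because the level
  sets of \<open>(x + y + z, x\<^sup>2 + y\<^sup>2 + z\<^sup>2)\<close> are circles and an annulus has area proportional to the
  difference of the squared radii; so an event that ignores three coordinates keeps a factor
  \<open>\<epsilon>\<^sup>2\<close> when it is intersected with a shell (lemma \<open>sums_near_bound\<close>). The denominator needs the
  bound \<open>c n\<^bsup>-q\<^esup> \<epsilon>\<^sup>2\<close> from below (lemma \<open>sums_near_lower_bound\<close>), which replaces a local central limit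
  theorem. Chebyshev's inequality and averaging produce some point at distance \<open>O(\<surd>n)\<close> from the
  mean where the probability is at least \<open>c \<epsilon>\<^sup>2 / n\<close>. The lemma \<open>Harnack\<close> moves this point by a bounded
  vector \<open>\<delta>\<close> at the price of a factor \<open>(1 - \<eta>) / (1 + \<eta>)\<close>: there is a weight on pairs of
  coordinates under which the sum and the sum of squares of the two are uniform on a
  small rectangle, so replacing the rectangle by its translate shifts the pair of sums by exactly
  \<open>\<delta>\<close>; and the total weight of \<open>n / 2\<close> disjoint pairs stays within a factor \<open>1 \<plusminus> \<eta>\<close> of its
  mean outside an event that Hoeffding's inequality makes negligible. With \<open>\<eta> = ln n / \<surd>n\<close> the
  \<open>O(\<surd>n)\<close> steps that lead to the mean cost only a power of \<open>n\<close>.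

  Given the comparison, the claims follow from properties of independent variables. By
  exchangeability, the mean of \<open>f (X\<^sub>1, \<dots>, X\<^sub>k)\<close> is the mean of the average of \<open>f\<close> over about \<open>n / k\<close>
  disjoint blocks of coordinates, and this average is within \<open>\<eta>\<close> of its limit up to an exponentially
  small probability. For moments the same is done with the coordinates truncated at
  \<open>1 + (ln n)\<^sup>2\<close>. The maximum is handled by a union bound and the tail of one coordinate, which is
  Gaussian if \<open>r > 0\<close> and exponential if \<open>r = 0\<close>.

  The parameters are unique because for two solutions with densities \<open>p\<close> and \<open>q\<close> the function
  \<open>ln p - ln q\<close> is a combination of \<open>1, x, x\<^sup>2\<close>, so \<open>\<integral> (p - q) (ln p - ln q) = 0\<close> although the integrand
  is nonnegative. They exist for \<open>b < 2\<close> because in the family \<open>exp (- x\<^sup>2 - \<sigma> x)\<close> the ratio of the second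
  moment to the squared first moment is continuous in \<open>\<sigma>\<close> and passes through \<open>b\<close>, and
  scaling then normalizes the mean; for \<open>b = 2\<close> the exponential density is a solution.
\<close>

section \<open>The joint distribution of the sum and the sum of squares\<close>

text \<open>
  The area is a difference of the areas of two discs; it is proportional to the difference of
  the squared radii and hence independent of \<open>A\<close> as long as the inner disc exists.
\<close>
lemma annulus_area:
  fixes A e :: real
  assumes "e > 0"
  shows "(\<integral>\<^sup>+x. \<integral>\<^sup>+y. indicator {A - e<..<A + e} (x\<^sup>2 + y\<^sup>2) \<partial>lborel \<partial>lborel) \<le> ennreal (2 * pi * e)"
proof -
  have "(\<integral>\<^sup>+x. \<integral>\<^sup>+y. indicator {A - e<..<A + e} (x\<^sup>2 + y\<^sup>2) \<partial>lborel \<partial>lborel) =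
     (\<integral>\<^sup>+p. indicator {A - e<..<A + e} ((fst p)\<^sup>2 + (snd p)\<^sup>2) \<partial>(lborel \<Otimes>\<^sub>M (lborel :: real measure)))"
    by (subst lborel.nn_integral_fst[where f="\<lambda>p. indicator {A - e<..<A + e} ((fst p)\<^sup>2 + (snd p)\<^sup>2)" and ?M1.0=lborel, symmetric]) simp_all
  also have "\<dots> = (\<integral>\<^sup>+p. indicator {p. (fst p)\<^sup>2 + (snd p)\<^sup>2 \<in> {A - e<..<A + e}} p \<partial>(lborel :: (real \<times> real) measure))"
    unfolding lborel_prod by (rule nn_integral_cong) (auto simp: indicator_def)
  also have "\<dots> = emeasure lborel {p :: real \<times> real. (fst p)\<^sup>2 + (snd p)\<^sup>2 \<in> {A - e<..<A + e}}"
    by (rule nn_integral_indicator) (auto intro!: borel_open open_Collect_conj open_Collect_less continuous_intros)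
  also have "\<dots> \<le> ennreal (2 * pi * e)"
  proof (cases "A + e \<le> 0")
    case True
    then have "{p :: real \<times> real. (fst p)\<^sup>2 + (snd p)\<^sup>2 \<in> {A - e<..<A + e}} = {}"
      by (auto simp: not_less) (smt (verit) zero_le_power2)
    then show ?thesis by (simp only: emeasure_empty zero_le)
  next
    case False
    \<comment> \<open>The inner disc is empty if \<open>A \<le> e\<close>.\<close>
    let ?r = "sqrt (max 0 (A - e))" and ?R = "sqrt (A + e)"
    have n: "norm p = sqrt ((fst p)\<^sup>2 + (snd p)\<^sup>2)" for p :: "real \<times> real"
      by (simp add: norm_prod_def)
    have rR: "?r \<le> ?R" using False assms by simp
    have "{p :: real \<times> real. (fst p)\<^sup>2 + (snd p)\<^sup>2 \<in> {A - e<..<A + e}} \<subseteq> ball 0 ?R - ball 0 ?r"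
      by (auto simp: n less_max_iff_disj not_sum_power2_lt_zero)
    then have "emeasure lborel {p :: real \<times> real. (fst p)\<^sup>2 + (snd p)\<^sup>2 \<in> {A - e<..<A + e}}
      \<le> emeasure lborel (ball (0 :: real \<times> real) ?R - ball 0 ?r)"
      by (rule emeasure_mono) simp
    also have "\<dots> = emeasure lborel (ball (0 :: real \<times> real) ?R) - emeasure lborel (ball (0 :: real \<times> real) ?r)"
      using rR by (intro emeasure_Diff) (auto simp: subset_ball emeasure_ball)
    also have "\<dots> = ennreal (pi * ?R\<^sup>2) - ennreal (pi * ?r\<^sup>2)"
      using False by (simp add: emeasure_ball unit_ball_vol_2)
    also have "\<dots> = ennreal (pi * (A + e) - pi * max 0 (A - e))"
      using False by (simp add: ennreal_minus)
    also have "\<dots> \<le> ennreal (2 * pi * e)"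
    proof (rule ennreal_leI)
      have "pi * ((A + e) - max 0 (A - e)) \<le> pi * (2 * e)"
        by (rule mult_left_mono) auto
      then show "pi * (A + e) - pi * max 0 (A - e) \<le> 2 * pi * e"
        by (simp add: algebra_simps)
    qed
    finally show ?thesis .
  qed
  finally show ?thesis .
qed

lemma nn_integral_lborel_shift:
  fixes f :: "real \<Rightarrow> ennreal"
  assumes [measurable]: "f \<in> borel_measurable borel"
  shows "(\<integral>\<^sup>+x. f (x + c) \<partial>lborel) = (\<integral>\<^sup>+x. f x \<partial>lborel)"
  using nn_integral_real_affine[OF assms, of 1 c] by (simp add: add.commute)

lemma nn_integral_lborel_scale_le:
  fixes f :: "real \<Rightarrow> ennreal"
  assumes [measurable]: "f \<in> borel_measurable borel" and "c \<ge> 1"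
  shows "(\<integral>\<^sup>+x. f (c * x) \<partial>lborel) \<le> (\<integral>\<^sup>+x. f x \<partial>lborel)"
proof -
  have "(\<integral>\<^sup>+x. f x \<partial>lborel) = ennreal c * (\<integral>\<^sup>+x. f (c * x) \<partial>lborel)"
    using nn_integral_real_affine[OF assms(1), of c 0] assms(2) by simp
  moreover have "1 * (\<integral>\<^sup>+x. f (c * x) \<partial>lborel) \<le> ennreal c * (\<integral>\<^sup>+x. f (c * x) \<partial>lborel)"
    using assms(2) by (intro mult_right_mono) auto
  ultimately show ?thesis by simp
qed

text \<open>
  Fixing the sum \<open>\<tau>\<close> leaves a plane on which the sum of squares is \<open>\<tau>\<^sup>2 / 3\<close> plus a positive
  definite quadratic form with constant coefficients. Completing the squares turns the condition
  on it into an annulus.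
\<close>
lemma shell_volume_R3:
  fixes t u e :: real
  assumes "e > 0"
  shows "(\<integral>\<^sup>+x. \<integral>\<^sup>+y. \<integral>\<^sup>+z. indicator {t - e<..<t + e} (x + y + z) *
            indicator {u - e<..<u + e} (x\<^sup>2 + y\<^sup>2 + z\<^sup>2) \<partial>lborel \<partial>lborel \<partial>lborel) \<le> ennreal (4 * pi * e\<^sup>2)"
proof -
  let ?T = "\<lambda>\<tau>. indicator {t - e<..<t + e} \<tau> :: ennreal"
  let ?U = "\<lambda>q. indicator {u - e<..<u + e} q :: ennreal"
  have inner: "(\<integral>\<^sup>+x. \<integral>\<^sup>+y. ?U (x\<^sup>2 + y\<^sup>2 + (\<tau> - x - y)\<^sup>2) \<partial>lborel \<partial>lborel) \<le> ennreal (2 * pi * e)" for \<tau>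
  proof -
    let ?J = "\<lambda>q. indicator {u - \<tau>\<^sup>2 / 3 - e<..<u - \<tau>\<^sup>2 / 3 + e} q :: ennreal"
    have "(\<integral>\<^sup>+x. \<integral>\<^sup>+y. ?U (x\<^sup>2 + y\<^sup>2 + (\<tau> - x - y)\<^sup>2) \<partial>lborel \<partial>lborel) =
      (\<integral>\<^sup>+x. \<integral>\<^sup>+y. ?J ((sqrt (3/2) * (x + - \<tau> / 3))\<^sup>2 + (sqrt 2 * (y + (x - \<tau>) / 2))\<^sup>2) \<partial>lborel \<partial>lborel)"
    proof (intro nn_integral_cong)
      fix x y :: real
      have "x\<^sup>2 + y\<^sup>2 + (\<tau> - x - y)\<^sup>2 = (sqrt (3/2) * (x + - \<tau> / 3))\<^sup>2 + (sqrt 2 * (y + (x - \<tau>) / 2))\<^sup>2 + \<tau>\<^sup>2 / 3"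
        unfolding power_mult_distrib by (simp add: power2_eq_square field_simps)
      then show "?U (x\<^sup>2 + y\<^sup>2 + (\<tau> - x - y)\<^sup>2) = ?J ((sqrt (3/2) * (x + - \<tau> / 3))\<^sup>2 + (sqrt 2 * (y + (x - \<tau>) / 2))\<^sup>2)"
        by (auto simp: indicator_def)
    qed
    also have "\<dots> = (\<integral>\<^sup>+x. \<integral>\<^sup>+y. ?J ((sqrt (3/2) * (x + - \<tau> / 3))\<^sup>2 + (sqrt 2 * y)\<^sup>2) \<partial>lborel \<partial>lborel)"
      by (intro nn_integral_cong nn_integral_lborel_shift[where f="\<lambda>y. ?J (_ + (sqrt 2 * y)\<^sup>2)"]) measurable
    also have "\<dots> = (\<integral>\<^sup>+x. \<integral>\<^sup>+y. ?J ((sqrt (3/2) * x)\<^sup>2 + (sqrt 2 * y)\<^sup>2) \<partial>lborel \<partial>lborel)"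
      by (rule nn_integral_lborel_shift[where f="\<lambda>x. \<integral>\<^sup>+y. ?J ((sqrt (3/2) * x)\<^sup>2 + (sqrt 2 * y)\<^sup>2) \<partial>lborel"]) measurable
    also have "\<dots> \<le> (\<integral>\<^sup>+x. \<integral>\<^sup>+y. ?J (x\<^sup>2 + (sqrt 2 * y)\<^sup>2) \<partial>lborel \<partial>lborel)"
      by (rule nn_integral_lborel_scale_le[where f="\<lambda>x. \<integral>\<^sup>+y. ?J (x\<^sup>2 + (sqrt 2 * y)\<^sup>2) \<partial>lborel"]) ((measurable)[1], simp)
    also have "\<dots> \<le> (\<integral>\<^sup>+x. \<integral>\<^sup>+y. ?J (x\<^sup>2 + y\<^sup>2) \<partial>lborel \<partial>lborel)"
      by (intro nn_integral_mono nn_integral_lborel_scale_le[where f="\<lambda>y. ?J (_ + y\<^sup>2)"]) ((measurable)[1], simp)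
    also have "\<dots> \<le> ennreal (2 * pi * e)"
      by (rule annulus_area) fact
    finally show ?thesis .
  qed
  have "(\<integral>\<^sup>+x. \<integral>\<^sup>+y. \<integral>\<^sup>+z. ?T (x + y + z) * ?U (x\<^sup>2 + y\<^sup>2 + z\<^sup>2) \<partial>lborel \<partial>lborel \<partial>lborel) =
    (\<integral>\<^sup>+x. \<integral>\<^sup>+y. \<integral>\<^sup>+\<tau>. ?T \<tau> * ?U (x\<^sup>2 + y\<^sup>2 + (\<tau> - x - y)\<^sup>2) \<partial>lborel \<partial>lborel \<partial>lborel)"
  proof (rule nn_integral_cong, rule nn_integral_cong)
    fix x y :: real
    show "(\<integral>\<^sup>+z. ?T (x + y + z) * ?U (x\<^sup>2 + y\<^sup>2 + z\<^sup>2) \<partial>lborel) =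
       (\<integral>\<^sup>+\<tau>. ?T \<tau> * ?U (x\<^sup>2 + y\<^sup>2 + (\<tau> - x - y)\<^sup>2) \<partial>lborel)"
      using nn_integral_lborel_shift[of "\<lambda>\<tau>. ?T \<tau> * ?U (x\<^sup>2 + y\<^sup>2 + (\<tau> - x - y)\<^sup>2)" "x + y"]
      by (simp add: algebra_simps)
  qed
  also have "\<dots> = (\<integral>\<^sup>+x. \<integral>\<^sup>+\<tau>. \<integral>\<^sup>+y. ?T \<tau> * ?U (x\<^sup>2 + y\<^sup>2 + (\<tau> - x - y)\<^sup>2) \<partial>lborel \<partial>lborel \<partial>lborel)"
    by (intro nn_integral_cong lborel_pair.Fubini') measurable
  also have "\<dots> = (\<integral>\<^sup>+\<tau>. \<integral>\<^sup>+x. \<integral>\<^sup>+y. ?T \<tau> * ?U (x\<^sup>2 + y\<^sup>2 + (\<tau> - x - y)\<^sup>2) \<partial>lborel \<partial>lborel \<partial>lborel)"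
    by (intro lborel_pair.Fubini') measurable
  also have "\<dots> = (\<integral>\<^sup>+\<tau>. ?T \<tau> * (\<integral>\<^sup>+x. \<integral>\<^sup>+y. ?U (x\<^sup>2 + y\<^sup>2 + (\<tau> - x - y)\<^sup>2) \<partial>lborel \<partial>lborel) \<partial>lborel)"
    by (intro nn_integral_cong) (simp add: nn_integral_cmult)
  also have "\<dots> \<le> (\<integral>\<^sup>+\<tau>. ?T \<tau> * ennreal (2 * pi * e) \<partial>lborel)"
    by (intro nn_integral_mono mult_left_mono inner) simp
  also have "\<dots> = ennreal (2 * e) * ennreal (2 * pi * e)"
    using assms by (subst nn_integral_multc) (auto simp: emeasure_lborel_Ioo)
  also have "\<dots> = ennreal (4 * pi * e\<^sup>2)"
    using assms by (simp add: ennreal_mult[symmetric] power2_eq_square)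
  finally show ?thesis .
qed

lemma borel_measurable_curried:
  fixes F :: "real \<Rightarrow> real \<Rightarrow> ennreal"
  assumes F: "(\<lambda>(t, u). F t u) \<in> borel_measurable borel"
    and [measurable]: "f \<in> borel_measurable M" "g \<in> borel_measurable M"
  shows "(\<lambda>x. F (f x) (g x)) \<in> borel_measurable M"
  using measurable_compose[OF _ F, of "\<lambda>x. (f x, g x)" M] by simp

text \<open>
  The change of variables \<open>(x, y) \<mapsto> (x + y, x\<^sup>2 + y\<^sup>2)\<close> on \<open>0 \<le> x \<le> y\<close> has the Jacobian
  \<open>2 (y - x)\<close>; the factor \<open>y - x\<close> in the integrand cancels it up to the constant 2. The range consists of the \<open>(t, u)\<close>
  with \<open>t\<^sup>2 / 2 \<le> u \<le> t\<^sup>2\<close>. It is carried out one variable at a time: \<open>x\<close> is replaced by \<open>t\<close>, and then,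
  for fixed \<open>t\<close>, the variable \<open>y\<close> by \<open>u = (t - y)\<^sup>2 + y\<^sup>2\<close>.
\<close>
lemma sum_square_substitution:
  fixes F :: "real \<Rightarrow> real \<Rightarrow> ennreal" and R :: "(real \<times> real) set"
  assumes F[measurable]: "(\<lambda>(t, u). F t u) \<in> borel_measurable borel"
    and supp: "\<And>t u. F t u \<noteq> 0 \<Longrightarrow> 0 < t \<and> u \<in> {t\<^sup>2 / 2..t\<^sup>2}"
  shows "(\<integral>\<^sup>+x. \<integral>\<^sup>+y. indicator {x..} y * indicator {0..} x * ennreal (y - x) * F (x + y) (x\<^sup>2 + y\<^sup>2) \<partial>lborel \<partial>lborel) =
     ennreal (1/2) * (\<integral>\<^sup>+t. \<integral>\<^sup>+u. F t u \<partial>lborel \<partial>lborel)"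
proof -
  note [measurable] = borel_measurable_curried[OF F]
  have "(\<integral>\<^sup>+x. \<integral>\<^sup>+y. indicator {x..} y * indicator {0..} x * ennreal (y - x) * F (x + y) (x\<^sup>2 + y\<^sup>2) \<partial>lborel \<partial>lborel) =
    (\<integral>\<^sup>+x. \<integral>\<^sup>+y. indicator {0..} (y - x) * indicator {0..} x * ennreal (y - x) * F (x + y) (x\<^sup>2 + y\<^sup>2) \<partial>lborel \<partial>lborel)"
    by (intro nn_integral_cong) (auto simp: indicator_def)
  also have "\<dots> = (\<integral>\<^sup>+y. \<integral>\<^sup>+x. indicator {0..} (y - x) * indicator {0..} x * ennreal (y - x) * F (x + y) (x\<^sup>2 + y\<^sup>2) \<partial>lborel \<partial>lborel)"
    by (rule lborel_pair.Fubini') measurable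
  also have "\<dots> = (\<integral>\<^sup>+y. \<integral>\<^sup>+t. indicator {0..} (2 * y - t) * indicator {0..} (t - y) * ennreal (2 * y - t) * F t ((t - y)\<^sup>2 + y\<^sup>2) \<partial>lborel \<partial>lborel)"
  proof (rule nn_integral_cong)
    fix y :: real
    show "(\<integral>\<^sup>+x. indicator {0..} (y - x) * indicator {0..} x * ennreal (y - x) * F (x + y) (x\<^sup>2 + y\<^sup>2) \<partial>lborel) =
      (\<integral>\<^sup>+t. indicator {0..} (2 * y - t) * indicator {0..} (t - y) * ennreal (2 * y - t) * F t ((t - y)\<^sup>2 + y\<^sup>2) \<partial>lborel)"
      using nn_integral_lborel_shift[of "\<lambda>t. indicator {0..} (2 * y - t) * indicator {0..} (t - y) * ennreal (2 * y - t) * F t ((t - y)\<^sup>2 + y\<^sup>2)" y]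
      by simp
  qed
  also have "\<dots> = (\<integral>\<^sup>+t. \<integral>\<^sup>+y. indicator {0..} (2 * y - t) * indicator {0..} (t - y) * ennreal (2 * y - t) * F t ((t - y)\<^sup>2 + y\<^sup>2) \<partial>lborel \<partial>lborel)"
    by (rule lborel_pair.Fubini') measurable
  also have "\<dots> = (\<integral>\<^sup>+t. ennreal (1/2) * (\<integral>\<^sup>+u. F t u \<partial>lborel) \<partial>lborel)"
  proof (intro nn_integral_cong)
    fix t :: real
    show "(\<integral>\<^sup>+y. indicator {0..} (2 * y - t) * indicator {0..} (t - y) * ennreal (2 * y - t) * F t ((t - y)\<^sup>2 + y\<^sup>2) \<partial>lborel) =
        ennreal (1/2) * (\<integral>\<^sup>+u. F t u \<partial>lborel)"
    proof (cases "t > 0")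
      case False
      then have "F t u = 0" for u using supp[of t u] by auto
      then show ?thesis by simp
    next
      case True
      let ?g = "\<lambda>y. (t - y)\<^sup>2 + y\<^sup>2"
      have "(\<integral>\<^sup>+u. F t u \<partial>lborel) = (\<integral>\<^sup>+u. F t u * indicator {?g (t/2)..?g t} u \<partial>lborel)"
      proof (intro nn_integral_cong)
        fix u
        have "?g (t/2) = t\<^sup>2 / 2" "?g t = t\<^sup>2" by (simp_all add: power2_eq_square field_simps)
        then show "F t u = F t u * indicator {?g (t/2)..?g t} u"
          using supp[of t u] by (cases "F t u = 0") (simp_all del: power_divide)
      qed
      also have "\<dots> = (\<integral>\<^sup>+y. F t (?g y) * ennreal (4 * y - 2 * t) * indicator {t/2..t} y \<partial>lborel)"
        using True by (intro nn_integral_substitution_aux) (auto intro!: derivative_eq_intros continuous_intros)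
      also have "\<dots> = (\<integral>\<^sup>+y. ennreal 2 * (indicator {0..} (2 * y - t) * indicator {0..} (t - y) * ennreal (2 * y - t) * F t (?g y)) \<partial>lborel)"
      proof (intro nn_integral_cong)
        fix y
        have "ennreal (4 * y - 2 * t) = ennreal 2 * ennreal (2 * y - t)"
          by (subst ennreal_mult'[symmetric]) auto
        then show "F t (?g y) * ennreal (4 * y - 2 * t) * indicator {t/2..t} y =
          ennreal 2 * (indicator {0..} (2 * y - t) * indicator {0..} (t - y) * ennreal (2 * y - t) * F t (?g y))"
          by (auto simp: indicator_def ac_simps)
      qed
      also have "\<dots> = ennreal 2 * (\<integral>\<^sup>+y. indicator {0..} (2 * y - t) * indicator {0..} (t - y) * ennreal (2 * y - t) * F t (?g y) \<partial>lborel)"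
        by (rule nn_integral_cmult) measurable
      finally have "ennreal (1/2) * (\<integral>\<^sup>+u. F t u \<partial>lborel) = (ennreal (1/2) * ennreal 2) * (\<integral>\<^sup>+y. indicator {0..} (2 * y - t) * indicator {0..} (t - y) * ennreal (2 * y - t) * F t (?g y) \<partial>lborel)"
        by (simp add: ac_simps)
      also have "ennreal (1/2) * ennreal 2 = 1"
        by (subst ennreal_mult[symmetric]) auto
      finally show ?thesis by simp
    qed
  qed
  also have "\<dots> = ennreal (1/2) * (\<integral>\<^sup>+t. \<integral>\<^sup>+u. F t u \<partial>lborel \<partial>lborel)"
    by (rule nn_integral_cmult) measurable
  finally show ?thesis .
qed

section \<open>Existence and uniqueness of the parameters\<close>
lemma gibbs_density_nonneg: "gibbs_density r s x \<ge> 0"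
  unfolding gibbs_density_def set_lebesgue_integral_def gibbs_weight_def
  by (intro divide_nonneg_nonneg mult_nonneg_nonneg Bochner_Integration.integral_nonneg) (auto simp: indicator_def)

lemma borel_measurable_gibbs_density[measurable]: "gibbs_density r s \<in> borel_measurable borel"
  unfolding gibbs_density_def[abs_def] gibbs_weight_def[abs_def] by measurable

lemma has_bochner_integral_exponential_moment:
  assumes "l > 0"
  shows "has_bochner_integral lborel (\<lambda>x. exponential_density l x * x ^ m) (fact m / l ^ m)"
proof (rule has_bochner_integral_nn_integral)
  show "(\<integral>\<^sup>+x. ennreal (exponential_density l x * x ^ m) \<partial>lborel) = ennreal (fact m / l ^ m)"
    using nn_integral_erlang_ith_moment[OF assms, of 0 m] by simp
qed (use assms in \<open>auto simp: erlang_density_def\<close>)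

lemma AE_lborel_interval_ex:
  assumes "AE x in lborel. P x" "a < (b :: real)"
  shows "\<exists>x. a < x \<and> x < b \<and> P x"
proof (rule ccontr)
  assume "\<not> ?thesis"
  with assms(1) have "AE x in lborel. x \<notin> {a<..<b}"
    by (auto elim!: eventually_mono)
  then have "emeasure lborel {a<..<b} = 0"
    by (subst (asm) AE_iff_measurable[of "{a<..<b}"]) auto
  then show False using assms(2) by simp
qed

lemma quadratic_three_zeros:
  fixes A B C x y z :: real
  assumes "A * x\<^sup>2 + B * x + C = 0" "A * y\<^sup>2 + B * y + C = 0" "A * z\<^sup>2 + B * z + C = 0"
    and "x < y" "y < z"
  shows "A = 0 \<and> B = 0"
proof -
  have "(y - x) * (A * (x + y) + B) = (A * y\<^sup>2 + B * y + C) - (A * x\<^sup>2 + B * x + C)"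
    by (simp add: power2_eq_square algebra_simps)
  then have 1: "A * (x + y) + B = 0" using assms by simp
  have "(z - y) * (A * (y + z) + B) = (A * z\<^sup>2 + B * z + C) - (A * y\<^sup>2 + B * y + C)"
    by (simp add: power2_eq_square algebra_simps)
  then have 2: "A * (y + z) + B = 0" using assms by simp
  have "A * (z - x) = (A * (y + z) + B) - (A * (x + y) + B)" by (simp add: algebra_simps)
  then have "A = 0" using 1 2 assms by simp
  then show ?thesis using 1 by simp
qed

text \<open>
  If the integral of the weight were 0, division by 0 would make the density 0 everywhere,
  which contradicts the first moment being 1.
\<close>
lemma moment_match_normalizer:
  assumes "moment_match b r s"
  shows "(LINT y:{0..}|lborel. gibbs_weight r s y) > 0" "has_bochner_integral lborel (gibbs_density r s) 1"
proof -
  let ?Z = "LINT y:{0..}|lborel. gibbs_weight r s y"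
  have "?Z \<noteq> 0"
  proof
    assume "?Z = 0"
    then have "gibbs_density r s = (\<lambda>x. 0)" by (auto simp: gibbs_density_def fun_eq_iff)
    with assms show False
      unfolding moment_match_def by (auto simp: has_bochner_integral_iff)
  qed
  moreover have "?Z \<ge> 0"
    unfolding set_lebesgue_integral_def
    by (intro Bochner_Integration.integral_nonneg) (auto simp: gibbs_weight_def)
  ultimately show Z: "?Z > 0" by simp
  have "has_bochner_integral lborel (\<lambda>x. indicator {0..} x * gibbs_weight r s x) ?Z"
    using assms unfolding moment_match_def set_integrable_def set_lebesgue_integral_def
    by (simp add: has_bochner_integral_iff)
  then have "has_bochner_integral lborel (\<lambda>x. indicator {0..} x * gibbs_weight r s x / ?Z) (?Z / ?Z)"
    by (intro has_bochner_integral_divide_zero)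
  then show "has_bochner_integral lborel (gibbs_density r s) 1"
    using Z by (simp add: gibbs_density_def[abs_def])
qed

text \<open>
  With \<open>p = e\<^bsup>u\<^esup> q\<close>, where \<open>u\<close> is a quadratic polynomial, the matching moments give
  \<open>\<integral> u (p - q) = 0\<close>, while \<open>u (p - q) = u (e\<^bsup>u\<^esup> - 1) q \<ge> 0\<close>. Hence \<open>u\<close> vanishes almost everywhere on the
  half-line, and three zeros suffice to make its coefficients vanish.
\<close>
lemma moment_match_unique:
  assumes m: "moment_match b r s" and m': "moment_match b r' s'"
  shows "r = r' \<and> s = s'"
proof -
  let ?p = "gibbs_density r s" and ?q = "gibbs_density r' s'"
  define Z where "Z = (LINT y:{0..}|lborel. gibbs_weight r s y)"
  define Z' where "Z' = (LINT y:{0..}|lborel. gibbs_weight r' s' y)"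
  have Z: "Z > 0" "Z' > 0" unfolding Z_def Z'_def by (rule moment_match_normalizer[OF m], rule moment_match_normalizer[OF m'])
  define u where "u = (\<lambda>x. (r' - r) * x\<^sup>2 + (s' - s) * x + (ln Z' - ln Z))"
  have pe: "?p x = exp (- r * x\<^sup>2 - s * x) / Z" and qe: "?q x = exp (- r' * x\<^sup>2 - s' * x) / Z'" if "x \<ge> 0" for x
    using that unfolding gibbs_density_def Z_def[symmetric] Z'_def[symmetric] by (simp_all add: gibbs_weight_def)
  have rel: "?p x = exp (u x) * ?q x" if "x \<ge> 0" for x
  proof -
    have "exp (u x) = exp (- r * x\<^sup>2 - s * x) / exp (- r' * x\<^sup>2 - s' * x) * (Z' / Z)"
      using Z by (simp add: u_def exp_add exp_diff algebra_simps flip: exp_minus) (simp add: exp_add exp_diff exp_minus field_simps)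
    then show ?thesis using that Z by (simp add: pe qe)
  qed
  have q: "?q x > 0" if "x \<ge> 0" for x
    using that Z by (simp add: qe)
  have pq: "has_bochner_integral lborel ?p 1" "has_bochner_integral lborel ?q 1"
    using moment_match_normalizer(2)[OF m] moment_match_normalizer(2)[OF m'] .
  have mm: "has_bochner_integral lborel (\<lambda>x. x * ?p x) 1" "has_bochner_integral lborel (\<lambda>x. x\<^sup>2 * ?p x) b"
    "has_bochner_integral lborel (\<lambda>x. x * ?q x) 1" "has_bochner_integral lborel (\<lambda>x. x\<^sup>2 * ?q x) b"
    using m m' unfolding moment_match_def by auto
  have "has_bochner_integral lborel (\<lambda>x. (r' - r) * (x\<^sup>2 * ?p x - x\<^sup>2 * ?q x) + (s' - s) * (x * ?p x - x * ?q x) + (ln Z' - ln Z) * (?p x - ?q x))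
     ((r' - r) * (b - b) + (s' - s) * (1 - 1) + (ln Z' - ln Z) * (1 - 1))"
    by (intro has_bochner_integral_add has_bochner_integral_mult_right has_bochner_integral_diff pq mm)
  moreover have "(\<lambda>x. (r' - r) * (x\<^sup>2 * ?p x - x\<^sup>2 * ?q x) + (s' - s) * (x * ?p x - x * ?q x) + (ln Z' - ln Z) * (?p x - ?q x)) = (\<lambda>x. u x * (?p x - ?q x))"
    by (simp add: u_def fun_eq_iff algebra_simps)
  ultimately have I: "has_bochner_integral lborel (\<lambda>x. u x * (?p x - ?q x)) 0" by simp
  have nonneg: "u x * (?p x - ?q x) \<ge> 0" for x
  proof (cases "x \<ge> 0")
    case True
    have eq: "u x * (?p x - ?q x) = (u x * (exp (u x) - 1)) * ?q x" using rel[OF True] by (simp add: algebra_simps)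
    have "u x * (exp (u x) - 1) \<ge> 0"
      by (cases "u x \<ge> 0") (auto intro!: mult_nonneg_nonneg mult_nonpos_nonpos)
    then show ?thesis unfolding eq using less_imp_le[OF q[OF True]] by (rule mult_nonneg_nonneg)
  qed (simp add: gibbs_density_def)
  have "AE x in lborel. u x * (?p x - ?q x) = 0"
    using I nonneg integral_nonneg_eq_0_iff_AE[of lborel "\<lambda>x. u x * (?p x - ?q x)"]
    by (simp add: has_bochner_integral_iff)
  then have AE: "AE x in lborel. x \<ge> 0 \<longrightarrow> u x = 0"
  proof eventually_elim
    case (elim x)
    show ?case
    proof
      assume x: "x \<ge> 0"
      have "u x * (exp (u x) - 1) * ?q x = 0" using elim rel[OF x] by (simp add: algebra_simps)
      then show "u x = 0" using q[OF x] by auto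
    qed
  qed
  \<comment> \<open>Three separate intervals supply three distinct zeros.\<close>
  obtain x where x: "0 < x" "x < 1" "u x = 0" using AE_lborel_interval_ex[OF AE, of 0 1] by auto
  obtain y where y: "1 < y" "y < 2" "u y = 0" using AE_lborel_interval_ex[OF AE, of 1 2] by auto
  obtain z where z: "2 < z" "z < 3" "u z = 0" using AE_lborel_interval_ex[OF AE, of 2 3] by auto
  have "r' - r = 0 \<and> s' - s = 0"
    by (rule quadratic_three_zeros[of _ x _ "ln Z' - ln Z" y z]) (use x y z in \<open>auto simp: u_def\<close>)
  then show ?thesis by simp
qed

definition gibbs_moment :: "real \<Rightarrow> real \<Rightarrow> nat \<Rightarrow> real" where
  "gibbs_moment r s k = (\<integral>x. indicator {0..} x * (x ^ k * gibbs_weight r s x) \<partial>lborel)"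

lemma moment_matchI:
  assumes int: "\<And>k. integrable lborel (\<lambda>x. indicator {0..} x * (x ^ k * gibbs_weight r s x))"
    and gibbs_moment: "gibbs_moment r s 0 > 0" "gibbs_moment r s 1 = gibbs_moment r s 0" "gibbs_moment r s 2 = b * gibbs_moment r s 0"
  shows "moment_match b r s"
proof -
  have Z: "(LINT y:{0..}|lborel. gibbs_weight r s y) = gibbs_moment r s 0"
    unfolding gibbs_moment_def set_lebesgue_integral_def by simp
  have m: "has_bochner_integral lborel (\<lambda>x. x ^ k * gibbs_density r s x) (gibbs_moment r s k / gibbs_moment r s 0)" for k
  proof -
    have "has_bochner_integral lborel (\<lambda>x. indicator {0..} x * (x ^ k * gibbs_weight r s x) / gibbs_moment r s 0) (gibbs_moment r s k / gibbs_moment r s 0)"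
      using int[of k] by (intro has_bochner_integral_divide_zero) (simp add: has_bochner_integral_iff gibbs_moment_def)
    then show ?thesis by (simp add: gibbs_density_def Z mult.left_commute)
  qed
  show ?thesis unfolding moment_match_def
    using int[of 0] m[of 1] m[of 2] gibbs_moment by (simp add: set_integrable_def)
qed

lemma moment_match_exponential: "moment_match 2 0 1"
proof (rule moment_matchI)
  have e: "indicator {0..} x * (x ^ k * gibbs_weight 0 1 x) = exponential_density 1 x * x ^ k" for x :: real and k
    by (auto simp: gibbs_weight_def erlang_density_def indicator_def)
  note h = has_bochner_integral_exponential_moment[of 1]
  show "integrable lborel (\<lambda>x. indicator {0..} x * (x ^ k * gibbs_weight 0 1 x))" for k
    unfolding e using h[of k] by (simp add: has_bochner_integral_iff)
  have "gibbs_moment 0 1 k = fact k" for k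
    unfolding gibbs_moment_def e using h[of k] by (simp add: has_bochner_integral_iff)
  then show "gibbs_moment 0 1 0 > 0" "gibbs_moment 0 1 1 = gibbs_moment 0 1 0" "gibbs_moment 0 1 2 = 2 * gibbs_moment 0 1 0" by simp_all
qed

lemma gauss_weight_le: "gibbs_weight 1 \<sigma> x \<le> exp ((1 - \<sigma>)\<^sup>2 / 4) * exp (- x)"
proof -
  have "0 \<le> (x - (1 - \<sigma>) / 2)\<^sup>2" by simp
  also have "\<dots> = x\<^sup>2 - (1 - \<sigma>) * x + (1 - \<sigma>)\<^sup>2 / 4" by (simp add: power2_eq_square field_simps)
  finally have "- 1 * x\<^sup>2 - \<sigma> * x \<le> (1 - \<sigma>)\<^sup>2 / 4 + - x" by (simp add: algebra_simps)
  then have "exp (- 1 * x\<^sup>2 - \<sigma> * x) \<le> exp ((1 - \<sigma>)\<^sup>2 / 4 + - x)" by (simp only: exp_le_cancel_iff)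
  then show ?thesis unfolding gibbs_weight_def by (simp only: exp_add)
qed

lemma integrable_gauss_moment: "integrable lborel (\<lambda>x. indicator {0..} x * (x ^ k * gibbs_weight 1 \<sigma> x))"
proof (rule Bochner_Integration.integrable_bound)
  show "integrable lborel (\<lambda>x. exp ((1 - \<sigma>)\<^sup>2 / 4) * (exponential_density 1 x * x ^ k))"
    using has_bochner_integral_exponential_moment[of 1 k]
    by (intro integrable_mult_right) (simp add: has_bochner_integral_iff)
  show "(\<lambda>x. indicator {0..} x * (x ^ k * gibbs_weight 1 \<sigma> x)) \<in> borel_measurable lborel"
    unfolding gibbs_weight_def by measurable
  show "AE x in lborel. norm (indicator {0..} x * (x ^ k * gibbs_weight 1 \<sigma> x)) \<le> norm (exp ((1 - \<sigma>)\<^sup>2 / 4) * (exponential_density 1 x * x ^ k))"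
  proof (rule AE_I2)
    fix x :: real
    show "norm (indicator {0..} x * (x ^ k * gibbs_weight 1 \<sigma> x)) \<le> norm (exp ((1 - \<sigma>)\<^sup>2 / 4) * (exponential_density 1 x * x ^ k))"
    proof (cases "x \<ge> 0")
      case True
      have "x ^ k * gibbs_weight 1 \<sigma> x \<le> x ^ k * (exp ((1 - \<sigma>)\<^sup>2 / 4) * exp (- x))"
        using True by (intro mult_left_mono gauss_weight_le) auto
      then show ?thesis using True by (simp add: erlang_density_def abs_mult gibbs_weight_def ac_simps)
    qed simp
  qed
qed

lemma gibbs_moment_pos: "gibbs_moment 1 \<sigma> k > 0"
proof -
  let ?f = "\<lambda>x. indicator {0..} x * (x ^ k * gibbs_weight 1 \<sigma> x) :: real"
  have nn: "?f x \<ge> 0" for x by (simp add: indicator_def gibbs_weight_def)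
  have "gibbs_moment 1 \<sigma> k \<ge> 0" unfolding gibbs_moment_def using nn by (intro Bochner_Integration.integral_nonneg)
  moreover have "gibbs_moment 1 \<sigma> k \<noteq> 0"
  proof
    assume "gibbs_moment 1 \<sigma> k = 0"
    then have "AE x in lborel. ?f x = 0"
      using integral_nonneg_eq_0_iff_AE[OF integrable_gauss_moment] nn by (simp add: gibbs_moment_def)
    from AE_lborel_interval_ex[OF this, of 0 1] show False by (auto simp: gibbs_weight_def)
  qed
  ultimately show ?thesis by simp
qed

text \<open>
  Integration by parts, that is, integrating the derivative of \<open>x\<^sup>k exp (- x\<^sup>2 - \<sigma> x)\<close> over the
  half-line.
\<close>
lemma gibbs_moment_recurrence:
  "2 * gibbs_moment 1 \<sigma> 1 + \<sigma> * gibbs_moment 1 \<sigma> 0 = 1"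
  "2 * gibbs_moment 1 \<sigma> (Suc (Suc k)) + \<sigma> * gibbs_moment 1 \<sigma> (Suc k) = real (Suc k) * gibbs_moment 1 \<sigma> k"
proof -
  let ?w = "gibbs_weight 1 \<sigma>"
  have FTC: "(\<integral>x. indicator {0..} x * f x \<partial>lborel) = - F 0"
    if der: "\<And>x. (F has_real_derivative f x) (at x)" and cont: "\<And>x. isCont f x"
      and int: "integrable lborel (\<lambda>x. indicator {0..} x * f x)" and lim: "(F \<longlongrightarrow> 0) at_top" for F f :: "real \<Rightarrow> real"
  proof -
    have ind: "AE x in lborel. indicator (einterval 0 \<infinity>) x *\<^sub>R f x = indicator {0..} x * f x"
      using AE_lborel_singleton[of "0::real"]
      by eventually_elim (auto simp: einterval_def indicator_def zero_ereal_def)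
    have im: "(\<lambda>x. indicator (einterval 0 \<infinity>) x *\<^sub>R f x) \<in> borel_measurable lborel"
      using borel_measurable_continuous_onI[of f] cont by (auto simp: continuous_on_eq_continuous_at)
    have "(LBINT x=0..\<infinity>. f x) = 0 - F 0"
    proof (rule interval_integral_FTC_integrable[where F=F])
      show "(F has_vector_derivative f x) (at x)" for x
        using der by (simp add: has_real_derivative_iff_has_vector_derivative)
      have "integrable lborel (\<lambda>x. indicator (einterval 0 \<infinity>) x *\<^sub>R f x)"
        using int ind im by (subst integrable_cong_AE[where g="\<lambda>x. indicator {0..} x * f x"]) (auto dest: borel_measurable_integrable)
      then show "set_integrable lborel (einterval 0 \<infinity>) f" by (simp add: set_integrable_def)
      have "isCont F 0" using der DERIV_isCont by blast
      then have "(F \<longlongrightarrow> F 0) (at_right 0)" by (simp add: isCont_def filterlim_at_split)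
      then show "((F \<circ> real_of_ereal) \<longlongrightarrow> F 0) (at_right 0)"
        by (simp add: zero_ereal_def ereal_tendsto_simps)
      show "((F \<circ> real_of_ereal) \<longlongrightarrow> 0) (at_left \<infinity>)"
        using lim by (simp add: ereal_tendsto_simps)
    qed (use cont in auto)
    also have "(LBINT x=0..\<infinity>. f x) = (\<integral>x. indicator (einterval 0 \<infinity>) x *\<^sub>R f x \<partial>lborel)"
      by (simp add: interval_lebesgue_integral_def set_lebesgue_integral_def)
    also have "\<dots> = (\<integral>x. indicator {0..} x * f x \<partial>lborel)"
      using im int ind by (intro integral_cong_AE) (auto dest: borel_measurable_integrable)
    finally show ?thesis by simp
  qed
  have lim: "((\<lambda>x. x ^ k * ?w x) \<longlongrightarrow> 0) at_top" for k
  proof -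
    have "((\<lambda>x::real. x ^ k / exp x) \<longlongrightarrow> 0) at_top" by (rule tendsto_power_div_exp_0)
    then have "((\<lambda>x::real. exp ((1 - \<sigma>)\<^sup>2 / 4) * (x ^ k / exp x)) \<longlongrightarrow> 0) at_top"
      by (rule tendsto_mult_right_zero)
    then show ?thesis
    proof (rule Lim_null_comparison[rotated])
      show "eventually (\<lambda>x. norm (x ^ k * ?w x) \<le> exp ((1 - \<sigma>)\<^sup>2 / 4) * (x ^ k / exp x)) at_top"
        using eventually_ge_at_top[of 0]
      proof eventually_elim
        case (elim x)
        have "x ^ k * ?w x \<le> x ^ k * (exp ((1 - \<sigma>)\<^sup>2 / 4) * exp (- x))"
          using elim by (intro mult_left_mono gauss_weight_le) auto
        then show ?case using elim by (simp add: abs_mult gibbs_weight_def exp_minus field_simps)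
      qed
    qed
  qed
  have dw: "(?w has_real_derivative (- 2 * x - \<sigma>) * ?w x) (at x)" for x
    unfolding gibbs_weight_def by (auto intro!: derivative_eq_intros)
  have cw: "isCont ?w x" for x using dw DERIV_isCont by blast
  note int = integrable_gauss_moment[of _ \<sigma>]
  have *: "(\<integral>x. indicator {0..} x * ((- 2 * x - \<sigma>) * ?w x) \<partial>lborel) = - 2 * gibbs_moment 1 \<sigma> 1 - \<sigma> * gibbs_moment 1 \<sigma> 0"
    "integrable lborel (\<lambda>x. indicator {0..} x * ((- 2 * x - \<sigma>) * ?w x))"
  proof -
    have e: "indicator {0..} x * ((- 2 * x - \<sigma>) * ?w x) =
        - 2 * (indicator {0..} x * (x ^ 1 * ?w x)) - \<sigma> * (indicator {0..} x * (x ^ 0 * ?w x))" for x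
      by (simp add: algebra_simps)
    show "(\<integral>x. indicator {0..} x * ((- 2 * x - \<sigma>) * ?w x) \<partial>lborel) = - 2 * gibbs_moment 1 \<sigma> 1 - \<sigma> * gibbs_moment 1 \<sigma> 0"
      unfolding e gibbs_moment_def using int[of 0] int[of 1] by (subst Bochner_Integration.integral_diff) (auto intro!: integrable_mult_right)
    show "integrable lborel (\<lambda>x. indicator {0..} x * ((- 2 * x - \<sigma>) * ?w x))"
      unfolding e using int[of 0] int[of 1] by (auto intro!: integrable_mult_right Bochner_Integration.integrable_diff)
  qed
  have "- 2 * gibbs_moment 1 \<sigma> 1 - \<sigma> * gibbs_moment 1 \<sigma> 0 = - ?w 0"
    unfolding *(1)[symmetric]
    by (rule FTC[OF dw _ *(2)]) (use cw lim[of 0] in \<open>auto intro!: continuous_intros\<close>)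
  then show "2 * gibbs_moment 1 \<sigma> 1 + \<sigma> * gibbs_moment 1 \<sigma> 0 = 1" by (simp add: gibbs_weight_def)
  let ?f = "\<lambda>x. real (Suc k) * x ^ k * ?w x + x ^ Suc k * ((- 2 * x - \<sigma>) * ?w x)"
  have **: "(\<integral>x. indicator {0..} x * ?f x \<partial>lborel) = real (Suc k) * gibbs_moment 1 \<sigma> k - 2 * gibbs_moment 1 \<sigma> (Suc (Suc k)) - \<sigma> * gibbs_moment 1 \<sigma> (Suc k)"
    "integrable lborel (\<lambda>x. indicator {0..} x * ?f x)"
  proof -
    have e: "indicator {0..} x * ?f x = real (Suc k) * (indicator {0..} x * (x ^ k * ?w x)) - 2 * (indicator {0..} x * (x ^ (Suc (Suc k)) * ?w x))
        - \<sigma> * (indicator {0..} x * (x ^ (Suc k) * ?w x))" for x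
      by (simp add: algebra_simps)
    have i: "integrable lborel (\<lambda>x. c * (indicator {0..} x * (x ^ k * ?w x)))" for c k
      using int[of k] by (rule integrable_mult_right)
    show "(\<integral>x. indicator {0..} x * ?f x \<partial>lborel) = real (Suc k) * gibbs_moment 1 \<sigma> k - 2 * gibbs_moment 1 \<sigma> (Suc (Suc k)) - \<sigma> * gibbs_moment 1 \<sigma> (Suc k)"
      unfolding e gibbs_moment_def
      by (subst Bochner_Integration.integral_diff, intro Bochner_Integration.integrable_diff i, rule i,
          subst Bochner_Integration.integral_diff, rule i, rule i) simp
    show "integrable lborel (\<lambda>x. indicator {0..} x * ?f x)"
      unfolding e by (intro Bochner_Integration.integrable_diff i)
  qed
  have "real (Suc k) * gibbs_moment 1 \<sigma> k - 2 * gibbs_moment 1 \<sigma> (Suc (Suc k)) - \<sigma> * gibbs_moment 1 \<sigma> (Suc k) = - (0 ^ Suc k * ?w 0)"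
    unfolding **(1)[symmetric]
  proof (rule FTC[OF _ _ **(2) lim])
    show "((\<lambda>x. x ^ Suc k * ?w x) has_real_derivative ?f x) (at x)" for x
      using dw[of x] by (auto intro!: derivative_eq_intros simp del: power_Suc)
    show "isCont ?f x" for x using cw by (auto intro!: continuous_intros)
  qed
  then show "2 * gibbs_moment 1 \<sigma> (Suc (Suc k)) + \<sigma> * gibbs_moment 1 \<sigma> (Suc k) = real (Suc k) * gibbs_moment 1 \<sigma> k" by simp
qed

text \<open>
  Along a convergent sequence the parameters are bounded below by some \<open>- B\<close>, and the integrand
  with parameter \<open>- B\<close> dominates.
\<close>
lemma isCont_gibbs_moment: "isCont (\<lambda>\<sigma>. gibbs_moment 1 \<sigma> k) \<sigma>"
  unfolding continuous_at_sequentially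
proof (intro allI impI)
  fix X assume X: "X \<longlonglongrightarrow> \<sigma>"
  then obtain B where B: "\<And>n. \<bar>X n\<bar> \<le> B"
    by (metis Bseq_def convergent_def convergent_imp_Bseq real_norm_def)
  show "((\<lambda>\<sigma>. gibbs_moment 1 \<sigma> k) \<circ> X) \<longlonglongrightarrow> gibbs_moment 1 \<sigma> k"
    unfolding comp_def gibbs_moment_def
  proof (rule integral_dominated_convergence)
    show "integrable lborel (\<lambda>x. indicator {0..} x * (x ^ k * gibbs_weight 1 (- B) x))" by (rule integrable_gauss_moment)
    show "AE x in lborel. (\<lambda>n. indicator {0..} x * (x ^ k * gibbs_weight 1 (X n) x)) \<longlonglongrightarrow> indicator {0..} x * (x ^ k * gibbs_weight 1 \<sigma> x)"
      unfolding gibbs_weight_def by (intro AE_I2 tendsto_intros X)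
    show "AE x in lborel. norm (indicator {0..} x * (x ^ k * gibbs_weight 1 (X n) x)) \<le> indicator {0..} x * (x ^ k * gibbs_weight 1 (- B) x)" for n
    proof (rule AE_I2)
      fix x :: real
      show "norm (indicator {0..} x * (x ^ k * gibbs_weight 1 (X n) x)) \<le> indicator {0..} x * (x ^ k * gibbs_weight 1 (- B) x)"
      proof (cases "x \<ge> 0")
        case True
        have "- X n * x \<le> B * x" using True B[of n] by (intro mult_right_mono) auto
        then show ?thesis using True by (auto simp: gibbs_weight_def abs_mult intro!: mult_left_mono)
      qed simp
    qed
  qed (rule borel_measurable_integrable[OF integrable_gauss_moment])+
qed

text \<open>
  Intermediate value theorem in \<open>\<sigma>\<close>. Both sign conditions come from the recurrence alone. Write
  \<open>m\<^sub>k\<close> for the moments. For \<open>\<sigma> = - 2 \<tau>\<close> it gives \<open>m\<^sub>1 \<ge> \<tau> m\<^sub>0\<close> and \<open>m\<^sub>2 = \<tau> m\<^sub>1 + m\<^sub>0 / 2\<close>, so that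
  \<open>m\<^sub>2 m\<^sub>0\<close> is at most a multiple of \<open>m\<^sub>1\<^sup>2\<close> that is close to 1. For large \<open>\<sigma> > 0\<close> it gives
  \<open>\<sigma> m\<^sub>1 \<le> m\<^sub>0\<close> and \<open>\<sigma> m\<^sub>2 = 2 m\<^sub>1 - 2 m\<^sub>3\<close> with \<open>\<sigma> m\<^sub>3 \<le> m\<^sub>1\<close>, so that
  \<open>m\<^sub>2 m\<^sub>0 / m\<^sub>1\<^sup>2\<close> is at least a number close to 2.
\<close>
lemma gauss_ratio_surj:
  assumes "1 < b" "b < 2"
  shows "\<exists>\<sigma>. gibbs_moment 1 \<sigma> 2 * gibbs_moment 1 \<sigma> 0 = b * (gibbs_moment 1 \<sigma> 1)\<^sup>2"
proof -
  define g where "g = (\<lambda>\<sigma>. gibbs_moment 1 \<sigma> 2 * gibbs_moment 1 \<sigma> 0 - b * (gibbs_moment 1 \<sigma> 1)\<^sup>2)"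
  have cont: "isCont g \<sigma>" for \<sigma> unfolding g_def by (intro continuous_intros isCont_gibbs_moment)
  note pos = gibbs_moment_pos
  have low: "\<exists>\<tau>>0. g (- 2 * \<tau>) \<le> 0"
  proof -
    \<comment> \<open>Chosen so that \<open>\<tau> (b - 1) \<ge> 1\<close>, which bounds \<open>m\<^sub>0\<^sup>2 / 2\<close> by \<open>(b - 1) m\<^sub>1\<^sup>2\<close>.\<close>
    define \<tau> where "\<tau> = 1 / (b - 1) + 1"
    have \<tau>: "\<tau> \<ge> 1" "\<tau> * (b - 1) \<ge> 1" using assms by (simp_all add: \<tau>_def distrib_right)
    let ?z = "gibbs_moment 1 (- 2 * \<tau>) 0" and ?a = "gibbs_moment 1 (- 2 * \<tau>) 1" and ?c = "gibbs_moment 1 (- 2 * \<tau>) 2"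
    have 1: "2 * ?a - 2 * \<tau> * ?z = 1" using gibbs_moment_recurrence(1)[of "- 2 * \<tau>"] by simp
    have 2: "2 * ?c - 2 * \<tau> * ?a = ?z" using gibbs_moment_recurrence(2)[of "- 2 * \<tau>" 0] by (simp add: numeral_2_eq_2)
    have z: "?z > 0" "?a > 0" using pos by auto
    have az: "\<tau> * ?z \<le> ?a" using 1 by linarith
    have c: "?c = \<tau> * ?a + ?z / 2" using 2 by linarith
    have "?c * ?z = \<tau> * ?z * ?a + ?z * ?z / 2" unfolding c by (simp add: distrib_right)
    also have "\<dots> \<le> ?a * ?a + (b - 1) * (?a * ?a)"
    proof (rule add_mono)
      show "\<tau> * ?z * ?a \<le> ?a * ?a" using az z by (intro mult_right_mono) auto
      have "?z \<le> \<tau> * ?z" using \<tau> z by simp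
      then have za: "?z \<le> ?a" using az by linarith
      have "?z * ?z \<le> (\<tau> * (b - 1)) * (?z * ?z)" using \<tau> z by simp
      also have "\<dots> = (b - 1) * ((\<tau> * ?z) * ?z)" by simp
      also have "\<dots> \<le> (b - 1) * (?a * ?a)"
        using az za z assms \<tau> by (intro mult_left_mono mult_mono) auto
      finally show "?z * ?z / 2 \<le> (b - 1) * (?a * ?a)" using mult_pos_pos[OF z(1) z(1)] by linarith
    qed
    also have "\<dots> = b * ?a\<^sup>2" by (simp add: power2_eq_square algebra_simps)
    finally show ?thesis using \<tau> by (intro exI[of _ \<tau>]) (auto simp: g_def)
  qed
  have high: "\<exists>\<sigma>>0. g \<sigma> \<ge> 0"
  proof -
    \<comment> \<open>Large enough for \<open>\<sigma> m\<^sub>3 \<le> m\<^sub>1\<close> to imply \<open>2 m\<^sub>3 \<le> (2 - b) m\<^sub>1\<close>.\<close>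
    define \<sigma> where "\<sigma> = 12 / (2 - b) + 12"
    have gen: "c * (12 / c + 12) \<ge> 12" if "c > 0" for c :: real using that by (simp add: distrib_left)
    have \<sigma>: "\<sigma> \<ge> 12" using assms by (simp add: \<sigma>_def)
    have \<sigma>': "(2 - b) * \<sigma> \<ge> 12" unfolding \<sigma>_def by (rule gen) (use assms in simp)
    let ?z = "gibbs_moment 1 \<sigma> 0" and ?a = "gibbs_moment 1 \<sigma> 1" and ?c = "gibbs_moment 1 \<sigma> 2" and ?d = "gibbs_moment 1 \<sigma> 3" and ?e = "gibbs_moment 1 \<sigma> 4"
    have p: "?z > 0" "?a > 0" "?c > 0" "?d > 0" "?e > 0" by (rule pos)+
    have 2: "2 * ?c + \<sigma> * ?a = ?z" using gibbs_moment_recurrence(2)[of \<sigma> 0] by (simp add: numeral_2_eq_2)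
    have 3: "2 * ?d + \<sigma> * ?c = 2 * ?a" using gibbs_moment_recurrence(2)[of \<sigma> 1] by (simp add: numeral_2_eq_2 numeral_3_eq_3)
    have 4: "2 * ?e + \<sigma> * ?d = 3 * ?c" using gibbs_moment_recurrence(2)[of \<sigma> 2] by (simp add: numeral_eq_Suc)
    have "\<sigma> * ?d \<le> 3 * ?c" using 4 p by linarith
    moreover have "12 * ?d \<le> \<sigma> * ?d" "12 * ?c \<le> \<sigma> * ?c" using \<sigma> p by (intro mult_right_mono; simp)+
    moreover have "\<sigma> * ?c \<le> 2 * ?a" using 3 p by linarith
    ultimately have d: "\<sigma> * ?d \<le> ?a" "0 < ?d" using p by linarith+
    have "2 * ?d \<le> (2 - b) * ?a"
    proof -
      have "12 * ?d \<le> (2 - b) * \<sigma> * ?d" using \<sigma>' p by (intro mult_right_mono) auto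
      also have "\<dots> = (2 - b) * (\<sigma> * ?d)" by simp
      also have "\<dots> \<le> (2 - b) * ?a" using d assms by (intro mult_left_mono) auto
      finally show ?thesis using d by linarith
    qed
    then have "b * ?a \<le> \<sigma> * ?c" using 3 by (simp add: algebra_simps)
    then have "b * ?a * ?a \<le> \<sigma> * ?c * ?a" using p by (intro mult_right_mono) auto
    also have "\<dots> = (\<sigma> * ?a) * ?c" by simp
    also have "\<dots> \<le> ?z * ?c" using 2 p by (intro mult_right_mono) auto
    finally show ?thesis using \<sigma> by (intro exI[of _ \<sigma>]) (auto simp: g_def power2_eq_square ac_simps)
  qed
  obtain \<tau> \<sigma> where "\<tau> > 0" "g (- 2 * \<tau>) \<le> 0" "\<sigma> > 0" "g \<sigma> \<ge> 0" using low high by blast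
  then have "\<exists>x. - 2 * \<tau> \<le> x \<and> x \<le> \<sigma> \<and> g x = 0"
    by (intro IVT) (auto simp: cont)
  then show ?thesis by (auto simp: g_def)
qed

lemma gibbs_moment_scale:
  assumes m: "m > 0"
  shows "gibbs_moment (m\<^sup>2) (\<sigma> * m) k = gibbs_moment 1 \<sigma> k / m ^ Suc k"
    and "integrable lborel (\<lambda>x. indicator {0..} x * (x ^ k * gibbs_weight (m\<^sup>2) (\<sigma> * m) x))"
proof -
  let ?f = "\<lambda>x. indicator {0..} x * (x ^ k * gibbs_weight 1 \<sigma> x) :: real"
  have e: "?f (0 + m * x) = m ^ k * (indicator {0..} x * (x ^ k * gibbs_weight (m\<^sup>2) (\<sigma> * m) x))" for x
    using m by (auto simp: indicator_def gibbs_weight_def power_mult_distrib zero_le_mult_iff mult.assoc)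
  have "integrable lborel (\<lambda>x. ?f (0 + m * x))"
    using integrable_gauss_moment m by (intro lborel_integrable_real_affine) auto
  then have "integrable lborel (\<lambda>x. m ^ k * (indicator {0..} x * (x ^ k * gibbs_weight (m\<^sup>2) (\<sigma> * m) x)))"
    unfolding e .
  then show "integrable lborel (\<lambda>x. indicator {0..} x * (x ^ k * gibbs_weight (m\<^sup>2) (\<sigma> * m) x))"
    using m by simp
  have "gibbs_moment 1 \<sigma> k = \<bar>m\<bar> *\<^sub>R (\<integral>x. ?f (0 + m * x) \<partial>lborel)"
    unfolding gibbs_moment_def using m by (intro lborel_integral_real_affine) auto
  also have "\<dots> = m * (m ^ k * gibbs_moment (m\<^sup>2) (\<sigma> * m) k)"
    unfolding e using m by (simp add: gibbs_moment_def)
  finally show "gibbs_moment (m\<^sup>2) (\<sigma> * m) k = gibbs_moment 1 \<sigma> k / m ^ Suc k" using m by (simp add: field_simps)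
qed

text \<open>
  The ratio of moments does not change under scaling, so a solution of the ratio equation can be
  rescaled to have mean 1.
\<close>
lemma moment_match_exists:
  assumes "1 < b" "b \<le> 2"
  shows "\<exists>r s. moment_match b r s \<and> (if b < 2 then r > 0 else r = 0 \<and> s = 1)"
proof (cases "b < 2")
  case False
  then have "b = 2" using assms by simp
  then show ?thesis using moment_match_exponential by auto
next
  case True
  then obtain \<sigma> where \<sigma>: "gibbs_moment 1 \<sigma> 2 * gibbs_moment 1 \<sigma> 0 = b * (gibbs_moment 1 \<sigma> 1)\<^sup>2" using gauss_ratio_surj assms by blast
  define m where "m = gibbs_moment 1 \<sigma> 1 / gibbs_moment 1 \<sigma> 0"
  have p: "gibbs_moment 1 \<sigma> 0 > 0" "gibbs_moment 1 \<sigma> 1 > 0" by (rule gibbs_moment_pos)+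
  then have m: "m > 0" by (simp add: m_def)
  have "moment_match b (m\<^sup>2) (\<sigma> * m)"
  proof (rule moment_matchI)
    show "integrable lborel (\<lambda>x. indicator {0..} x * (x ^ k * gibbs_weight (m\<^sup>2) (\<sigma> * m) x))" for k
      by (rule gibbs_moment_scale(2)[OF m])
    show "gibbs_moment (m\<^sup>2) (\<sigma> * m) 0 > 0" using p m by (simp add: gibbs_moment_scale(1)[OF m])
    have a: "gibbs_moment 1 \<sigma> 1 = m * gibbs_moment 1 \<sigma> 0" using p by (simp add: m_def)
    have "gibbs_moment 1 \<sigma> 2 * gibbs_moment 1 \<sigma> 0 = (b * m\<^sup>2 * gibbs_moment 1 \<sigma> 0) * gibbs_moment 1 \<sigma> 0"
      unfolding \<sigma> a by (simp add: power2_eq_square)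
    then have c: "gibbs_moment 1 \<sigma> 2 = b * m\<^sup>2 * gibbs_moment 1 \<sigma> 0" using p by simp
    show "gibbs_moment (m\<^sup>2) (\<sigma> * m) 1 = gibbs_moment (m\<^sup>2) (\<sigma> * m) 0"
      unfolding gibbs_moment_scale(1)[OF m] a using m by simp
    show "gibbs_moment (m\<^sup>2) (\<sigma> * m) 2 = b * gibbs_moment (m\<^sup>2) (\<sigma> * m) 0"
      unfolding gibbs_moment_scale(1)[OF m] c using m by (simp add: power2_eq_square power3_eq_cube)
  qed
  then show ?thesis using True m by (intro exI[of _ "m\<^sup>2"] exI[of _ "\<sigma> * m"]) auto
qed

section \<open>The one-site law and its tails\<close>

locale gibbs =
  fixes b r s :: real
  assumes match: "moment_match b r s"
    and decay: "r > 0 \<or> r = 0 \<and> s > 0"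
begin

definition normalizer :: real where "normalizer = (LINT y:{0..}|lborel. gibbs_weight r s y)"

abbreviation p :: "real \<Rightarrow> real" where "p \<equiv> gibbs_density r s"

definition \<mu> :: "real measure" where "\<mu> = density lborel (\<lambda>x. ennreal (p x))"

lemma p_eq: "p x = indicator {0..} x * gibbs_weight r s x / normalizer"
  unfolding gibbs_density_def normalizer_def ..

lemma normalizer_pos: "normalizer > 0"
  unfolding normalizer_def by (rule moment_match_normalizer[OF match])

lemma p_nonneg [simp]: "p x \<ge> 0" by (rule gibbs_density_nonneg)

lemma has_bochner_integral_p: "has_bochner_integral lborel p 1"
  by (rule moment_match_normalizer[OF match])

lemma sets_\<mu> [measurable_cong, simp]: "sets \<mu> = sets borel"
  and space_\<mu> [simp]: "space \<mu> = UNIV"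
  by (simp_all add: \<mu>_def)

sublocale \<mu>: prob_space \<mu>
proof
  have "emeasure \<mu> (space \<mu>) = (\<integral>\<^sup>+x. ennreal (p x) \<partial>lborel)"
    by (simp add: \<mu>_def emeasure_density)
  also have "\<dots> = 1"
    using has_bochner_integral_p
    by (subst nn_integral_eq_integral) (auto simp: has_bochner_integral_iff)
  finally show "emeasure \<mu> (space \<mu>) = 1" .
qed

lemma AE_\<mu>_pos: "AE x in \<mu>. 0 < x"
  unfolding \<mu>_def
proof (subst AE_density)
  have "AE x in lborel. x \<noteq> (0::real)" by (rule AE_lborel_singleton)
  then show "AE x in lborel. 0 < ennreal (p x) \<longrightarrow> 0 < x"
    by eventually_elim (auto simp: p_eq indicator_def split: if_splits)
qed measurable

text \<open>
  Half of the quadratic term is kept for Gaussian tails; the other half absorbs the possibly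
  growing factor \<open>exp (- s x)\<close> at the price of a constant and leaves \<open>exp (- x)\<close> over. If \<open>r = 0\<close>, the
  density is itself exponential.
\<close>
lemma density_domination:
  obtains C \<kappa> where "C > 0" "\<kappa> > 0" "\<And>x. p x \<le> C * exp (- (r/2) * x\<^sup>2) * exponential_density \<kappa> x"
proof -
  have main: "p x \<le> C / (normalizer * \<kappa>) * exp (- (r/2) * x\<^sup>2) * exponential_density \<kappa> x"
    if "\<kappa> > 0" "C > 0" and *: "\<And>x. x \<ge> 0 \<Longrightarrow> exp (- r * x\<^sup>2 - s * x) \<le> C * exp (- (r/2) * x\<^sup>2) * exp (- x * \<kappa>)" for C \<kappa> x
  proof (cases "x \<ge> 0")
    case True
    have "p x = exp (- r * x\<^sup>2 - s * x) / normalizer" using True by (simp add: p_eq gibbs_weight_def)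
    also have "\<dots> \<le> (C * exp (- (r/2) * x\<^sup>2) * exp (- x * \<kappa>)) / normalizer"
      using *[OF True] normalizer_pos by (intro divide_right_mono) auto
    also have "\<dots> = C / (normalizer * \<kappa>) * exp (- (r/2) * x\<^sup>2) * exponential_density \<kappa> x"
      using True that by (simp add: erlang_density_def)
    finally show ?thesis .
  qed (auto simp: p_eq erlang_density_def)
  show thesis
  proof (cases "r > 0")
    case True
    let ?C = "exp ((1 - s)\<^sup>2 / (2 * r))"
    have "exp (- r * x\<^sup>2 - s * x) \<le> ?C * exp (- (r/2) * x\<^sup>2) * exp (- x * 1)" for x
    proof -
      have "0 \<le> (r * x - (1 - s))\<^sup>2 / (2 * r)" using True by simp
      also have "\<dots> = (r / 2) * x\<^sup>2 - (1 - s) * x + (1 - s)\<^sup>2 / (2 * r)"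
        using True by (simp add: power2_eq_square field_simps)
      finally have "- r * x\<^sup>2 - s * x \<le> (1 - s)\<^sup>2 / (2 * r) + - (r/2) * x\<^sup>2 + - x * 1"
        by (simp add: field_simps)
      then have "exp (- r * x\<^sup>2 - s * x) \<le> exp ((1 - s)\<^sup>2 / (2 * r) + - (r/2) * x\<^sup>2 + - x * 1)"
        by (simp only: exp_le_cancel_iff)
      then show ?thesis by (simp only: exp_add)
    qed
    from main[OF _ _ this, of x for x] show thesis
      by (intro that[of "?C / (normalizer * 1)" 1]) (use normalizer_pos in auto)
  next
    case False
    with decay have "r = 0" "s > 0" by auto
    then show thesis
      using main[of s 1] normalizer_pos by (intro that[of "1 / (normalizer * s)" s]) (auto simp: mult.commute)
  qed
qed

lemma density_bounded: obtains B where "B > 0" "\<And>x. p x \<le> B"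
proof -
  obtain C \<kappa> where C: "C > 0" "\<kappa> > 0" and *: "\<And>x. p x \<le> C * exp (- (r/2) * x\<^sup>2) * exponential_density \<kappa> x"
    by (rule density_domination) blast
  have "p x \<le> C * \<kappa>" for x
  proof -
    have "p x \<le> C * exp (- (r/2) * x\<^sup>2) * exponential_density \<kappa> x" by (rule *)
    also have "\<dots> \<le> C * 1 * \<kappa>"
      using C decay by (intro mult_mono) (auto simp: erlang_density_def)
    finally show ?thesis by simp
  qed
  then show thesis using C by (intro that[of "C * \<kappa>"]) auto
qed

lemma integrable_\<mu>_power [simp]: "integrable \<mu> (\<lambda>x. x ^ m)"
proof -
  obtain C \<kappa> where C: "C > 0" "\<kappa> > 0" and *: "\<And>x. p x \<le> C * exp (- (r/2) * x\<^sup>2) * exponential_density \<kappa> x"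
    by (rule density_domination) blast
  have "integrable lborel (\<lambda>x. C * (exponential_density \<kappa> x * x ^ m))"
    using has_bochner_integral_exponential_moment[OF \<open>\<kappa> > 0\<close>, of m]
    by (intro integrable_mult_right) (auto simp: has_bochner_integral_iff)
  then have "integrable lborel (\<lambda>x. p x *\<^sub>R x ^ m)"
  proof (rule Bochner_Integration.integrable_bound)
    show "AE x in lborel. norm (p x *\<^sub>R x ^ m) \<le> norm (C * (exponential_density \<kappa> x * x ^ m))"
    proof (rule AE_I2)
      fix x
      have "exp (- (r/2) * x\<^sup>2) \<le> 1" using decay by auto
      then have "C * exp (- (r/2) * x\<^sup>2) * exponential_density \<kappa> x \<le> C * 1 * exponential_density \<kappa> x"
        using C by (intro mult_right_mono mult_left_mono) (auto simp: erlang_density_def)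
      then have "p x \<le> C * exponential_density \<kappa> x" using *[of x] by simp
      then have "p x * \<bar>x ^ m\<bar> \<le> C * exponential_density \<kappa> x * \<bar>x ^ m\<bar>"
        by (intro mult_right_mono) auto
      then show "norm (p x *\<^sub>R x ^ m) \<le> norm (C * (exponential_density \<kappa> x * x ^ m))"
        using C by (simp add: abs_mult erlang_density_def)
    qed
  qed measurable
  then show ?thesis
    unfolding \<mu>_def by (subst integrable_density) auto
qed

lemma \<mu>_mean: "(\<integral>x. x \<partial>\<mu>) = 1" and \<mu>_mean_square: "(\<integral>x. x\<^sup>2 \<partial>\<mu>) = b"
  using match unfolding moment_match_def \<mu>_def
  by (simp_all add: integral_density has_bochner_integral_iff mult.commute)

lemma \<mu>_tail:
  obtains C \<kappa> where "C > 0" "\<kappa> > 0" "\<And>t. t \<ge> 0 \<Longrightarrow> measure \<mu> {t<..} \<le> C * exp (- (r/2) * t\<^sup>2 - \<kappa> * t)"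
proof -
  obtain C \<kappa> where C: "C > 0" "\<kappa> > 0" and *: "\<And>x. p x \<le> C * exp (- (r/2) * x\<^sup>2) * exponential_density \<kappa> x"
    by (rule density_domination) blast
  have "measure \<mu> {t<..} \<le> C * exp (- (r/2) * t\<^sup>2 - \<kappa> * t)" if "t \<ge> 0" for t
  proof -
    let ?E = "density lborel (exponential_density \<kappa>)"
    have E: "prob_space ?E" by (rule prob_space_exponential_density) fact
    have "emeasure \<mu> {t<..} = (\<integral>\<^sup>+x. ennreal (p x) * indicator {t<..} x \<partial>lborel)"
      by (simp add: \<mu>_def emeasure_density)
    also have "\<dots> \<le> (\<integral>\<^sup>+x. ennreal (C * exp (- (r/2) * t\<^sup>2)) * (ennreal (exponential_density \<kappa> x) * indicator {t<..} x) \<partial>lborel)"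
    proof (rule nn_integral_mono)
      fix x
      show "ennreal (p x) * indicator {t<..} x \<le> ennreal (C * exp (- (r/2) * t\<^sup>2)) * (ennreal (exponential_density \<kappa> x) * indicator {t<..} x)"
      proof (cases "x > t")
        case True
        have "p x \<le> C * exp (- (r/2) * x\<^sup>2) * exponential_density \<kappa> x" by (rule *)
        also have "\<dots> \<le> C * exp (- (r/2) * t\<^sup>2) * exponential_density \<kappa> x"
        proof (intro mult_right_mono mult_left_mono)
          have "t\<^sup>2 \<le> x\<^sup>2" using True that by (intro power_mono) auto
          then have "r * t\<^sup>2 \<le> r * x\<^sup>2" using decay by (intro mult_left_mono) auto
          then show "exp (- (r/2) * x\<^sup>2) \<le> exp (- (r/2) * t\<^sup>2)" by simp
        qed (use C in \<open>auto simp: erlang_density_def\<close>)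
        finally show ?thesis using True C
          by (simp add: ennreal_mult[symmetric] erlang_density_def)
      qed simp
    qed
    also have "\<dots> = ennreal (C * exp (- (r/2) * t\<^sup>2)) * emeasure ?E {t<..}"
      by (simp add: nn_integral_cmult emeasure_density)
    also have "emeasure ?E {t<..} = ennreal (exp (- t * \<kappa>))"
    proof -
      have "emeasure ?E {t<..} = ennreal (measure ?E {t<..})"
        using E by (simp add: prob_space_def finite_measure.emeasure_eq_measure)
      also have "measure ?E {t<..} = exp (- t * \<kappa>)"
        using prob_space.exponential_distributed_memoryless prob_space.exponential_distributedD_gt[OF E, of "\<lambda>x. x" \<kappa> t] that C
        by (simp add: distributed_def distr_id2 greaterThan_def)
      finally show ?thesis .
    qed
    also have "ennreal (C * exp (- (r/2) * t\<^sup>2)) * ennreal (exp (- t * \<kappa>)) = ennreal (C * exp (- (r/2) * t\<^sup>2 - \<kappa> * t))"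
      using C by (simp add: ennreal_mult[symmetric] exp_add[symmetric] mult.assoc algebra_simps)
    finally show ?thesis
      using C by (simp add: \<mu>.emeasure_eq_measure)
  qed
  then show thesis using C by (intro that)
qed

end

section \<open>The product measure and its intersection with thin shells\<close>

text \<open>
  The condition that defines a shell, with an arbitrary target \<open>(v, w)\<close> for the two sums and
  without positivity of the coordinates.
\<close>
definition sums_near :: "nat \<Rightarrow> real \<Rightarrow> real \<Rightarrow> real \<Rightarrow> (nat \<Rightarrow> real) set" where
  "sums_near n e v w = {x. \<bar>(\<Sum>i<n. x i) - v\<bar> < e \<and> \<bar>(\<Sum>i<n. (x i)\<^sup>2) - w\<bar> < e}"

definition ignores :: "nat set \<Rightarrow> ((nat \<Rightarrow> real) \<Rightarrow> 'a) \<Rightarrow> bool" where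
  "ignores T g \<longleftrightarrow> (\<forall>x y. (\<forall>l. l \<notin> T \<longrightarrow> x l = y l) \<longrightarrow> g x = g y)"

lemma ignoresD: "ignores T g \<Longrightarrow> (\<And>l. l \<notin> T \<Longrightarrow> x l = y l) \<Longrightarrow> g x = g y"
  unfolding ignores_def by blast

lemma indicator_sums_near:
  "(indicator (sums_near n e v w) x :: ennreal) =
     indicator {v - e<..<v + e} (\<Sum>i<n. x i) * indicator {w - e<..<w + e} (\<Sum>i<n. (x i)\<^sup>2)"
  unfolding sums_near_def indicator_def by (auto simp: abs_less_iff)

lemma measurable_indicator_sums_near[measurable]:
  assumes [measurable_cong]: "\<And>i. i < n \<Longrightarrow> sets (N i) = sets borel"
  shows "(indicator (sums_near n e v w) :: _ \<Rightarrow> ennreal) \<in> borel_measurable (PiM {..<n} N)"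
proof -
  have [measurable]: "(\<lambda>x. x i) \<in> borel_measurable (PiM {..<n} N)" if "i < n" for i
    using measurable_component_singleton[of i "{..<n}" N] that assms
    by (simp cong: measurable_cong_sets)
  show ?thesis unfolding indicator_sums_near[abs_def] by measurable
qed

definition block :: "nat \<Rightarrow> nat \<Rightarrow> (nat \<Rightarrow> real) \<Rightarrow> nat \<Rightarrow> real" where
  "block c k x = (\<lambda>i\<in>{..<k}. x (c + i))"

context gibbs
begin

definition G :: "nat \<Rightarrow> (nat \<Rightarrow> real) measure" where "G n = PiM {..<n} (\<lambda>_. \<mu>)"

sublocale prod: product_prob_space "\<lambda>_::nat. \<mu>" UNIV
  by unfold_locales

sublocale G: prob_space "G n" for n
  unfolding G_def by (rule prob_space_PiM) (rule \<mu>.prob_space_axioms)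

lemma sets_G [measurable_cong]: "sets (G n) = sets (PiM {..<n} (\<lambda>_. borel))"
  unfolding G_def by (rule sets_PiM_cong) auto

lemma space_G: "space (G n) = {..<n} \<rightarrow>\<^sub>E UNIV"
  unfolding G_def by (simp add: space_PiM)

lemma AE_G_pos: "AE x in G k. \<forall>i\<in>{..<k}. 0 < x i"
  unfolding G_def using AE_\<mu>_pos \<mu>.prob_space_axioms
  by (intro AE_finite_allI AE_PiM_component) auto

lemma nn_integral_\<mu>_le:
  assumes [measurable]: "f \<in> borel_measurable borel" and B: "\<And>x. p x \<le> B"
  shows "(\<integral>\<^sup>+x. f x \<partial>\<mu>) \<le> ennreal B * (\<integral>\<^sup>+x. f x \<partial>lborel)"
  unfolding \<mu>_def
  by (subst nn_integral_density, measurable, subst nn_integral_cmult[symmetric], measurable)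
    (intro nn_integral_mono mult_right_mono ennreal_leI B, simp)

lemma \<mu>_shell_bound:
  assumes B: "B > 0" "\<And>x. p x \<le> B" and e: "e > 0"
  shows "(\<integral>\<^sup>+x. \<integral>\<^sup>+y. \<integral>\<^sup>+z. indicator {t - e<..<t + e} (x + y + z) *
            indicator {u - e<..<u + e} (x\<^sup>2 + y\<^sup>2 + z\<^sup>2) \<partial>\<mu> \<partial>\<mu> \<partial>\<mu>) \<le> ennreal (4 * pi * B ^ 3 * e\<^sup>2)"
    (is "?L \<le> _")
proof -
  let ?f = "\<lambda>x y z. indicator {t - e<..<t + e} (x + y + z) * indicator {u - e<..<u + e} (x\<^sup>2 + y\<^sup>2 + z\<^sup>2) :: ennreal"
  have "?L \<le> (\<integral>\<^sup>+x. \<integral>\<^sup>+y. ennreal B * (\<integral>\<^sup>+z. ?f x y z \<partial>lborel) \<partial>\<mu> \<partial>\<mu>)"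
    by (intro nn_integral_mono nn_integral_\<mu>_le B) measurable
  also have "\<dots> \<le> (\<integral>\<^sup>+x. ennreal B * (\<integral>\<^sup>+y. ennreal B * (\<integral>\<^sup>+z. ?f x y z \<partial>lborel) \<partial>lborel) \<partial>\<mu>)"
    by (intro nn_integral_mono nn_integral_\<mu>_le B) measurable
  also have "\<dots> \<le> ennreal B * (\<integral>\<^sup>+x. ennreal B * (\<integral>\<^sup>+y. ennreal B * (\<integral>\<^sup>+z. ?f x y z \<partial>lborel) \<partial>lborel) \<partial>lborel)"
    by (intro nn_integral_\<mu>_le B) measurable
  also have "\<dots> = ennreal B * (ennreal B * (ennreal B * (\<integral>\<^sup>+x. \<integral>\<^sup>+y. \<integral>\<^sup>+z. ?f x y z \<partial>lborel \<partial>lborel \<partial>lborel)))"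
    by (simp add: nn_integral_cmult)
  also have "\<dots> \<le> ennreal B * (ennreal B * (ennreal B * ennreal (4 * pi * e\<^sup>2)))"
    by (intro mult_left_mono shell_volume_R3 e) auto
  also have "\<dots> = ennreal (4 * pi * B ^ 3 * e\<^sup>2)"
    using B by (simp add: ennreal_mult[symmetric] power3_eq_cube ac_simps)
  finally show ?thesis .
qed

lemma measurable_upd [measurable]:
  assumes "f \<in> measurable N (PiM I (\<lambda>_. \<mu>))" "h \<in> borel_measurable N"
  shows "(\<lambda>x. (f x)(i := h x)) \<in> measurable N (PiM (insert i I) (\<lambda>_. \<mu>))"
  by (rule measurable_fun_upd[OF _ assms(1)]) (use assms(2) in \<open>auto cong: measurable_cong_sets\<close>)

lemma nn_integral_split2:
  fixes i j :: nat
  assumes f[measurable]: "f \<in> borel_measurable (PiM (insert i (insert j I)) (\<lambda>_. \<mu>))"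
    and I: "finite I" "i \<noteq> j" "i \<notin> I" "j \<notin> I"
  shows "(\<integral>\<^sup>+x. f x \<partial>PiM (insert i (insert j I)) (\<lambda>_. \<mu>)) =
    (\<integral>\<^sup>+x. \<integral>\<^sup>+z. \<integral>\<^sup>+y. f (x(j := z, i := y)) \<partial>\<mu> \<partial>\<mu> \<partial>PiM I (\<lambda>_. \<mu>))"
proof -
  have "(\<integral>\<^sup>+x. f x \<partial>PiM (insert i (insert j I)) (\<lambda>_. \<mu>)) =
     (\<integral>\<^sup>+x. (\<integral>\<^sup>+y. f (x(i := y)) \<partial>\<mu>) \<partial>PiM (insert j I) (\<lambda>_. \<mu>))"
    using I by (intro prod.product_nn_integral_insert) auto
  also have "\<dots> = (\<integral>\<^sup>+x. \<integral>\<^sup>+z. \<integral>\<^sup>+y. f (x(j := z, i := y)) \<partial>\<mu> \<partial>\<mu> \<partial>PiM I (\<lambda>_. \<mu>))"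
  proof (rule prod.product_nn_integral_insert)
    show "(\<lambda>x. \<integral>\<^sup>+y. f (x(i := y)) \<partial>\<mu>) \<in> borel_measurable (PiM (insert j I) (\<lambda>_. \<mu>))"
      by measurable
  qed (use I in auto)
  finally show ?thesis .
qed

lemma nn_integral_split3:
  fixes i j k :: nat
  assumes f[measurable]: "f \<in> borel_measurable (PiM (insert i (insert j (insert k I))) (\<lambda>_. \<mu>))"
    and I: "finite I" "i \<noteq> j" "i \<noteq> k" "j \<noteq> k" "i \<notin> I" "j \<notin> I" "k \<notin> I"
  shows "(\<integral>\<^sup>+x. f x \<partial>PiM (insert i (insert j (insert k I))) (\<lambda>_. \<mu>)) =
    (\<integral>\<^sup>+x. \<integral>\<^sup>+w. \<integral>\<^sup>+z. \<integral>\<^sup>+y. f (x(k := w, j := z, i := y)) \<partial>\<mu> \<partial>\<mu> \<partial>\<mu> \<partial>PiM I (\<lambda>_. \<mu>))"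
proof -
  have "(\<integral>\<^sup>+x. f x \<partial>PiM (insert i (insert j (insert k I))) (\<lambda>_. \<mu>)) =
     (\<integral>\<^sup>+x. (\<integral>\<^sup>+z. \<integral>\<^sup>+y. f (x(j := z, i := y)) \<partial>\<mu> \<partial>\<mu>) \<partial>PiM (insert k I) (\<lambda>_. \<mu>))"
    using I by (intro nn_integral_split2) auto
  also have "\<dots> = (\<integral>\<^sup>+x. \<integral>\<^sup>+w. \<integral>\<^sup>+z. \<integral>\<^sup>+y. f (x(k := w, j := z, i := y)) \<partial>\<mu> \<partial>\<mu> \<partial>\<mu> \<partial>PiM I (\<lambda>_. \<mu>))"
  proof (rule prod.product_nn_integral_insert)
    show "(\<lambda>x. \<integral>\<^sup>+z. \<integral>\<^sup>+y. f (x(j := z, i := y)) \<partial>\<mu> \<partial>\<mu>) \<in> borel_measurable (PiM (insert k I) (\<lambda>_. \<mu>))"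
      by measurable
  qed (use I in auto)
  finally show ?thesis .
qed

text \<open>
  The other coordinates are fixed, \<open>g\<close> becomes a constant, and the integral over the three
  coordinates in \<open>T\<close> is at most a constant times \<open>e\<^sup>2\<close>, uniformly in the fixed ones.
\<close>
lemma sums_near_bound:
  assumes B: "B > 0" "\<And>x. p x \<le> B" and e: "e > 0"
    and T: "card T = 3" "T \<subseteq> {..<n}"
    and g[measurable]: "g \<in> borel_measurable (G n)" and dep: "ignores T g"
  shows "(\<integral>\<^sup>+x. g x * indicator (sums_near n e v w) x \<partial>G n) \<le> ennreal (4 * pi * B ^ 3 * e\<^sup>2) * (\<integral>\<^sup>+x. g x \<partial>G n)"
proof -
  obtain i j k where ijk: "T = {i, j, k}" "i \<noteq> j" "i \<noteq> k" "j \<noteq> k"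
    using T by (auto simp: card_3_iff)
  define I where "I = {..<n} - {i, j, k}"
  have I: "finite I" "i \<notin> I" "j \<notin> I" "k \<notin> I" by (auto simp: I_def)
  have n: "{..<n} = insert i (insert j (insert k I))" using T ijk by (auto simp: I_def)
  have Gn: "G n = PiM (insert i (insert j (insert k I))) (\<lambda>_. \<mu>)" by (simp add: G_def n)
  have gm[measurable]: "g \<in> borel_measurable (PiM (insert i (insert j (insert k I))) (\<lambda>_. \<mu>))"
    using g by (simp add: Gn)
  have [measurable]: "(indicator (sums_near n e v w) :: _ \<Rightarrow> ennreal) \<in> borel_measurable (PiM (insert i (insert j (insert k I))) (\<lambda>_. \<mu>))"
    unfolding n[symmetric] by (rule measurable_indicator_sums_near) simp
  \<comment> \<open>Since \<open>g\<close> ignores the three coordinates, they may be set to 0; this makes \<open>g\<close> measurable on the remaining product.\<close>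
  define g' where "g' = (\<lambda>x. g (x(k := 0, j := 0, i := 0)))"
  have g_upd: "g (x(k := w, j := z, i := y)) = g' x" for x w z y
    unfolding g'_def by (rule ignoresD[OF dep]) (auto simp: ijk)
  have [measurable]: "g' \<in> borel_measurable (PiM I (\<lambda>_. \<mu>))" unfolding g'_def by measurable
  have sums: "(\<Sum>l<n. (x(k := w, j := z, i := y)) l) = (\<Sum>l\<in>I. x l) + (w + z + y)"
    "(\<Sum>l<n. ((x(k := w, j := z, i := y)) l)\<^sup>2) = (\<Sum>l\<in>I. (x l)\<^sup>2) + (w\<^sup>2 + z\<^sup>2 + y\<^sup>2)" for x :: "nat \<Rightarrow> real" and w z y
  proof -
    have "(\<Sum>l\<in>I. (x(k := w, j := z, i := y)) l) = (\<Sum>l\<in>I. x l)"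
      "(\<Sum>l\<in>I. ((x(k := w, j := z, i := y)) l)\<^sup>2) = (\<Sum>l\<in>I. (x l)\<^sup>2)"
      by (rule sum.cong; use I in auto)+
    then show "(\<Sum>l<n. (x(k := w, j := z, i := y)) l) = (\<Sum>l\<in>I. x l) + (w + z + y)"
      "(\<Sum>l<n. ((x(k := w, j := z, i := y)) l)\<^sup>2) = (\<Sum>l\<in>I. (x l)\<^sup>2) + (w\<^sup>2 + z\<^sup>2 + y\<^sup>2)"
      unfolding n using I ijk by simp_all
  qed
  have hit: "(indicator (sums_near n e v w) (x(k := x1, j := x2, i := x3)) :: ennreal) =
      indicator {(v - (\<Sum>l\<in>I. x l)) - e<..<(v - (\<Sum>l\<in>I. x l)) + e} (x1 + x2 + x3) *
      indicator {(w - (\<Sum>l\<in>I. (x l)\<^sup>2)) - e<..<(w - (\<Sum>l\<in>I. (x l)\<^sup>2)) + e} (x1\<^sup>2 + x2\<^sup>2 + x3\<^sup>2)" for x x1 x2 x3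
    unfolding indicator_sums_near sums by (auto simp: indicator_def)
  have "(\<integral>\<^sup>+x. g x * indicator (sums_near n e v w) x \<partial>G n) =
     (\<integral>\<^sup>+x. \<integral>\<^sup>+x1. \<integral>\<^sup>+x2. \<integral>\<^sup>+x3. g (x(k := x1, j := x2, i := x3)) *
         indicator (sums_near n e v w) (x(k := x1, j := x2, i := x3)) \<partial>\<mu> \<partial>\<mu> \<partial>\<mu> \<partial>PiM I (\<lambda>_. \<mu>))"
    unfolding Gn using ijk I by (intro nn_integral_split3) auto
  also have "\<dots> = (\<integral>\<^sup>+x. g' x * (\<integral>\<^sup>+x1. \<integral>\<^sup>+x2. \<integral>\<^sup>+x3. 
      indicator {(v - (\<Sum>l\<in>I. x l)) - e<..<(v - (\<Sum>l\<in>I. x l)) + e} (x1 + x2 + x3) *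
      indicator {(w - (\<Sum>l\<in>I. (x l)\<^sup>2)) - e<..<(w - (\<Sum>l\<in>I. (x l)\<^sup>2)) + e} (x1\<^sup>2 + x2\<^sup>2 + x3\<^sup>2) \<partial>\<mu> \<partial>\<mu> \<partial>\<mu>) \<partial>PiM I (\<lambda>_. \<mu>))"
    unfolding g_upd hit by (intro nn_integral_cong) (simp add: nn_integral_cmult)
  also have "\<dots> \<le> (\<integral>\<^sup>+x. g' x * ennreal (4 * pi * B ^ 3 * e\<^sup>2) \<partial>PiM I (\<lambda>_. \<mu>))"
    by (intro nn_integral_mono mult_left_mono \<mu>_shell_bound B e) simp
  also have "\<dots> = ennreal (4 * pi * B ^ 3 * e\<^sup>2) * (\<integral>\<^sup>+x. g' x \<partial>PiM I (\<lambda>_. \<mu>))"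
    by (subst nn_integral_multc) (auto simp: mult.commute)
  also have "(\<integral>\<^sup>+x. g' x \<partial>PiM I (\<lambda>_. \<mu>)) = (\<integral>\<^sup>+x. g x \<partial>G n)"
  proof -
    have "(\<integral>\<^sup>+x. g x \<partial>G n) = (\<integral>\<^sup>+x. \<integral>\<^sup>+x1. \<integral>\<^sup>+x2. \<integral>\<^sup>+x3. g (x(k := x1, j := x2, i := x3)) \<partial>\<mu> \<partial>\<mu> \<partial>\<mu> \<partial>PiM I (\<lambda>_. \<mu>))"
      unfolding Gn using ijk I by (intro nn_integral_split3) auto
    then show ?thesis unfolding g_upd by (simp add: \<mu>.emeasure_space_1[simplified])
  qed
  finally show ?thesis .
qed

lemma measurable_G_component:
  "i < n \<Longrightarrow> (\<lambda>x. x i) \<in> borel_measurable (G n)"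
  unfolding G_def using measurable_component_singleton[of i "{..<n}" "\<lambda>_. \<mu>"]
  by (simp cong: measurable_cong_sets)

lemma measurable_block:
  assumes "c + k \<le> n"
  shows "block c k \<in> measurable (G n) (PiM {..<k} (\<lambda>_. \<mu>))"
  unfolding block_def[abs_def]
proof (rule measurable_restrict)
  fix i assume "i \<in> {..<k}"
  then show "(\<lambda>x. x (c + i)) \<in> measurable (G n) \<mu>"
    unfolding G_def using assms by (intro measurable_component_singleton) auto
qed

lemma distr_block:
  assumes "c + k \<le> n"
  shows "distr (G n) (G k) (block c k) = G k"
  using distr_PiM_reindex[of "{..<n}" "\<lambda>_. \<mu>" "\<lambda>i. c + i" "{..<k}"] assms \<mu>.prob_space_axioms
  unfolding G_def block_def[abs_def] by (auto simp: inj_on_def)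

lemma integral_block:
  assumes "c + k \<le> n" "f \<in> borel_measurable (PiM {..<k} (\<lambda>_. borel))"
  shows "(\<integral>x. f (block c k x) \<partial>G n) = (\<integral>x. (f x :: real) \<partial>G k)"
proof -
  have [measurable]: "f \<in> borel_measurable (G k)" using assms(2) by (simp cong: measurable_cong_sets add: sets_G)
  have "(\<integral>x. f x \<partial>distr (G n) (G k) (block c k)) = (\<integral>x. f (block c k x) \<partial>G n)"
    using measurable_block[OF assms(1)] by (intro integral_distr) (auto simp: G_def)
  then show ?thesis unfolding distr_block[OF assms(1)] by simp
qed

lemma indep_coordinates: "G.indep_vars n (\<lambda>_. \<mu>) (\<lambda>i x. x i) {..<n}"
proof (cases "n = 0")
  case True
  then show ?thesis by (simp add: G.indep_vars_def G.indep_sets_def)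
next
  case False
  have rv: "(\<lambda>x. x i) \<in> measurable (G n) \<mu>" if "i \<in> {..<n}" for i
    unfolding G_def using that by (intro measurable_component_singleton) auto
  have "distr (G n) (PiM {..<n} (\<lambda>_. \<mu>)) (\<lambda>x. \<lambda>i\<in>{..<n}. x i) = distr (G n) (G n) (\<lambda>x. x)"
    by (rule distr_cong) (auto simp: G_def space_PiM extensional_restrict PiE_def)
  also have "\<dots> = G n" by (rule distr_id)
  also have "\<dots> = PiM {..<n} (\<lambda>i. distr (G n) \<mu> (\<lambda>x. x i))"
    unfolding G_def
    by (rule PiM_cong) (auto simp: distr_PiM_component[OF \<mu>.prob_space_axioms])
  finally show ?thesis
    using False rv by (subst G.indep_vars_iff_distr_eq_PiM') auto
qed

lemma indep_blocks:
  assumes n: "c + k * N \<le> n" and f: "f \<in> borel_measurable (PiM {..<k} (\<lambda>_. borel))"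
  shows "G.indep_vars n (\<lambda>_. borel) (\<lambda>j x. f (block (c + k * j) k x) :: real) {..<N}"
proof -
  define S where "S = (\<lambda>j. {c + k * j..<c + k * j + k})"
  have le: "c + k * j + k \<le> n" if "j < N" for j
  proof -
    have "k * (j + 1) \<le> k * N" using that by (intro mult_left_mono) auto
    then show ?thesis using n by simp
  qed
  have "disjoint_family_on S {..<N}"
  proof -
    have "S i \<inter> S j = {}" if "i < j" for i j
    proof -
      have "k * (i + 1) \<le> k * j" using that by (intro mult_left_mono) auto
      then show ?thesis by (auto simp: S_def)
    qed
    then show ?thesis unfolding disjoint_family_on_def by (metis Int_commute linorder_neq_iff)
  qed
  then have "G.indep_vars n (\<lambda>j. PiM (S j) (\<lambda>_. \<mu>)) (\<lambda>j x. restrict (\<lambda>i. x i) (S j)) {..<N}"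
    using le by (intro G.indep_vars_restrict[OF indep_coordinates]) (force simp: S_def)+
  then have "G.indep_vars n (\<lambda>_. borel) (\<lambda>j x. f (block (c + k * j) k (restrict (\<lambda>i. x i) (S j)))) {..<N}"
  proof (rule G.indep_vars_compose2)
    fix j assume "j \<in> {..<N}"
    have "block (c + k * j) k \<in> measurable (PiM (S j) (\<lambda>_. \<mu>)) (PiM {..<k} (\<lambda>_. borel))"
      unfolding block_def[abs_def]
    proof (rule measurable_restrict)
      fix i assume "i \<in> {..<k}"
      then show "(\<lambda>x. x (c + k * j + i)) \<in> borel_measurable (PiM (S j) (\<lambda>_. \<mu>))"
        using measurable_component_singleton[of "c + k * j + i" "S j" "\<lambda>_. \<mu>"]
        by (simp add: S_def cong: measurable_cong_sets)
    qed
    from measurable_compose[OF this f]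
    show "(\<lambda>x. f (block (c + k * j) k x)) \<in> borel_measurable (PiM (S j) (\<lambda>_. \<mu>))" .
  qed
  also have "(\<lambda>j x. f (block (c + k * j) k (restrict (\<lambda>i. x i) (S j)))) = (\<lambda>j x. f (block (c + k * j) k x))"
    by (intro ext arg_cong[where f=f]) (auto simp: block_def S_def)
  finally show ?thesis .
qed

text \<open>
  The blocks are disjoint, so the summands are independent, and each block has the law \<open>G k\<close>.
\<close>
lemma block_Hoeffding:
  fixes f :: "(nat \<Rightarrow> real) \<Rightarrow> real"
  assumes n: "c + k * N \<le> n" and N: "N > 0" and f: "f \<in> borel_measurable (PiM {..<k} (\<lambda>_. borel))"
    and bnd: "\<And>x. f x \<in> {lo..hi}" "lo < hi" and t: "t \<ge> 0"
  shows "measure (G n) {x \<in> space (G n). \<bar>(\<Sum>j<N. f (block (c + k * j) k x)) - real N * (\<integral>x. f x \<partial>G k)\<bar> \<ge> t}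
     \<le> 2 * exp (- 2 * t\<^sup>2 / (real N * (hi - lo)\<^sup>2))"
proof -
  have le: "c + k * j + k \<le> n" if "j < N" for j
  proof -
    have "k * (j + 1) \<le> k * N" using that by (intro mult_left_mono) auto
    then show ?thesis using n by simp
  qed
  interpret H: Hoeffding_ineq "G n" "{..<N}" "\<lambda>j x. f (block (c + k * j) k x)" "\<lambda>_. lo" "\<lambda>_. hi"
    "real N * (\<integral>x. f x \<partial>G k)"
  proof unfold_locales
    show "G.indep_vars n (\<lambda>_. borel) (\<lambda>j x. f (block (c + k * j) k x)) {..<N}"
      by (rule indep_blocks) fact+
    show "real N * (\<integral>x. f x \<partial>G k) \<equiv> \<Sum>j<N. (\<integral>x. f (block (c + k * j) k x) \<partial>G n)"
      by (rule eq_reflection) (simp add: integral_block[OF le f])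
  qed (use bnd in auto)
  show ?thesis
    using H.Hoeffding_ineq_abs_ge[OF t] bnd(2) N by simp
qed

end

section \<open>A Harnack inequality for the law of the two sums\<close>

context gibbs
begin

definition pair_scale :: real where "pair_scale = 1 / (5 * normalizer\<^sup>2 * exp (11 * r + 5 * \<bar>s\<bar>))"

text \<open>
  Up to a constant, the factor \<open>z - y\<close> cancels the Jacobian of \<open>(y, z) \<mapsto> (y + z, y\<^sup>2 + z\<^sup>2)\<close> and the denominator cancels
  the density of the two coordinates, so that the weight turns their law into a multiple of the
  uniform distribution on the rectangle with lower left corner \<open>(c, d)\<close>.
\<close>
definition pair_weight :: "real \<Rightarrow> real \<Rightarrow> real \<Rightarrow> real \<Rightarrow> real" where
  "pair_weight c d y z = pair_scale * max 0 (z - y) * indicator {0..} y * indicator {c..c + 1/10} (y + z) *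
     indicator {d..d + 1/10} (y\<^sup>2 + z\<^sup>2) / (p y * p z)"

lemma pair_scale_pos: "pair_scale > 0" unfolding pair_scale_def using normalizer_pos by simp

lemma measurable_pair_weight [measurable]:
  assumes [measurable]: "f \<in> borel_measurable M" "g \<in> borel_measurable M"
  shows "(\<lambda>x. pair_weight c d (f x) (g x)) \<in> borel_measurable M"
  unfolding pair_weight_def by measurable

text \<open>
  On the support, \<open>1 / (p y * p z)\<close> is \<open>exp (r u + s t)\<close> up to the normalizer, where \<open>t\<close> and \<open>u\<close> are
  bounded; \<open>pair_scale\<close> is chosen to compensate for these bounds.
\<close>
lemma pair_weight_bounds:
  assumes "\<bar>c - 4\<bar> \<le> 1/10" "\<bar>d - 10\<bar> \<le> 1/10"
  shows "pair_weight c d y z \<in> {0..1}"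
proof (cases "0 \<le> y \<and> y < z \<and> y + z \<in> {c..c + 1/10} \<and> y\<^sup>2 + z\<^sup>2 \<in> {d..d + 1/10}")
  case False
  then show ?thesis by (auto simp: pair_weight_def indicator_def max_def)
next
  case True
  have cd: "39/10 \<le> c" "c \<le> 41/10" "99/10 \<le> d" "d \<le> 101/10" using assms by linarith+
  have "pair_weight c d y z = pair_scale * (z - y) / (p y * p z)" using True by (simp add: pair_weight_def)
  also have "\<dots> = pair_scale * (z - y) * (normalizer\<^sup>2 * exp (r * (y\<^sup>2 + z\<^sup>2) + s * (y + z)))"
    using True normalizer_pos
    by (simp add: p_eq gibbs_weight_def power2_eq_square exp_add[symmetric] field_simps)
  also have "\<dots> \<le> pair_scale * 5 * (normalizer\<^sup>2 * exp (11 * r + 5 * \<bar>s\<bar>))"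
  proof (intro mult_mono)
    have "y\<^sup>2 + z\<^sup>2 \<le> 11" using True assms unfolding atLeastAtMost_iff by linarith
    then have "r * (y\<^sup>2 + z\<^sup>2) \<le> r * 11" using decay by (intro mult_left_mono) auto
    moreover have "s * (y + z) \<le> \<bar>s\<bar> * 5"
      using True cd by (intro mult_mono) auto
    ultimately show "exp (r * (y\<^sup>2 + z\<^sup>2) + s * (y + z)) \<le> exp (11 * r + 5 * \<bar>s\<bar>)" by simp
  qed (use True cd pair_scale_pos in auto)
  also have "\<dots> = 1" using normalizer_pos by (simp add: pair_scale_def)
  finally have "pair_weight c d y z \<le> 1" .
  moreover have "pair_weight c d y z \<ge> 0"
    unfolding pair_weight_def using pair_scale_pos by (intro divide_nonneg_nonneg mult_nonneg_nonneg) auto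
  ultimately show ?thesis by simp
qed

text \<open>
  Under the weight, the pair \<open>(y + z, y\<^sup>2 + z\<^sup>2)\<close> is uniform on a rectangle. For corners close to
  \<open>(4, 10)\<close>, the values at \<open>y = 1, z = 3\<close>, the rectangle lies inside the range
  \<open>t\<^sup>2 / 2 \<le> u \<le> t\<^sup>2\<close> of the change of variables.
\<close>
lemma nn_integral_pair_weight:
  fixes F :: "real \<Rightarrow> real \<Rightarrow> ennreal"
  assumes c: "\<bar>c - 4\<bar> \<le> 1/10" "\<bar>d - 10\<bar> \<le> 1/10"
    and F[measurable]: "(\<lambda>(t, u). F t u) \<in> borel_measurable borel"
  shows "(\<integral>\<^sup>+y. \<integral>\<^sup>+z. ennreal (pair_weight c d y z) * F (y + z) (y\<^sup>2 + z\<^sup>2) \<partial>\<mu> \<partial>\<mu>) =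
     ennreal (pair_scale / 2) * (\<integral>\<^sup>+t. \<integral>\<^sup>+u. indicator {c..c + 1/10} t * indicator {d..d + 1/10} u * F t u \<partial>lborel \<partial>lborel)"
proof -
  let ?F = "\<lambda>t u. indicator {c..c + 1/10} t * indicator {d..d + 1/10} u * F t u :: ennreal"
  note [measurable] = borel_measurable_curried[OF F]
  have "(\<integral>\<^sup>+y. \<integral>\<^sup>+z. ennreal (pair_weight c d y z) * F (y + z) (y\<^sup>2 + z\<^sup>2) \<partial>\<mu> \<partial>\<mu>) =
    (\<integral>\<^sup>+y. ennreal (p y) * (\<integral>\<^sup>+z. ennreal (p z) * (ennreal (pair_weight c d y z) * F (y + z) (y\<^sup>2 + z\<^sup>2)) \<partial>lborel) \<partial>lborel)"
    unfolding \<mu>_def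
    by (subst nn_integral_density, measurable, subst nn_integral_density, measurable)
  also have "\<dots> = (\<integral>\<^sup>+y. \<integral>\<^sup>+z. ennreal (p y) * (ennreal (p z) * (ennreal (pair_weight c d y z) * F (y + z) (y\<^sup>2 + z\<^sup>2))) \<partial>lborel \<partial>lborel)"
    by (intro nn_integral_cong nn_integral_cmult[symmetric]) measurable
  also have "\<dots> = (\<integral>\<^sup>+y. \<integral>\<^sup>+z. ennreal pair_scale * (indicator {y..} z * indicator {0..} y * ennreal (z - y) * ?F (y + z) (y\<^sup>2 + z\<^sup>2)) \<partial>lborel \<partial>lborel)"
  proof (rule nn_integral_cong, rule nn_integral_cong)
    fix y z :: real
    show "ennreal (p y) * (ennreal (p z) * (ennreal (pair_weight c d y z) * F (y + z) (y\<^sup>2 + z\<^sup>2))) =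
      ennreal pair_scale * (indicator {y..} z * indicator {0..} y * ennreal (z - y) * ?F (y + z) (y\<^sup>2 + z\<^sup>2))"
    proof (cases "0 \<le> y \<and> y \<le> z")
      case False
      then show ?thesis by (auto simp: pair_weight_def indicator_def max_def)
    next
      case True
      then have "p y * (p z * pair_weight c d y z) = pair_scale * ((z - y) * (indicator {c..c + 1/10} (y + z) * indicator {d..d + 1/10} (y\<^sup>2 + z\<^sup>2)))"
        using normalizer_pos by (simp add: pair_weight_def p_eq gibbs_weight_def)
      then have "ennreal (p y) * (ennreal (p z) * ennreal (pair_weight c d y z)) =
         ennreal pair_scale * (ennreal (z - y) * (indicator {c..c + 1/10} (y + z) * indicator {d..d + 1/10} (y\<^sup>2 + z\<^sup>2)))"
        using True pair_scale_pos pair_weight_bounds[OF c, of y z]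
        by (simp add: ennreal_mult'[symmetric] ennreal_indicator[symmetric])
      from arg_cong[OF this, of "\<lambda>q. q * F (y + z) (y\<^sup>2 + z\<^sup>2)"] show ?thesis
        using True by (simp add: mult.assoc)
    qed
  qed
  also have "\<dots> = (\<integral>\<^sup>+y. ennreal pair_scale * (\<integral>\<^sup>+z. indicator {y..} z * indicator {0..} y * ennreal (z - y) * ?F (y + z) (y\<^sup>2 + z\<^sup>2) \<partial>lborel) \<partial>lborel)"
    by (intro nn_integral_cong nn_integral_cmult) measurable
  also have "\<dots> = (\<integral>\<^sup>+y. ennreal pair_scale * (\<integral>\<^sup>+z. indicator {0..} (z - y) * indicator {0..} y * ennreal (z - y) * ?F (y + z) (y\<^sup>2 + z\<^sup>2) \<partial>lborel) \<partial>lborel)"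
    by (intro nn_integral_cong arg_cong[where f="\<lambda>q. ennreal pair_scale * q"]) (auto simp: indicator_def)
  also have "\<dots> = ennreal pair_scale * (\<integral>\<^sup>+y. \<integral>\<^sup>+z. indicator {0..} (z - y) * indicator {0..} y * ennreal (z - y) * ?F (y + z) (y\<^sup>2 + z\<^sup>2) \<partial>lborel \<partial>lborel)"
    by (rule nn_integral_cmult) measurable
  also have "(\<integral>\<^sup>+y. \<integral>\<^sup>+z. indicator {0..} (z - y) * indicator {0..} y * ennreal (z - y) * ?F (y + z) (y\<^sup>2 + z\<^sup>2) \<partial>lborel \<partial>lborel)
     = (\<integral>\<^sup>+y. \<integral>\<^sup>+z. indicator {y..} z * indicator {0..} y * ennreal (z - y) * ?F (y + z) (y\<^sup>2 + z\<^sup>2) \<partial>lborel \<partial>lborel)"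
    by (intro nn_integral_cong) (auto simp: indicator_def)
  also have "\<dots> = ennreal (1/2) * (\<integral>\<^sup>+t. \<integral>\<^sup>+u. ?F t u \<partial>lborel \<partial>lborel)"
  proof (rule sum_square_substitution)
    show "(\<lambda>(t, u). ?F t u) \<in> borel_measurable borel"
      unfolding borel_prod[symmetric] case_prod_beta by measurable
    fix t u assume "?F t u \<noteq> 0"
    then have tu: "t \<in> {c..c + 1/10}" "u \<in> {d..d + 1/10}" by (auto simp: indicator_def split: if_splits)
    have cd: "39/10 \<le> c" "c \<le> 41/10" "99/10 \<le> d" "d \<le> 101/10" using c by linarith+
    have t: "39/10 \<le> t" "t \<le> 42/10" using tu cd by auto
    have "(39/10)\<^sup>2 \<le> t\<^sup>2" "t\<^sup>2 \<le> (42/10)\<^sup>2" using t by (intro power_mono; simp)+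
    then have "t\<^sup>2 / 2 \<le> u" "u \<le> t\<^sup>2" using tu cd by (auto simp: power2_eq_square)
    then show "0 < t \<and> u \<in> {t\<^sup>2 / 2..t\<^sup>2}" using t by auto
  qed
  also have "ennreal pair_scale * (ennreal (1/2) * (\<integral>\<^sup>+t. \<integral>\<^sup>+u. ?F t u \<partial>lborel \<partial>lborel)) = ennreal (pair_scale / 2) * (\<integral>\<^sup>+t. \<integral>\<^sup>+u. ?F t u \<partial>lborel \<partial>lborel)"
    using pair_scale_pos ennreal_mult[of pair_scale "1/2"] by (simp only: mult.assoc[symmetric]) simp
  finally show ?thesis .
qed

abbreviation (input) Sum1 :: "nat \<Rightarrow> (nat \<Rightarrow> real) \<Rightarrow> real" where "Sum1 n x \<equiv> \<Sum>l<n. x l"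
abbreviation (input) Sum2 :: "nat \<Rightarrow> (nat \<Rightarrow> real) \<Rightarrow> real" where "Sum2 n x \<equiv> \<Sum>l<n. (x l)\<^sup>2"

lemma nn_integral_pair_weight_sums:
  fixes F :: "real \<Rightarrow> real \<Rightarrow> ennreal"
  assumes ij: "i < n" "j < n" "i \<noteq> j"
    and c: "\<bar>c - 4\<bar> \<le> 1/10" "\<bar>d - 10\<bar> \<le> 1/10"
    and F[measurable]: "(\<lambda>(t, u). F t u) \<in> borel_measurable borel"
  shows "(\<integral>\<^sup>+x. ennreal (pair_weight c d (x i) (x j)) * F (Sum1 n x) (Sum2 n x) \<partial>G n) =
    (\<integral>\<^sup>+x. ennreal (pair_scale / 2) * (\<integral>\<^sup>+t. \<integral>\<^sup>+u. indicator {c..c + 1/10} t * indicator {d..d + 1/10} u *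
        F ((\<Sum>l\<in>{..<n} - {i, j}. x l) + t) ((\<Sum>l\<in>{..<n} - {i, j}. (x l)\<^sup>2) + u) \<partial>lborel \<partial>lborel)
       \<partial>PiM ({..<n} - {i, j}) (\<lambda>_. \<mu>))"
proof -
  define I where "I = {..<n} - {i, j}"
  have I: "finite I" "i \<notin> I" "j \<notin> I" by (auto simp: I_def)
  have n: "{..<n} = insert j (insert i I)" using ij by (auto simp: I_def)
  have Gn: "G n = PiM (insert j (insert i I)) (\<lambda>_. \<mu>)" by (simp add: G_def n)
  note [measurable] = borel_measurable_curried[OF F]
  have comp[measurable]: "(\<lambda>x. x l) \<in> borel_measurable (PiM (insert j (insert i I)) (\<lambda>_. \<mu>))" if "l < n" for l
    using measurable_G_component[OF that] by (simp add: Gn)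
  have sums: "Sum1 n (x(i := y, j := z)) = (\<Sum>l\<in>I. x l) + (y + z)"
    "Sum2 n (x(i := y, j := z)) = (\<Sum>l\<in>I. (x l)\<^sup>2) + (y\<^sup>2 + z\<^sup>2)" for x :: "nat \<Rightarrow> real" and y z
  proof -
    have "(\<Sum>l\<in>I. (x(i := y, j := z)) l) = (\<Sum>l\<in>I. x l)"
      "(\<Sum>l\<in>I. ((x(i := y, j := z)) l)\<^sup>2) = (\<Sum>l\<in>I. (x l)\<^sup>2)"
      by (rule sum.cong; use I in auto)+
    then show "Sum1 n (x(i := y, j := z)) = (\<Sum>l\<in>I. x l) + (y + z)"
      "Sum2 n (x(i := y, j := z)) = (\<Sum>l\<in>I. (x l)\<^sup>2) + (y\<^sup>2 + z\<^sup>2)"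
      unfolding n using I ij by simp_all
  qed
  have upd: "(x(i := y, j := z)) i = y" "(x(i := y, j := z)) j = z" for x :: "nat \<Rightarrow> real" and y z
    using ij by auto
  have meas: "(\<lambda>x. ennreal (pair_weight c d (x i) (x j)) * F (Sum1 n x) (Sum2 n x)) \<in> borel_measurable (PiM (insert j (insert i I)) (\<lambda>_. \<mu>))"
    using ij by measurable
  have "(\<integral>\<^sup>+x. ennreal (pair_weight c d (x i) (x j)) * F (Sum1 n x) (Sum2 n x) \<partial>G n) =
    (\<integral>\<^sup>+x. \<integral>\<^sup>+y. \<integral>\<^sup>+z. ennreal (pair_weight c d y z) * F ((\<Sum>l\<in>I. x l) + (y + z)) ((\<Sum>l\<in>I. (x l)\<^sup>2) + (y\<^sup>2 + z\<^sup>2)) \<partial>\<mu> \<partial>\<mu> \<partial>PiM I (\<lambda>_. \<mu>))"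
    unfolding Gn by (subst nn_integral_split2[OF meas I(1) ij(3)[symmetric] I(3) I(2)]) (simp only: sums upd)
  also have "\<dots> = (\<integral>\<^sup>+x. ennreal (pair_scale / 2) * (\<integral>\<^sup>+t. \<integral>\<^sup>+u. indicator {c..c + 1/10} t * indicator {d..d + 1/10} u *
        F ((\<Sum>l\<in>I. x l) + t) ((\<Sum>l\<in>I. (x l)\<^sup>2) + u) \<partial>lborel \<partial>lborel)
       \<partial>PiM I (\<lambda>_. \<mu>))"
  proof (rule nn_integral_cong)
    fix x :: "nat \<Rightarrow> real"
    have "(\<lambda>(t, u). F ((\<Sum>l\<in>I. x l) + t) ((\<Sum>l\<in>I. (x l)\<^sup>2) + u)) \<in> borel_measurable borel"
    proof -
      have "(\<lambda>q :: real \<times> real. ((\<Sum>l\<in>I. x l) + fst q, (\<Sum>l\<in>I. (x l)\<^sup>2) + snd q)) \<in> borel_measurable borel"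
        by (intro borel_measurable_continuous_onI continuous_intros)
      from measurable_compose[OF this F] show ?thesis by (simp add: case_prod_beta)
    qed
    from nn_integral_pair_weight[OF c this]
    show "(\<integral>\<^sup>+y. \<integral>\<^sup>+z. ennreal (pair_weight c d y z) * F ((\<Sum>l\<in>I. x l) + (y + z)) ((\<Sum>l\<in>I. (x l)\<^sup>2) + (y\<^sup>2 + z\<^sup>2)) \<partial>\<mu> \<partial>\<mu>) =
       ennreal (pair_scale / 2) * (\<integral>\<^sup>+t. \<integral>\<^sup>+u. indicator {c..c + 1/10} t * indicator {d..d + 1/10} u *
        F ((\<Sum>l\<in>I. x l) + t) ((\<Sum>l\<in>I. (x l)\<^sup>2) + u) \<partial>lborel \<partial>lborel)" .
  qed
  finally show ?thesis by (simp only: I_def)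
qed

text \<open>
  Moving the rectangle by \<open>(- d1, - d2)\<close> and the argument of \<open>F\<close> by \<open>(d1, d2)\<close> is a translation in the
  two integration variables.
\<close>
lemma nn_integral_pair_weight_shift:
  fixes F :: "real \<Rightarrow> real \<Rightarrow> ennreal"
  assumes ij: "i < n" "j < n" "i \<noteq> j"
    and d: "\<bar>d1\<bar> \<le> 1/10" "\<bar>d2\<bar> \<le> 1/10"
    and F: "(\<lambda>(t, u). F t u) \<in> borel_measurable borel"
  shows "(\<integral>\<^sup>+x. ennreal (pair_weight 4 10 (x i) (x j)) * F (Sum1 n x) (Sum2 n x) \<partial>G n) =
     (\<integral>\<^sup>+x. ennreal (pair_weight (4 - d1) (10 - d2) (x i) (x j)) * F (Sum1 n x + d1) (Sum2 n x + d2) \<partial>G n)"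
proof -
  have F': "(\<lambda>(t, u). F (t + d1) (u + d2)) \<in> borel_measurable borel"
  proof -
    have "(\<lambda>q :: real \<times> real. (fst q + d1, snd q + d2)) \<in> borel_measurable borel"
      by (intro borel_measurable_continuous_onI continuous_intros)
    from measurable_compose[OF this F] show ?thesis by (simp add: case_prod_beta)
  qed
  note [measurable] = borel_measurable_curried[OF F]
  have ind: "(indicator {a - e..a - e + 1/10} t :: ennreal) = indicator {a..a + 1/10} (t + e)" for a e t :: real
    by (auto simp: indicator_def)
  have shift: "(\<integral>\<^sup>+t. \<integral>\<^sup>+u. indicator {4 - d1..4 - d1 + 1/10} t * indicator {10 - d2..10 - d2 + 1/10} u * F (a + t + d1) (b + u + d2) \<partial>lborel \<partial>lborel)
    = (\<integral>\<^sup>+t. \<integral>\<^sup>+u. indicator {4..4 + 1/10} t * indicator {10..10 + 1/10} u * F (a + t) (b + u) \<partial>lborel \<partial>lborel)" for a b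
  proof -
    have "(\<integral>\<^sup>+t. \<integral>\<^sup>+u. indicator {4 - d1..4 - d1 + 1/10} t * indicator {10 - d2..10 - d2 + 1/10} u * F (a + t + d1) (b + u + d2) \<partial>lborel \<partial>lborel)
     = (\<integral>\<^sup>+t. \<integral>\<^sup>+u. indicator {4..4 + 1/10} (t + d1) * indicator {10..10 + 1/10} (u + d2) * F (a + (t + d1)) (b + (u + d2)) \<partial>lborel \<partial>lborel)"
      unfolding ind by (simp add: add.assoc)
    also have "\<dots> = (\<integral>\<^sup>+t. \<integral>\<^sup>+u. indicator {4..4 + 1/10} (t + d1) * indicator {10..10 + 1/10} u * F (a + (t + d1)) (b + u) \<partial>lborel \<partial>lborel)"
      by (rule nn_integral_cong)
        (rule nn_integral_lborel_shift[where f="\<lambda>u. indicator {4..4 + 1/10} (_ + d1) * indicator {10..10 + 1/10} u * F (a + (_ + d1)) (b + u)"], measurable)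
    also have "\<dots> = (\<integral>\<^sup>+t. \<integral>\<^sup>+u. indicator {4..4 + 1/10} t * indicator {10..10 + 1/10} u * F (a + t) (b + u) \<partial>lborel \<partial>lborel)"
      by (rule nn_integral_lborel_shift[where f="\<lambda>t. \<integral>\<^sup>+u. indicator {4..4 + 1/10} t * indicator {10..10 + 1/10} u * F (a + t) (b + u) \<partial>lborel"]) measurable
    finally show ?thesis .
  qed
  show ?thesis
    using nn_integral_pair_weight_sums[OF ij _ _ F', of "4 - d1" "10 - d2"] d
    by (subst nn_integral_pair_weight_sums[OF ij _ _ F]) (simp_all add: shift[simplified])
qed

text \<open>
  The total mass is \<open>pair_scale / 2\<close> times the area \<open>1 / 100\<close> of the rectangle, wherever the
  rectangle is.
\<close>
lemma pair_weight_mean: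
  assumes c: "\<bar>c - 4\<bar> \<le> 1/10" "\<bar>d - 10\<bar> \<le> 1/10"
  shows "(\<integral>x. pair_weight c d (x 0) (x 1) \<partial>G 2) = pair_scale / 200"
proof -
  have [measurable]: "(\<lambda>x. pair_weight c d (x 0) (x 1)) \<in> borel_measurable (G 2)"
    by (intro measurable_pair_weight measurable_G_component) auto
  interpret I: prob_space "PiM ({..<2} - {0, 1::nat}) (\<lambda>_. \<mu>)"
    by (rule prob_space_PiM) (rule \<mu>.prob_space_axioms)
  have "(\<integral>\<^sup>+x. ennreal (pair_weight c d (x 0) (x 1)) \<partial>G 2) = ennreal (pair_scale / 2) * (\<integral>\<^sup>+t. \<integral>\<^sup>+u. indicator {c..c + 1/10} t * indicator {d..d + 1/10} u \<partial>lborel \<partial>lborel)"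
    using nn_integral_pair_weight_sums[OF _ _ _ c, of 0 2 1 "\<lambda>_ _. 1"] I.emeasure_space_1 by (simp add: nn_integral_const)
  also have "(\<integral>\<^sup>+t. \<integral>\<^sup>+u. indicator {c..c + 1/10} t * indicator {d..d + 1/10} u \<partial>lborel \<partial>lborel) = ennreal (1/10) * ennreal (1/10)"
    by (simp add: nn_integral_cmult nn_integral_multc)
  also have "ennreal (pair_scale / 2) * (ennreal (1/10) * ennreal (1/10)) = ennreal (pair_scale / 200)"
    using pair_scale_pos by (subst ennreal_mult[symmetric], simp, simp)+ simp
  finally show ?thesis
    using pair_scale_pos pair_weight_bounds[OF c] by (subst integral_eq_nn_integral) auto
qed

lemma pred_sums_near [measurable]: "Measurable.pred (G n) (\<lambda>x. x \<in> sums_near n e v w)"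
proof -
  have [measurable]: "(\<lambda>x. x i) \<in> borel_measurable (G n)" if "i < n" for i
    using that by (rule measurable_G_component)
  show ?thesis unfolding sums_near_def by measurable
qed

definition pmax :: real where "pmax = (SOME B. B > 0 \<and> (\<forall>x. p x \<le> B))"

lemma pmax: "pmax > 0" "p x \<le> pmax"
proof -
  have "\<exists>B. B > 0 \<and> (\<forall>x. p x \<le> B)" using density_bounded by metis
  from someI_ex[OF this] show "pmax > 0" "p x \<le> pmax" by (simp_all add: pmax_def)
qed

definition shell_const :: real where "shell_const = 4 * pi * pmax ^ 3"

lemma shell_const_pos: "shell_const > 0" unfolding shell_const_def using pmax by simp

lemma sums_near_bound_event:
  assumes e: "e > 0" and T: "card T = 3" "T \<subseteq> {..<n}"
    and Q: "Measurable.pred (G n) Q" "ignores T Q"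
  shows "(\<integral>x. indicator {x. Q x} x * indicator (sums_near n e v w) x \<partial>G n) \<le> shell_const * e\<^sup>2 * measure (G n) {x \<in> space (G n). Q x}"
proof -
  have [measurable]: "Measurable.pred (G n) Q" by fact
  have dep: "ignores T (indicator {x. Q x} :: _ \<Rightarrow> ennreal)"
    unfolding ignores_def
  proof (intro allI impI)
    fix x y :: "nat \<Rightarrow> real" assume "\<forall>l. l \<notin> T \<longrightarrow> x l = y l"
    then have "Q x = Q y" using Q(2) unfolding ignores_def by blast
    then show "indicator {x. Q x} x = (indicator {x. Q x} y :: ennreal)" by (simp add: indicator_def)
  qed
  have "ennreal (\<integral>x. indicator {x. Q x} x * indicator (sums_near n e v w) x \<partial>G n)
    = (\<integral>\<^sup>+x. ennreal (indicator {x. Q x} x * indicator (sums_near n e v w) x) \<partial>G n)"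
    by (rule nn_integral_eq_integral[symmetric])
      (auto intro!: G.integrable_const_bound[where B=1] simp: indicator_def)
  also have "\<dots> = (\<integral>\<^sup>+x. indicator {x. Q x} x * indicator (sums_near n e v w) x \<partial>G n)"
    by (intro nn_integral_cong) (auto simp: indicator_def)
  also have "\<dots> \<le> ennreal (4 * pi * pmax ^ 3 * e\<^sup>2) * (\<integral>\<^sup>+x. indicator {x. Q x} x \<partial>G n)"
    using pmax e T dep by (intro sums_near_bound) auto
  also have "(\<integral>\<^sup>+x. indicator {x. Q x} x \<partial>G n) = (\<integral>\<^sup>+x. indicator {x \<in> space (G n). Q x} x \<partial>G n)"
    by (intro nn_integral_cong) (auto simp: indicator_def)
  also have "\<dots> = ennreal (measure (G n) {x \<in> space (G n). Q x})"
    by (simp add: G.emeasure_eq_measure)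
  also have "ennreal (4 * pi * pmax ^ 3 * e\<^sup>2) * \<dots> = ennreal (shell_const * e\<^sup>2 * measure (G n) {x \<in> space (G n). Q x})"
    using shell_const_pos by (subst ennreal_mult) (auto simp: shell_const_def)
  finally show ?thesis
    using shell_const_pos by (subst (asm) ennreal_le_iff) auto
qed

definition near_prob :: "nat \<Rightarrow> real \<Rightarrow> real \<Rightarrow> real \<Rightarrow> real" where
  "near_prob n e v w = (\<integral>x. indicator (sums_near n e v w) x \<partial>G n)"

lemma pair_weight_shift:
  assumes ij: "i < n" "j < n" "i \<noteq> j"
    and d: "\<bar>d1\<bar> \<le> 1/10" "\<bar>d2\<bar> \<le> 1/10"
  shows "(\<integral>x. pair_weight 4 10 (x i) (x j) * indicator (sums_near n e v w) x \<partial>G n) =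
     (\<integral>x. pair_weight (4 - d1) (10 - d2) (x i) (x j) * indicator (sums_near n e (v - d1) (w - d2)) x \<partial>G n)"
proof -
  have [measurable]: "(\<lambda>x. x i) \<in> borel_measurable (G n)" "(\<lambda>x. x j) \<in> borel_measurable (G n)"
    using ij by (auto intro: measurable_G_component)
  have W0: "pair_weight 4 10 y z \<ge> 0" "pair_weight (4 - d1) (10 - d2) y z \<ge> 0" for y z
    using pair_weight_bounds[of 4 10 y z] pair_weight_bounds[of "4 - d1" "10 - d2" y z] d by auto
  define F :: "real \<Rightarrow> real \<Rightarrow> ennreal" where "F = (\<lambda>t u. indicator {v - e<..<v + e} t * indicator {w - e<..<w + e} u)"
  have F: "(\<lambda>(t, u). F t u) \<in> borel_measurable borel"
    unfolding F_def borel_prod[symmetric] by measurable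
  have "(\<integral>\<^sup>+x. ennreal (pair_weight 4 10 (x i) (x j) * indicator (sums_near n e v w) x) \<partial>G n) =
    (\<integral>\<^sup>+x. ennreal (pair_weight 4 10 (x i) (x j)) * F (Sum1 n x) (Sum2 n x) \<partial>G n)"
    using W0 by (intro nn_integral_cong) (simp add: F_def ennreal_mult ennreal_indicator indicator_sums_near)
  also have "\<dots> = (\<integral>\<^sup>+x. ennreal (pair_weight (4 - d1) (10 - d2) (x i) (x j)) * F (Sum1 n x + d1) (Sum2 n x + d2) \<partial>G n)"
    by (rule nn_integral_pair_weight_shift[OF ij d F])
  also have "\<dots> = (\<integral>\<^sup>+x. ennreal (pair_weight (4 - d1) (10 - d2) (x i) (x j) * indicator (sums_near n e (v - d1) (w - d2)) x) \<partial>G n)"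
  proof (intro nn_integral_cong)
    fix x
    have "F (Sum1 n x + d1) (Sum2 n x + d2) = ennreal (indicator (sums_near n e (v - d1) (w - d2)) x)"
      unfolding ennreal_indicator indicator_sums_near F_def by (auto simp: indicator_def)
    then show "ennreal (pair_weight (4 - d1) (10 - d2) (x i) (x j)) * F (Sum1 n x + d1) (Sum2 n x + d2) =
        ennreal (pair_weight (4 - d1) (10 - d2) (x i) (x j) * indicator (sums_near n e (v - d1) (w - d2)) x)"
      using W0 by (simp add: ennreal_mult)
  qed
  finally show ?thesis
    using W0 by (subst (1 2) integral_eq_nn_integral) (auto intro!: mult_nonneg_nonneg)
qed

definition pair_mean :: real where "pair_mean = pair_scale / 200"

lemma pair_mean_pos: "pair_mean > 0" using pair_scale_pos by (simp add: pair_mean_def)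

text \<open>
  The pairs start at coordinate 3; the first three coordinates stay free for the bound on shells.
\<close>
definition pair_weight_sum :: "nat \<Rightarrow> real \<Rightarrow> real \<Rightarrow> (nat \<Rightarrow> real) \<Rightarrow> real" where
  "pair_weight_sum N c d x = (\<Sum>j<N. pair_weight c d (x (3 + 2 * j)) (x (3 + 2 * j + 1)))"

lemma pair_weight_sum_bounds:
  assumes "\<bar>c - 4\<bar> \<le> 1/10" "\<bar>d - 10\<bar> \<le> 1/10"
  shows "0 \<le> pair_weight_sum N c d x" "pair_weight_sum N c d x \<le> real N"
proof -
  show "0 \<le> pair_weight_sum N c d x"
    unfolding pair_weight_sum_def using pair_weight_bounds[OF assms] by (intro sum_nonneg) auto
  have "pair_weight_sum N c d x \<le> (\<Sum>j<N. 1)"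
    unfolding pair_weight_sum_def using pair_weight_bounds[OF assms] by (intro sum_mono) auto
  then show "pair_weight_sum N c d x \<le> real N" by simp
qed

lemma measurable_pair_weight_sum:
  assumes "3 + 2 * N \<le> n"
  shows "pair_weight_sum N c d \<in> borel_measurable (G n)"
proof -
  show ?thesis unfolding pair_weight_sum_def[abs_def]
    using assms by (intro borel_measurable_sum measurable_pair_weight measurable_G_component) auto
qed

lemma pair_weight_sum_Hoeffding:
  assumes c: "\<bar>c - 4\<bar> \<le> 1/10" "\<bar>d - 10\<bar> \<le> 1/10" and n: "3 + 2 * N \<le> n" "N > 0" and \<eta>: "\<eta> > 0"
  shows "measure (G n) {x \<in> space (G n). \<bar>pair_weight_sum N c d x - real N * pair_mean\<bar> \<ge> real N * pair_mean * \<eta>}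
    \<le> 2 * exp (- 2 * real N * pair_mean\<^sup>2 * \<eta>\<^sup>2)"
proof -
  let ?f = "\<lambda>x::nat \<Rightarrow> real. pair_weight c d (x 0) (x 1)"
  have "measure (G n) {x \<in> space (G n). \<bar>(\<Sum>j<N. ?f (block (3 + 2 * j) 2 x)) - real N * (\<integral>x. ?f x \<partial>G 2)\<bar> \<ge> real N * pair_mean * \<eta>}
     \<le> 2 * exp (- 2 * (real N * pair_mean * \<eta>)\<^sup>2 / (real N * (1 - 0)\<^sup>2))"
  proof (rule block_Hoeffding)
    show "?f \<in> borel_measurable (PiM {..<2} (\<lambda>_. borel))"
      by (intro measurable_pair_weight measurable_component_singleton) auto
    show "?f x \<in> {0..1}" for x using pair_weight_bounds[OF c] .
  qed (use n pair_mean_pos \<eta> in auto)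
  moreover have "(\<Sum>j<N. ?f (block (3 + 2 * j) 2 x)) = pair_weight_sum N c d x" for x
    unfolding pair_weight_sum_def by (intro sum.cong) (auto simp: block_def)
  moreover have "- 2 * (real N * pair_mean * \<eta>)\<^sup>2 / (real N * (1 - 0)\<^sup>2) = - 2 * real N * pair_mean\<^sup>2 * \<eta>\<^sup>2"
    using n by (simp add: power2_eq_square)
  ultimately show ?thesis using pair_weight_mean[OF c] by (simp only: pair_mean_def)
qed

text \<open>
  Multiply the indicator of the event at \<open>(v, w)\<close> by the total weight of \<open>N\<close> pairs of coordinates
  with the rectangle at \<open>(4, 10)\<close>, and the one at \<open>(v - d1, w - d2)\<close> by the total weight with
  the translated rectangle. The two products have the same integral. Both total weights
  are within a factor \<open>1 \<plusminus> \<eta>\<close> of \<open>N * pair_mean\<close>, except on an event that ignores the coordinates 0, 1, 2;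
  there the loss is at most a constant times the probability of the exceptional event times \<open>e\<^sup>2\<close>.
\<close>
lemma Harnack:
  assumes e: "e > 0" and \<eta>: "0 < \<eta>" "\<eta> < 1" and n: "3 + 2 * N \<le> n" "N > 0"
    and d: "\<bar>d1\<bar> \<le> 1/10" "\<bar>d2\<bar> \<le> 1/10"
    and \<beta>: "\<beta> = shell_const * e\<^sup>2 * (4 * exp (- 2 * real N * pair_mean\<^sup>2 * \<eta>\<^sup>2))"
  shows "near_prob n e (v - d1) (w - d2) \<ge> (1 - \<eta>) / (1 + \<eta>) * near_prob n e v w - \<beta> * (1 + 1 / pair_mean)"
proof -
  have c: "\<bar>4 - 4 :: real\<bar> \<le> 1/10" "\<bar>10 - 10 :: real\<bar> \<le> 1/10"
    and c': "\<bar>4 - d1 - 4\<bar> \<le> 1/10" "\<bar>10 - d2 - 10\<bar> \<le> 1/10" using d by auto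
  let ?A = "pair_weight_sum N 4 10" and ?A' = "pair_weight_sum N (4 - d1) (10 - d2)"
  let ?M = "real N * pair_mean"
  have [measurable]: "?A \<in> borel_measurable (G n)" "?A' \<in> borel_measurable (G n)"
    by (rule measurable_pair_weight_sum[OF n(1)])+
  \<comment> \<open>The exceptional event: one of the two total weights is far from its mean.\<close>
  define Q where "Q = (\<lambda>x. \<bar>?A x - ?M\<bar> \<ge> ?M * \<eta> \<or> \<bar>?A' x - ?M\<bar> \<ge> ?M * \<eta>)"
  have [measurable]: "Measurable.pred (G n) Q" unfolding Q_def by measurable
  let ?b = "indicator {x. Q x} :: _ \<Rightarrow> real"
  let ?h = "indicator (sums_near n e v w) :: _ \<Rightarrow> real" and ?h' = "indicator (sums_near n e (v - d1) (w - d2)) :: _ \<Rightarrow> real"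
  have M: "?M > 0" using n pair_mean_pos by simp
  have "measure (G n) {x \<in> space (G n). Q x} \<le>
    measure (G n) {x \<in> space (G n). \<bar>?A x - ?M\<bar> \<ge> ?M * \<eta>} + measure (G n) {x \<in> space (G n). \<bar>?A' x - ?M\<bar> \<ge> ?M * \<eta>}"
  proof -
    have "{x \<in> space (G n). Q x} = {x \<in> space (G n). \<bar>?A x - ?M\<bar> \<ge> ?M * \<eta>} \<union> {x \<in> space (G n). \<bar>?A' x - ?M\<bar> \<ge> ?M * \<eta>}"
      by (auto simp: Q_def)
    then show ?thesis by (simp only:) (intro measure_Un_le, measurable)
  qed
  also have "\<dots> \<le> 2 * exp (- 2 * real N * pair_mean\<^sup>2 * \<eta>\<^sup>2) + 2 * exp (- 2 * real N * pair_mean\<^sup>2 * \<eta>\<^sup>2)"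
    by (intro add_mono pair_weight_sum_Hoeffding c c' n \<eta>)
  finally have PQ: "measure (G n) {x \<in> space (G n). Q x} \<le> 4 * exp (- 2 * real N * pair_mean\<^sup>2 * \<eta>\<^sup>2)" by simp
  have dep: "ignores {0, 1, 2} Q"
    unfolding ignores_def
  proof (intro allI impI)
    fix x y :: "nat \<Rightarrow> real" assume eq: "\<forall>l. l \<notin> {0, 1, 2} \<longrightarrow> x l = y l"
    have "pair_weight_sum N c d x = pair_weight_sum N c d y" for c d
      unfolding pair_weight_sum_def using eq by (intro sum.cong refl arg_cong2[where f="pair_weight c d"]) auto
    then show "Q x = Q y" by (simp add: Q_def)
  qed
  have bad: "(\<integral>x. ?b x * indicator (sums_near n e v w) x \<partial>G n) \<le> \<beta>" for v w
  proof -
    have "(\<integral>x. ?b x * indicator (sums_near n e v w) x \<partial>G n) \<le> shell_const * e\<^sup>2 * measure (G n) {x \<in> space (G n). Q x}"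
      using n by (intro sums_near_bound_event[OF e _ _ _ dep]) auto
    also have "\<dots> \<le> \<beta>" unfolding \<beta> using shell_const_pos by (intro mult_left_mono PQ) auto
    finally show ?thesis .
  qed
  have int: "integrable (G n) (\<lambda>x. indicator (sums_near n e v w) x :: real)" "integrable (G n) (\<lambda>x. ?b x * indicator (sums_near n e v w) x)" for v w
    by (auto intro!: G.integrable_const_bound[where B=1] simp: indicator_def)
  have intA: "integrable (G n) (\<lambda>x. pair_weight_sum N c d x * indicator (sums_near n e v w) x)"
    if "\<bar>c - 4\<bar> \<le> 1/10" "\<bar>d - 10\<bar> \<le> 1/10" for c d v w
  proof (rule G.integrable_const_bound[where B="real N"])
    have [measurable]: "pair_weight_sum N c d \<in> borel_measurable (G n)" by (rule measurable_pair_weight_sum[OF n(1)])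
    show "(\<lambda>x. pair_weight_sum N c d x * indicator (sums_near n e v w) x) \<in> borel_measurable (G n)" by measurable
  qed (use pair_weight_sum_bounds[OF that] in \<open>auto simp: indicator_def\<close>)
  have "(1 - \<eta>) * ?M * near_prob n e v w - (1 - \<eta>) * ?M * (\<integral>x. ?b x * ?h x \<partial>G n)
     = (\<integral>x. (1 - \<eta>) * ?M * ?h x - (1 - \<eta>) * ?M * (?b x * ?h x) \<partial>G n)"
    using int[of v w] by (subst Bochner_Integration.integral_diff) (auto simp: near_prob_def intro!: integrable_mult_right)
  also have "\<dots> \<le> (\<integral>x. ?A x * ?h x \<partial>G n)"
  proof (rule integral_mono)
    fix x
    show "(1 - \<eta>) * ?M * ?h x - (1 - \<eta>) * ?M * (?b x * ?h x) \<le> ?A x * ?h x"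
    proof (cases "Q x")
      case True
      then show ?thesis using pair_weight_sum_bounds[OF c, of N x] by (auto simp: indicator_def)
    next
      case False
      then have "\<bar>?A x - ?M\<bar> < ?M * \<eta>" by (simp add: Q_def)
      then have "(1 - \<eta>) * ?M \<le> ?A x" by (simp add: algebra_simps abs_less_iff)
      then show ?thesis using False by (auto simp: indicator_def)
    qed
  qed (use int[of v w] intA[OF c] in \<open>auto intro!: integrable_mult_right Bochner_Integration.integrable_diff\<close>)
  \<comment> \<open>This exact identity, applied to each pair of coordinates, carries the event from \<open>(v, w)\<close> to \<open>(v - d1, w - d2)\<close>.\<close>
  also have "\<dots> = (\<integral>x. ?A' x * ?h' x \<partial>G n)"
  proof -
    have intW: "integrable (G n) (\<lambda>x. pair_weight c d (x (3 + 2 * j)) (x (3 + 2 * j + 1)) * indicator (sums_near n e v w) x)"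
      if "\<bar>c - 4\<bar> \<le> 1/10" "\<bar>d - 10\<bar> \<le> 1/10" "j < N" for c d v w j
    proof (rule G.integrable_const_bound[where B=1])
      have [measurable]: "(\<lambda>x. pair_weight c d (x (3 + 2 * j)) (x (3 + 2 * j + 1))) \<in> borel_measurable (G n)"
        using that n by (intro measurable_pair_weight measurable_G_component) auto
      show "(\<lambda>x. pair_weight c d (x (3 + 2 * j)) (x (3 + 2 * j + 1)) * indicator (sums_near n e v w) x) \<in> borel_measurable (G n)" by measurable
    qed (use pair_weight_bounds[OF that(1,2)] in \<open>auto simp: indicator_def\<close>)
    have "(\<integral>x. ?A x * ?h x \<partial>G n) = (\<Sum>j<N. \<integral>x. pair_weight 4 10 (x (3 + 2 * j)) (x (3 + 2 * j + 1)) * ?h x \<partial>G n)"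
      unfolding pair_weight_sum_def sum_distrib_right using c by (intro Bochner_Integration.integral_sum intW) auto
    also have "\<dots> = (\<Sum>j<N. \<integral>x. pair_weight (4 - d1) (10 - d2) (x (3 + 2 * j)) (x (3 + 2 * j + 1)) * ?h' x \<partial>G n)"
      using n d by (intro sum.cong pair_weight_shift) auto
    also have "\<dots> = (\<integral>x. ?A' x * ?h' x \<partial>G n)"
      unfolding pair_weight_sum_def sum_distrib_right using c' by (intro Bochner_Integration.integral_sum[symmetric] intW) auto
    finally show ?thesis .
  qed
  also have "\<dots> \<le> (\<integral>x. (1 + \<eta>) * ?M * ?h' x + real N * (?b x * ?h' x) \<partial>G n)"
  proof (rule integral_mono)
    fix x
    show "?A' x * ?h' x \<le> (1 + \<eta>) * ?M * ?h' x + real N * (?b x * ?h' x)"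
    proof (cases "Q x")
      case True
      have "0 \<le> (1 + \<eta>) * ?M" using M \<eta> by simp
      then show ?thesis using True pair_weight_sum_bounds[OF c', of N x] by (auto simp: indicator_def)
    next
      case False
      then have "\<bar>?A' x - ?M\<bar> < ?M * \<eta>" by (simp add: Q_def)
      then have "?A' x \<le> (1 + \<eta>) * ?M" by (simp add: algebra_simps abs_less_iff)
      then show ?thesis using False by (auto simp: indicator_def)
    qed
  qed (use int[of "v - d1" "w - d2"] intA[OF c'] in \<open>auto intro!: integrable_mult_right Bochner_Integration.integrable_add\<close>)
  also have "\<dots> = (1 + \<eta>) * ?M * near_prob n e (v - d1) (w - d2) + real N * (\<integral>x. ?b x * ?h' x \<partial>G n)"
    using int[of "v - d1" "w - d2"] by (subst Bochner_Integration.integral_add) (auto simp: near_prob_def intro!: integrable_mult_right)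
  finally have "(1 - \<eta>) * ?M * near_prob n e v w - (1 - \<eta>) * ?M * (\<integral>x. ?b x * ?h x \<partial>G n)
     \<le> (1 + \<eta>) * ?M * near_prob n e (v - d1) (w - d2) + real N * (\<integral>x. ?b x * ?h' x \<partial>G n)" .
  moreover have "(1 - \<eta>) * ?M * (\<integral>x. ?b x * ?h x \<partial>G n) \<le> (1 - \<eta>) * ?M * \<beta>"
    using \<eta> M by (intro mult_left_mono bad) auto
  moreover have "real N * (\<integral>x. ?b x * ?h' x \<partial>G n) \<le> real N * \<beta>"
    by (intro mult_left_mono bad) auto
  ultimately have "(1 - \<eta>) * ?M * near_prob n e v w - (1 - \<eta>) * ?M * \<beta> \<le> (1 + \<eta>) * ?M * near_prob n e (v - d1) (w - d2) + real N * \<beta>"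
    by linarith
  then have "real N * ((1 - \<eta>) * pair_mean * near_prob n e v w - (1 - \<eta>) * pair_mean * \<beta>) \<le> real N * ((1 + \<eta>) * pair_mean * near_prob n e (v - d1) (w - d2) + \<beta>)"
    by (simp add: algebra_simps)
  then have "(1 - \<eta>) * pair_mean * near_prob n e v w - (1 - \<eta>) * pair_mean * \<beta> \<le> (1 + \<eta>) * pair_mean * near_prob n e (v - d1) (w - d2) + \<beta>"
    using n by (subst (asm) mult_le_cancel_left_pos) auto
  moreover have "\<beta> \<ge> 0" unfolding \<beta> using shell_const_pos by simp
  moreover have "0 \<le> (1 + \<eta>) * pair_mean * \<beta> - (1 - \<eta>) * pair_mean * \<beta>" "0 \<le> \<eta> * \<beta>"
    using \<eta> pair_mean_pos \<open>\<beta> \<ge> 0\<close> by (simp_all add: mult_right_mono)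
  ultimately have "(1 - \<eta>) * pair_mean * near_prob n e v w \<le> (1 + \<eta>) * pair_mean * near_prob n e (v - d1) (w - d2) + (1 + \<eta>) * pair_mean * \<beta> + (1 + \<eta>) * \<beta>"
    by (simp add: algebra_simps)
  also have "\<dots> = ((1 + \<eta>) * pair_mean) * (near_prob n e (v - d1) (w - d2) + \<beta> * (1 + 1 / pair_mean))"
    using pair_mean_pos by (simp add: field_simps)
  finally have "(1 - \<eta>) * pair_mean * near_prob n e v w / ((1 + \<eta>) * pair_mean) \<le> near_prob n e (v - d1) (w - d2) + \<beta> * (1 + 1 / pair_mean)"
    using \<eta> pair_mean_pos by (subst pos_divide_le_eq) (auto simp: mult.commute)
  then show ?thesis using pair_mean_pos by simp
qed

lemma Harnack_iterated:
  assumes e: "e > 0" and \<eta>: "0 < \<eta>" "\<eta> < 1" and n: "3 + 2 * N \<le> n" "N > 0"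
    and d: "\<bar>d1\<bar> \<le> 1/10" "\<bar>d2\<bar> \<le> 1/10"
    and \<beta>: "\<beta> = shell_const * e\<^sup>2 * (4 * exp (- 2 * real N * pair_mean\<^sup>2 * \<eta>\<^sup>2))"
  shows "near_prob n e (v - real L * d1) (w - real L * d2) \<ge> ((1 - \<eta>) / (1 + \<eta>)) ^ L * near_prob n e v w - real L * (\<beta> * (1 + 1 / pair_mean))"
proof (induction L)
  case (Suc L)
  let ?\<rho> = "(1 - \<eta>) / (1 + \<eta>)" and ?\<gamma> = "\<beta> * (1 + 1 / pair_mean)"
  have \<gamma>: "?\<gamma> \<ge> 0" unfolding \<beta> using shell_const_pos pair_mean_pos by simp
  have \<rho>: "0 \<le> ?\<rho>" "?\<rho> \<le> 1" using \<eta> by auto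
  have "?\<rho> ^ Suc L * near_prob n e v w - real (Suc L) * ?\<gamma> \<le> ?\<rho> * (?\<rho> ^ L * near_prob n e v w - real L * ?\<gamma>) - ?\<gamma>"
  proof -
    have gen: "q ^ Suc L * X - real (Suc L) * g \<le> q * (q ^ L * X - real L * g) - g"
      if "q * (real L * g) \<le> 1 * (real L * g)" for q X g :: real
      using that by (simp add: algebra_simps)
    show ?thesis using \<rho> \<gamma> by (intro gen mult_right_mono) auto
  qed
  also have "\<dots> \<le> ?\<rho> * near_prob n e (v - real L * d1) (w - real L * d2) - ?\<gamma>"
    using Suc.IH \<rho> by (intro diff_right_mono mult_left_mono) auto
  also have "\<dots> \<le> near_prob n e (v - real L * d1 - d1) (w - real L * d2 - d2)"
    by (rule Harnack[OF e \<eta> n d \<beta>])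
  finally show ?case by (simp add: algebra_simps)
qed simp

end

section \<open>A polynomial lower bound at the mean\<close>

context gibbs
begin

lemma distr_coordinate: "i < n \<Longrightarrow> distr (G n) \<mu> (\<lambda>x. x i) = \<mu>"
  unfolding G_def using distr_PiM_component[of "{..<n}" "\<lambda>_. \<mu>" i] \<mu>.prob_space_axioms by auto

lemma coordinate_measurable_\<mu>: "i < n \<Longrightarrow> (\<lambda>x. x i) \<in> measurable (G n) \<mu>"
  unfolding G_def by (intro measurable_component_singleton) auto

lemma integral_coordinate:
  assumes "i < n" and [measurable]: "f \<in> borel_measurable borel"
  shows "(\<integral>x. f (x i) \<partial>G n) = (\<integral>z. (f z :: real) \<partial>\<mu>)"
  using integral_distr[OF coordinate_measurable_\<mu>[OF assms(1)], of f] distr_coordinate[OF assms(1)] by simp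

lemma integrable_coordinate:
  assumes "i < n" and "integrable \<mu> (f :: real \<Rightarrow> real)"
  shows "integrable (G n) (\<lambda>x. f (x i))"
  using integrable_distr[OF coordinate_measurable_\<mu>[OF assms(1)], of f] distr_coordinate[OF assms(1)] assms(2) by simp

text \<open>
  Chebyshev's inequality; by independence the mixed second moments of the centred summands vanish.
\<close>
lemma sum_concentration:
  fixes g :: "real \<Rightarrow> real"
  assumes g[measurable]: "g \<in> borel_measurable borel" and g1: "integrable \<mu> g" and g2: "integrable \<mu> (\<lambda>x. (g x)\<^sup>2)"
    and mean: "(\<integral>z. g z \<partial>\<mu>) = 0" and a: "a > 0"
  shows "measure (G n) {x \<in> space (G n). \<bar>\<Sum>i<n. g (x i)\<bar> \<ge> a} \<le> real n * (\<integral>z. (g z)\<^sup>2 \<partial>\<mu>) / a\<^sup>2"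
proof -
  have [measurable]: "(\<lambda>x. g (x i)) \<in> borel_measurable (G n)" if "i < n" for i
    using measurable_compose[OF measurable_G_component[OF that] g] by simp
  have prods: "integrable (G n) (\<lambda>x. g (x i) * g (x j))"
      "(\<integral>x. g (x i) * g (x j) \<partial>G n) = (if i = j then \<integral>z. (g z)\<^sup>2 \<partial>\<mu> else 0)"
    if "i < n" "j < n" for i j
  proof -
    have "integrable (G n) (\<lambda>x. g (x i) * g (x j)) \<and>
       (\<integral>x. g (x i) * g (x j) \<partial>G n) = (if i = j then \<integral>z. (g z)\<^sup>2 \<partial>\<mu> else 0)"
    proof (cases "i = j")
      case True
      then show ?thesis
        using integrable_coordinate[OF that(1) g2] integral_coordinate[OF that(1), of "\<lambda>z. (g z)\<^sup>2"]
        by (simp add: power2_eq_square)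
    next
      case False
      have "G.indep_vars n (\<lambda>_. borel) (\<lambda>i x. g (x i)) {..<n}"
        using indep_coordinates by (rule G.indep_vars_compose2) simp
      then have ind: "G.indep_vars n (\<lambda>_. borel) (\<lambda>i x. g (x i)) {i, j}"
        by (rule G.indep_vars_subset) (use that in auto)
      have I: "integrable (G n) (\<lambda>x. g (x l))" if "l \<in> {i, j}" for l
        using that \<open>i < n\<close> \<open>j < n\<close> g1 by (auto intro: integrable_coordinate)
      show ?thesis
        using G.indep_vars_integrable[OF _ ind I] G.indep_vars_lebesgue_integral[OF _ ind I] False
          integral_coordinate[OF that(1) g] mean by simp
    qed
    then show "integrable (G n) (\<lambda>x. g (x i) * g (x j))"
      "(\<integral>x. g (x i) * g (x j) \<partial>G n) = (if i = j then \<integral>z. (g z)\<^sup>2 \<partial>\<mu> else 0)" by auto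
  qed
  have sq: "(\<Sum>i<n. g (x i))\<^sup>2 = (\<Sum>i<n. \<Sum>j<n. g (x i) * g (x j))" for x
    by (simp add: power2_eq_square sum_product)
  have int: "integrable (G n) (\<lambda>x. (\<Sum>i<n. g (x i))\<^sup>2)"
    unfolding sq by (intro Bochner_Integration.integrable_sum prods) auto
  have "(\<integral>x. (\<Sum>i<n. g (x i))\<^sup>2 \<partial>G n) = (\<Sum>i<n. \<Sum>j<n. \<integral>x. g (x i) * g (x j) \<partial>G n)"
    unfolding sq using prods by (subst Bochner_Integration.integral_sum) (auto intro!: Bochner_Integration.integrable_sum sum.cong Bochner_Integration.integral_sum)
  also have "\<dots> = (\<Sum>i<n. \<Sum>j<n. if i = j then \<integral>z. (g z)\<^sup>2 \<partial>\<mu> else 0)"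
    using prods by (intro sum.cong) auto
  also have "\<dots> = real n * (\<integral>z. (g z)\<^sup>2 \<partial>\<mu>)" by simp
  finally have E: "(\<integral>x. (\<Sum>i<n. g (x i))\<^sup>2 \<partial>G n) = real n * (\<integral>z. (g z)\<^sup>2 \<partial>\<mu>)" .
  have "measure (G n) {x \<in> space (G n). (\<Sum>i<n. g (x i))\<^sup>2 \<ge> a\<^sup>2} \<le> (\<integral>x. (\<Sum>i<n. g (x i))\<^sup>2 \<partial>G n) / a\<^sup>2"
    using a int by (intro integral_Markov_inequality_measure[where A="{}"]) auto
  moreover have "(\<bar>\<Sum>i<n. g (x i)\<bar> \<ge> a) = ((\<Sum>i<n. g (x i))\<^sup>2 \<ge> a\<^sup>2)" for x
    using a abs_le_square_iff[of a "\<Sum>i<n. g (x i)"] by simp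
  ultimately show ?thesis by (simp add: E)
qed

lemma window_probability:
  obtains M where "M > 0" "\<And>n. n > 0 \<Longrightarrow>
    measure (G n) {x \<in> space (G n). \<bar>Sum1 n x - real n\<bar> < M * sqrt (real n) \<and> \<bar>Sum2 n x - real n * b\<bar> < M * sqrt (real n)} \<ge> 1 / 2"
proof -
  define V1 where "V1 = (\<integral>z. (z - 1)\<^sup>2 \<partial>\<mu>)"
  define V2 where "V2 = (\<integral>z. (z\<^sup>2 - b)\<^sup>2 \<partial>\<mu>)"
  have V: "V1 \<ge> 0" "V2 \<ge> 0" by (simp_all add: V1_def V2_def)
  define M where "M = sqrt (4 * (V1 + V2) + 1)"
  have M: "M > 0" "M\<^sup>2 = 4 * (V1 + V2) + 1" using V by (auto simp: M_def)
  have i1: "integrable \<mu> (\<lambda>z. z)" using integrable_\<mu>_power[of 1] by simp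
  have "1 / 2 \<le> measure (G n) {x \<in> space (G n). \<bar>Sum1 n x - real n\<bar> < M * sqrt (real n) \<and> \<bar>Sum2 n x - real n * b\<bar> < M * sqrt (real n)}"
    (is "_ \<le> measure _ ?W") if n: "n > 0" for n
  proof -
    let ?a = "M * sqrt (real n)"
    have [measurable]: "(\<lambda>x. x i) \<in> borel_measurable (G n)" if "i < n" for i
      using that by (rule measurable_G_component)
    have a: "?a > 0" "?a\<^sup>2 = M\<^sup>2 * real n" using M n by (auto simp: power_mult_distrib)
    let ?B1 = "{x \<in> space (G n). \<bar>\<Sum>i<n. x i - 1\<bar> \<ge> ?a}"
    let ?B2 = "{x \<in> space (G n). \<bar>\<Sum>i<n. (x i)\<^sup>2 - b\<bar> \<ge> ?a}"
    have "measure (G n) ?B1 \<le> real n * V1 / ?a\<^sup>2" unfolding V1_def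
    proof (rule sum_concentration)
      show "integrable \<mu> (\<lambda>x. (x - 1)\<^sup>2)"
        using i1 integrable_\<mu>_power[of 2] by (simp add: power2_diff)
      have "(\<integral>z. z - 1 \<partial>\<mu>) = (\<integral>z. z \<partial>\<mu>) - (\<integral>z. 1 \<partial>\<mu>)"
        using i1 by (intro Bochner_Integration.integral_diff) simp_all
      then show "(\<integral>z. z - 1 \<partial>\<mu>) = 0" by (simp add: \<mu>_mean \<mu>.prob_space[simplified])
      show "integrable \<mu> (\<lambda>x. x - 1)" using i1 by (intro Bochner_Integration.integrable_diff) simp_all
      show "(\<lambda>x. x - 1 :: real) \<in> borel_measurable borel" by measurable
    qed (rule a(1))
    also have "\<dots> = V1 / M\<^sup>2" using n by (simp add: a(2))
    finally have B1: "measure (G n) ?B1 \<le> V1 / M\<^sup>2" .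
    have "measure (G n) ?B2 \<le> real n * V2 / ?a\<^sup>2" unfolding V2_def
    proof (rule sum_concentration)
      have "(\<lambda>x. (x\<^sup>2 - b)\<^sup>2) = (\<lambda>x::real. x ^ 4 + b\<^sup>2 - 2 * b * x\<^sup>2)"
        by (auto simp: fun_eq_iff power2_eq_square power4_eq_xxxx algebra_simps)
      then show "integrable \<mu> (\<lambda>x. (x\<^sup>2 - b)\<^sup>2)" by simp
      have "(\<integral>z. z\<^sup>2 - b \<partial>\<mu>) = (\<integral>z. z\<^sup>2 \<partial>\<mu>) - (\<integral>z. b \<partial>\<mu>)"
        by (intro Bochner_Integration.integral_diff) simp_all
      then show "(\<integral>z. z\<^sup>2 - b \<partial>\<mu>) = 0" by (simp add: \<mu>_mean_square \<mu>.prob_space[simplified])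
      show "integrable \<mu> (\<lambda>x. x\<^sup>2 - b)" by (intro Bochner_Integration.integrable_diff) simp_all
      show "(\<lambda>x. x\<^sup>2 - b :: real) \<in> borel_measurable borel" by measurable
    qed (rule a(1))
    also have "\<dots> = V2 / M\<^sup>2" using n by (simp add: a(2))
    finally have B2: "measure (G n) ?B2 \<le> V2 / M\<^sup>2" .
    have "(V1 + V2) / M\<^sup>2 \<le> 1 / 2" using M V by (simp add: field_simps)
    then have B: "measure (G n) ?B1 + measure (G n) ?B2 \<le> 1 / 2" using B1 B2 unfolding add_divide_distrib by linarith
    have W: "?W = space (G n) - (?B1 \<union> ?B2)" by (auto simp: sum_subtractf not_le mult.commute)
    have "measure (G n) ?W = 1 - measure (G n) (?B1 \<union> ?B2)"
      unfolding W by (rule G.prob_compl) measurable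
    also have "\<dots> \<ge> 1 - (measure (G n) ?B1 + measure (G n) ?B2)"
      by (intro diff_left_mono measure_Un_le) measurable
    finally show ?thesis using B by linarith
  qed
  with M(1) show thesis by (rule that)
qed

lemma emeasure_sums_near: "emeasure (G n) {x \<in> space (G n). x \<in> sums_near n e v w} = ennreal (near_prob n e v w)"
proof -
  have "near_prob n e v w = (\<integral>x. indicator {x \<in> space (G n). x \<in> sums_near n e v w} x \<partial>G n)"
    unfolding near_prob_def by (rule Bochner_Integration.integral_cong) (auto simp: indicator_def)
  also have "\<dots> = measure (G n) {x \<in> space (G n). x \<in> sums_near n e v w}" by simp
  finally show ?thesis by (simp add: G.emeasure_eq_measure)
qed

text \<open>
  Integrate \<open>near_prob n e v' w'\<close> over all \<open>(v', w')\<close> in the square of half-width \<open>R + e\<close> around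
  \<open>(v, w)\<close>. By Fubini this is the mean of the area of the \<open>(v', w')\<close> that are within \<open>e\<close> of the pair of
  sums, which is \<open>4 e\<^sup>2\<close> whenever the pair is within \<open>R\<close> of \<open>(v, w)\<close>. The average over the
  square is attained or exceeded somewhere.
\<close>
lemma exists_heavy_point:
  assumes R: "R \<ge> 0" and e: "e > 0"
    and prob: "measure (G n) {x \<in> space (G n). \<bar>Sum1 n x - v\<bar> < R \<and> \<bar>Sum2 n x - w\<bar> < R} \<ge> 1 / 2"
  shows "\<exists>v' w'. \<bar>v' - v\<bar> \<le> R + e \<and> \<bar>w' - w\<bar> \<le> R + e \<and> near_prob n e v' w' \<ge> e\<^sup>2 / (4 * (R + e)\<^sup>2)"
proof (rule ccontr)
  let ?R = "R + e"
  let ?c = "e\<^sup>2 / (4 * ?R\<^sup>2)"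
  assume "\<not> ?thesis"
  then have small: "near_prob n e v' w' \<le> ?c" if "\<bar>v' - v\<bar> \<le> ?R" "\<bar>w' - w\<bar> \<le> ?R" for v' w'
    using that by (meson linear)
  have R': "?R > 0" using R e by simp
  have c: "?c \<ge> 0" by simp
  have [measurable]: "(\<lambda>x. x i) \<in> borel_measurable (G n)" if "i < n" for i
    using that by (rule measurable_G_component)
  let ?V = "\<lambda>v'. indicator {v - ?R..v + ?R} v' :: ennreal" and ?W = "\<lambda>w'. indicator {w - ?R..w + ?R} w' :: ennreal"
  let ?k = "\<lambda>x v' w'. (if \<bar>Sum1 n x - v'\<bar> < e then 1 else 0) * (if \<bar>Sum2 n x - w'\<bar> < e then 1 else 0) :: ennreal"
  let ?E = "{x \<in> space (G n). \<bar>Sum1 n x - v\<bar> < R \<and> \<bar>Sum2 n x - w\<bar> < R}"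
  let ?f = "\<lambda>x v' w'. ?V v' * ?W w' * ?k x v' w'"
  interpret L: pair_sigma_finite lborel "G n" ..
  have k: "(\<integral>\<^sup>+x. ?k x v' w' \<partial>G n) = ennreal (near_prob n e v' w')" for v' w'
  proof -
    have "(\<integral>\<^sup>+x. ?k x v' w' \<partial>G n) = (\<integral>\<^sup>+x. indicator {x \<in> space (G n). x \<in> sums_near n e v' w'} x \<partial>G n)"
      by (intro nn_integral_cong) (auto simp: indicator_def sums_near_def)
    also have "\<dots> = emeasure (G n) {x \<in> space (G n). x \<in> sums_near n e v' w'}"
      by (rule nn_integral_indicator) measurable
    finally show ?thesis by (simp add: emeasure_sums_near)
  qed
  have "ennreal (2 * e\<^sup>2) \<le> ennreal (4 * e\<^sup>2) * ennreal (measure (G n) ?E)"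
    using mult_left_mono[OF prob, of "4 * e\<^sup>2"] by (subst ennreal_mult[symmetric]) (auto intro!: ennreal_leI)
  also have "\<dots> = (\<integral>\<^sup>+x. ennreal (4 * e\<^sup>2) * indicator ?E x \<partial>G n)"
    by (subst nn_integral_cmult_indicator) (measurable, simp add: G.emeasure_eq_measure)
  also have "\<dots> \<le> (\<integral>\<^sup>+x. \<integral>\<^sup>+v'. \<integral>\<^sup>+w'. ?f x v' w' \<partial>lborel \<partial>lborel \<partial>G n)"
  proof (rule nn_integral_mono)
    fix x
    show "ennreal (4 * e\<^sup>2) * indicator ?E x \<le> (\<integral>\<^sup>+v'. \<integral>\<^sup>+w'. ?f x v' w' \<partial>lborel \<partial>lborel)"
    proof (cases "x \<in> ?E")
      case True
      have "ennreal (4 * e\<^sup>2) = ennreal (2 * e) * ennreal (2 * e)"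
        using e by (subst ennreal_mult[symmetric]) (auto simp: power2_eq_square)
      also have "\<dots> = (\<integral>\<^sup>+v'. \<integral>\<^sup>+w'. indicator {Sum1 n x - e<..<Sum1 n x + e} v' * indicator {Sum2 n x - e<..<Sum2 n x + e} w' \<partial>lborel \<partial>lborel)"
        using e by (simp add: nn_integral_cmult nn_integral_multc)
      also have "\<dots> \<le> (\<integral>\<^sup>+v'. \<integral>\<^sup>+w'. ?f x v' w' \<partial>lborel \<partial>lborel)"
        using True by (intro nn_integral_mono) (auto simp: indicator_def abs_less_iff)
      finally show ?thesis using True by simp
    qed simp
  qed
  also have "\<dots> = (\<integral>\<^sup>+v'. \<integral>\<^sup>+x. \<integral>\<^sup>+w'. ?f x v' w' \<partial>lborel \<partial>G n \<partial>lborel)"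
    by (rule L.Fubini') measurable
  also have "\<dots> = (\<integral>\<^sup>+v'. \<integral>\<^sup>+w'. \<integral>\<^sup>+x. ?f x v' w' \<partial>G n \<partial>lborel \<partial>lborel)"
    by (rule nn_integral_cong, rule L.Fubini') measurable
  also have "\<dots> = (\<integral>\<^sup>+v'. \<integral>\<^sup>+w'. ?V v' * ?W w' * ennreal (near_prob n e v' w') \<partial>lborel \<partial>lborel)"
    by (rule nn_integral_cong, rule nn_integral_cong, subst nn_integral_cmult) (measurable, simp only: k)
  also have "\<dots> \<le> (\<integral>\<^sup>+v'. \<integral>\<^sup>+w'. ennreal ?c * (?V v' * ?W w') \<partial>lborel \<partial>lborel)"
    using small by (intro nn_integral_mono) (auto simp: indicator_def abs_le_iff intro!: ennreal_leI)
  also have "\<dots> = ennreal ?c * (ennreal (2 * ?R) * ennreal (2 * ?R))"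
    using R' by (simp add: nn_integral_cmult nn_integral_multc)
  also have "\<dots> = ennreal (e\<^sup>2)"
  proof -
    have gen: "e\<^sup>2 / (4 * q\<^sup>2) * (2 * q * (2 * q)) = e\<^sup>2" if "q > 0" for q :: real
      using that by (simp add: power2_eq_square)
    have "?c * (2 * ?R * (2 * ?R)) = e\<^sup>2" using R' by (rule gen)
    then show ?thesis using R' c by (simp add: ennreal_mult[symmetric])
  qed
  finally have "2 * e\<^sup>2 \<le> e\<^sup>2" by (subst (asm) ennreal_le_iff) auto
  then show False using e by (auto simp: not_le)
qed

text \<open>
  Iterate the Harnack inequality from the heavy point to \<open>(n, n b)\<close>. With \<open>\<eta> = ln n / \<surd>n\<close> and \<open>L \<le> H \<surd>n\<close> steps
  the product of the factors is at least \<open>exp (- 4 \<eta> L) \<ge> n\<^bsup>- 4 H\<^esup>\<close>, while the accumulated error is of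
  order \<open>exp (- k (ln n)\<^sup>2)\<close> and thus smaller than every power of \<open>n\<close>.
\<close>
lemma sums_near_lower_bound:
  obtains c q n0 where "c > 0" "\<And>n e. n \<ge> n0 \<Longrightarrow> 0 < e \<Longrightarrow> e \<le> 1 \<Longrightarrow>
    near_prob n e (real n) (real n * b) \<ge> c * e\<^sup>2 * real n powr (- q)"
proof -
  obtain M where M: "M > 0" and window: "\<And>n. n > 0 \<Longrightarrow>
    measure (G n) {x \<in> space (G n). \<bar>Sum1 n x - real n\<bar> < M * sqrt (real n) \<and> \<bar>Sum2 n x - real n * b\<bar> < M * sqrt (real n)} \<ge> 1 / 2"
    by (rule window_probability) blast
  define H where "H = 10 * (M + 1) + 1"
  define c where "c = 1 / (8 * (M + 1)\<^sup>2)"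
  define A where "A = 4 * H * shell_const * (1 + 1 / pair_mean)"
  define k where "k = pair_mean\<^sup>2 / 2"
  have pos: "H > 0" "c > 0" "A > 0" "k > 0"
    using M shell_const_pos pair_mean_pos by (auto simp: H_def c_def A_def k_def intro!: mult_pos_pos add_pos_pos)
  have "eventually (\<lambda>n::nat. ln (real n) / sqrt (real n) \<le> 1/4) sequentially" by real_asymp
  moreover have "eventually (\<lambda>n::nat. A * sqrt (real n) * exp (- (k * (ln (real n))\<^sup>2)) \<le> c * real n powr (- (4 * H + 1))) sequentially"
    using pos by real_asymp
  ultimately have "eventually (\<lambda>n::nat. n \<ge> 10 \<and> ln (real n) / sqrt (real n) \<le> 1/4 \<and>
      A * sqrt (real n) * exp (- (k * (ln (real n))\<^sup>2)) \<le> c * real n powr (- (4 * H + 1))) sequentially"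
    using eventually_ge_at_top[of 10] by eventually_elim simp
  then obtain n0 where n0: "\<And>n. n \<ge> n0 \<Longrightarrow> n \<ge> 10 \<and> ln (real n) / sqrt (real n) \<le> 1/4 \<and>
      A * sqrt (real n) * exp (- (k * (ln (real n))\<^sup>2)) \<le> c * real n powr (- (4 * H + 1))"
    unfolding eventually_sequentially by blast
  have "near_prob n e (real n) (real n * b) \<ge> c * e\<^sup>2 * real n powr (- (4 * H + 1))" if n: "n \<ge> n0" and e: "0 < e" "e \<le> 1" for n e
  proof -
    define sq where "sq = sqrt (real n)"
    define \<eta> where "\<eta> = ln (real n) / sq"
    have n10: "n \<ge> 10" and \<eta>4: "\<eta> \<le> 1/4" and asym: "A * sq * exp (- (k * (ln (real n))\<^sup>2)) \<le> c * real n powr (- (4 * H + 1))"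
      using n0[OF n] by (auto simp: sq_def \<eta>_def)
    have sq: "sq \<ge> 1" "sq * sq = real n" using n10 by (auto simp: sq_def)
    have \<eta>0: "\<eta> > 0" using n10 sq by (simp add: \<eta>_def)
    have Re: "M * sq + e \<le> (M + 1) * sq" using e sq by (simp add: algebra_simps)
    have "n > 0" "M * sqrt (real n) \<ge> 0" using M n10 by auto
    from exists_heavy_point[OF this(2) e(1) window[OF this(1)]] obtain v w where
      vw0: "\<bar>v - real n\<bar> \<le> M * sq + e" "\<bar>w - real n * b\<bar> \<le> M * sq + e" "near_prob n e v w \<ge> e\<^sup>2 / (4 * (M * sq + e)\<^sup>2)"
      unfolding sq_def by blast
    have vw: "\<bar>v - real n\<bar> \<le> (M + 1) * sq" "\<bar>w - real n * b\<bar> \<le> (M + 1) * sq" using vw0 Re by auto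
    have "2 * c * e\<^sup>2 / real n = e\<^sup>2 / (4 * ((M + 1) * sq)\<^sup>2)"
    proof -
      have gen: "2 * (1 / (8 * m\<^sup>2)) * e\<^sup>2 / (q * q) = e\<^sup>2 / (4 * (m * q)\<^sup>2)" if "m > 0" "q > 0" for m q :: real
        using that by (simp add: power2_eq_square)
      show ?thesis using gen[of "M + 1" sq] M sq by (simp add: c_def)
    qed
    also have "\<dots> \<le> e\<^sup>2 / (4 * (M * sq + e)\<^sup>2)"
    proof (rule divide_left_mono)
      have p: "M * sq + e > 0" using M e sq by (intro add_pos_pos mult_pos_pos) auto
      show "4 * (M * sq + e)\<^sup>2 \<le> 4 * ((M + 1) * sq)\<^sup>2" using Re p by (intro mult_left_mono power_mono) auto
      show "0 < 4 * ((M + 1) * sq)\<^sup>2 * (4 * (M * sq + e)\<^sup>2)" using Re p M sq by (intro mult_pos_pos zero_less_power) auto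
    qed simp
    finally have Dvw: "near_prob n e v w \<ge> 2 * c * e\<^sup>2 / real n" using vw0(3) by linarith
    \<comment> \<open>The distance to the mean is at most \<open>(M + 1) \<surd>n\<close>, and each step may be at most \<open>1 / 10\<close>.\<close>
    define L where "L = nat \<lceil>10 * (M + 1) * sq\<rceil>"
    have L: "real L \<ge> 10 * (M + 1) * sq" "real L \<le> H * sq" "real L > 0"
    proof -
      have p: "10 * (M + 1) * sq > 0" using M sq by simp
      then show "real L \<ge> 10 * (M + 1) * sq" "real L > 0" unfolding L_def by linarith+
      have "real L \<le> 10 * (M + 1) * sq + 1" unfolding L_def using p by linarith
      also have "\<dots> \<le> H * sq" using sq by (simp add: H_def algebra_simps)
      finally show "real L \<le> H * sq" .
    qed
    define d1 where "d1 = (v - real n) / real L"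
    define d2 where "d2 = (w - real n * b) / real L"
    have dd: "\<bar>t\<bar> / real L \<le> 1/10" if "\<bar>t\<bar> \<le> (M + 1) * sq" for t
      using that L by (subst pos_divide_le_eq) (auto simp: algebra_simps)
    have d: "\<bar>d1\<bar> \<le> 1/10" "\<bar>d2\<bar> \<le> 1/10"
      unfolding d1_def d2_def abs_divide abs_of_nat by (rule dd[OF vw(1)], rule dd[OF vw(2)])
    have vL: "v - real L * d1 = real n" "w - real L * d2 = real n * b" using L by (auto simp: d1_def d2_def)
    define N where "N = (n - 3) div 2"
    have N: "3 + 2 * N \<le> n" "N > 0" "real N \<ge> real n / 4" using n10 by (auto simp: N_def)
    let ?\<beta> = "shell_const * e\<^sup>2 * (4 * exp (- 2 * real N * pair_mean\<^sup>2 * \<eta>\<^sup>2))"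
    have HI: "near_prob n e (real n) (real n * b) \<ge> ((1 - \<eta>) / (1 + \<eta>)) ^ L * near_prob n e v w - real L * (?\<beta> * (1 + 1 / pair_mean))"
      using Harnack_iterated[OF e(1) \<eta>0 _ N(1,2) d refl, where v=v and w=w and L=L] \<eta>4 by (simp add: vL)
    have "real n powr (- (4 * H)) * (2 * c * e\<^sup>2 / real n) \<le> ((1 - \<eta>) / (1 + \<eta>)) ^ L * near_prob n e v w"
    proof (rule mult_mono)
      have "exp (- 4 * \<eta>) \<le> (1 - \<eta>) / (1 + \<eta>)"
      proof -
        have "- (2 * \<eta>) - 2 * (2 * \<eta>)\<^sup>2 \<le> ln (1 - 2 * \<eta>)"
          using \<eta>0 \<eta>4 by (intro ln_one_minus_pos_lower_bound) auto
        moreover have "(2 * \<eta>)\<^sup>2 \<le> \<eta>"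
        proof -
          have "\<eta> * (4 * \<eta>) \<le> \<eta> * 1" using \<eta>0 \<eta>4 by (intro mult_left_mono) auto
          then show ?thesis by (simp add: power2_eq_square)
        qed
        ultimately have "- 4 * \<eta> \<le> ln (1 - 2 * \<eta>)" by linarith
        then have "exp (- 4 * \<eta>) \<le> 1 - 2 * \<eta>" using \<eta>4 by (subst (asm) ln_ge_iff) auto
        also have "\<dots> \<le> (1 - \<eta>) / (1 + \<eta>)"
          using \<eta>0 by (subst pos_le_divide_eq) (auto simp: algebra_simps)
        finally show ?thesis .
      qed
      then have "exp (- 4 * \<eta>) ^ L \<le> ((1 - \<eta>) / (1 + \<eta>)) ^ L" by (rule power_mono) simp
      moreover have "real n powr (- (4 * H)) \<le> exp (- 4 * \<eta>) ^ L"
      proof -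
        have "4 * \<eta> * real L \<le> 4 * \<eta> * (H * sq)" using L \<eta>0 by (intro mult_left_mono) auto
        also have "\<dots> = 4 * H * ln (real n)" using sq by (simp add: \<eta>_def)
        finally show ?thesis using n10 by (simp add: powr_def exp_of_nat_mult[symmetric] algebra_simps)
      qed
      ultimately show "real n powr (- (4 * H)) \<le> ((1 - \<eta>) / (1 + \<eta>)) ^ L" by linarith
    qed (use Dvw \<eta>0 \<eta>4 pos in auto)
    moreover have "real n powr (- (4 * H)) * (2 * c * e\<^sup>2 / real n) = 2 * (c * e\<^sup>2 * real n powr (- (4 * H + 1)))"
      using n10 by (simp add: powr_diff powr_minus_divide)
    moreover have "real L * (?\<beta> * (1 + 1 / pair_mean)) \<le> e\<^sup>2 * (A * sq * exp (- (k * (ln (real n))\<^sup>2)))"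
    proof -
      have "k * (ln (real n))\<^sup>2 = 2 * (real n / 4) * pair_mean\<^sup>2 * \<eta>\<^sup>2"
        using sq by (simp add: k_def \<eta>_def power_divide power2_eq_square)
      also have "\<dots> \<le> 2 * real N * pair_mean\<^sup>2 * \<eta>\<^sup>2"
        using N by (intro mult_right_mono mult_left_mono) auto
      finally have E: "exp (- 2 * real N * pair_mean\<^sup>2 * \<eta>\<^sup>2) \<le> exp (- (k * (ln (real n))\<^sup>2))" by simp
      have "real L * (?\<beta> * (1 + 1 / pair_mean)) \<le> (H * sq) * ((shell_const * e\<^sup>2 * (4 * exp (- (k * (ln (real n))\<^sup>2)))) * (1 + 1 / pair_mean))"
        using L shell_const_pos pair_mean_pos E pos sq by (intro mult_mono) auto
      also have "\<dots> = e\<^sup>2 * (A * sq * exp (- (k * (ln (real n))\<^sup>2)))"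
        by (simp only: A_def mult.assoc mult.commute mult.left_commute)
      finally show ?thesis .
    qed
    moreover have "e\<^sup>2 * (A * sq * exp (- (k * (ln (real n))\<^sup>2))) \<le> e\<^sup>2 * (c * real n powr (- (4 * H + 1)))"
      by (intro mult_left_mono asym) auto
    ultimately show ?thesis using HI by (simp add: ac_simps)
  qed
  with pos(2) show thesis by (rule that)
qed

end

section \<open>Uniform measures on thin shells\<close>
lemma ennreal_inverse_antimono: "a \<le> b \<Longrightarrow> inverse b \<le> inverse (a :: ennreal)"
proof (cases "a = 0 \<or> b = top")
  case False
  assume "a \<le> b"
  then show ?thesis using False
    by (cases a; cases b) (auto simp: inverse_ennreal ennreal_le_iff2 top_unique intro!: ennreal_leI le_imp_inverse_le)
qed auto

lemma sets_shell [measurable]: "shell n b e \<in> sets (PiM {..<n} (\<lambda>_. borel))"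
proof -
  have "shell n b e = {x \<in> space (PiM {..<n} (\<lambda>_. borel :: real measure)). (\<forall>i\<in>{..<n}. 0 < x i) \<and>
     \<bar>(\<Sum>i<n. x i) - real n\<bar> < e \<and> \<bar>(\<Sum>i<n. (x i)\<^sup>2) - real n * b\<bar> < e}"
    by (intro set_eqI iffI) (simp_all add: shell_def space_PiM PiE_iff)
  also have "\<dots> \<in> sets (PiM {..<n} (\<lambda>_. borel))" by measurable
  finally show ?thesis .
qed

lemma sets_PiM_lborel: "sets (PiM {..<n} (\<lambda>_. lborel :: real measure)) = sets (PiM {..<n} (\<lambda>_. borel))"
  by (rule sets_PiM_cong) auto

context gibbs
begin

text \<open>
  Both sides agree on boxes.
\<close>
lemma G_density: "G n = density (PiM {..<n} (\<lambda>_. lborel)) (\<lambda>x. ennreal (\<Prod>i<n. p (x i)))"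
proof -
  interpret L: product_sigma_finite "\<lambda>_::nat. lborel :: real measure" ..
  show ?thesis
    unfolding G_def
  proof (rule sym, rule prod.PiM_eqI)
    show "sets (density (PiM {..<n} (\<lambda>_. lborel)) (\<lambda>x. ennreal (\<Prod>i<n. p (x i)))) = sets (PiM {..<n} (\<lambda>_. \<mu>))"
      by (simp, rule sets_PiM_cong) auto
    fix A assume "\<And>i. i \<in> {..<n} \<Longrightarrow> A i \<in> sets \<mu>"
    then have A: "A i \<in> sets borel" if "i < n" for i using that by simp
    have "PiE {..<n} A \<in> sets (PiM {..<n} (\<lambda>_. lborel))"
      using A by (intro sets_PiM_I_finite) auto
    then have "emeasure (density (PiM {..<n} (\<lambda>_. lborel)) (\<lambda>x. ennreal (\<Prod>i<n. p (x i)))) (PiE {..<n} A) =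
      (\<integral>\<^sup>+x. ennreal (\<Prod>i<n. p (x i)) * indicator (PiE {..<n} A) x \<partial>PiM {..<n} (\<lambda>_. lborel))"
      by (intro emeasure_density) auto
    also have "\<dots> = (\<integral>\<^sup>+x. (\<Prod>i<n. ennreal (p (x i)) * indicator (A i) (x i)) \<partial>PiM {..<n} (\<lambda>_. lborel))"
    proof (rule nn_integral_cong)
      fix x assume x: "x \<in> space (PiM {..<n} (\<lambda>_. lborel :: real measure))"
      have "(indicator (PiE {..<n} A) x :: ennreal) = (\<Prod>i<n. indicator (A i) (x i))"
        using x by (auto simp: indicator_def space_PiM PiE_iff prod_eq_1_iff)
      then show "ennreal (\<Prod>i<n. p (x i)) * indicator (PiE {..<n} A) x = (\<Prod>i<n. ennreal (p (x i)) * indicator (A i) (x i))"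
        by (simp add: prod_ennreal prod.distrib)
    qed
    also have "\<dots> = (\<Prod>i<n. \<integral>\<^sup>+z. ennreal (p z) * indicator (A i) z \<partial>lborel)"
      using A by (intro L.product_nn_integral_prod) auto
    also have "\<dots> = (\<Prod>i<n. emeasure \<mu> (A i))"
      using A by (intro prod.cong refl) (simp add: \<mu>_def emeasure_density)
    finally show "emeasure (density (PiM {..<n} (\<lambda>_. lborel)) (\<lambda>x. ennreal (\<Prod>i<n. p (x i)))) (PiE {..<n} A) = (\<Prod>i<n. emeasure \<mu> (A i))" .
  qed simp
qed

lemma emeasure_G_shell: "emeasure (G n) (shell n b e) = ennreal (near_prob n e (real n) (real n * b))"
proof -
  have "emeasure (G n) (shell n b e) = emeasure (G n) {x \<in> space (G n). x \<in> sums_near n e (real n) (real n * b)}"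
  proof (intro emeasure_eq_AE)
    from AE_G_pos[of n] show "AE x in G n. x \<in> shell n b e \<longleftrightarrow> x \<in> {x \<in> space (G n). x \<in> sums_near n e (real n) (real n * b)}"
      using AE_space by eventually_elim (auto simp: shell_def sums_near_def space_G PiE_iff)
    show "shell n b e \<in> sets (G n)" by (simp add: sets_G)
    show "{x \<in> space (G n). x \<in> sums_near n e (real n) (real n * b)} \<in> sets (G n)" by measurable
  qed
  then show ?thesis by (simp add: emeasure_sums_near)
qed

lemma shell_subset_sums_near: "x \<in> shell n b e \<Longrightarrow> x \<in> sums_near n e (real n) (real n * b)"
  by (auto simp: shell_def sums_near_def)

text \<open>
  On a shell the density of \<open>G n\<close> with respect to Lebesgue measure is constant up to a factor between
  \<open>exp (- k)\<close> and \<open>exp k\<close>, so Lebesgue measure on the shell may be replaced by \<open>G n\<close>. The numerator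
  is then bounded by \<open>sums_near_bound\<close> and the denominator by \<open>sums_near_lower_bound\<close>; the
  two factors \<open>e\<^sup>2\<close> cancel, which makes the bound uniform in the thickness.
\<close>
lemma uniform_shell_comparison:
  obtains C q n0 where "C > 0" "n0 > 0" "\<And>n e T g. n \<ge> n0 \<Longrightarrow> 0 < e \<Longrightarrow> e \<le> 1 \<Longrightarrow> card T = 3 \<Longrightarrow> T \<subseteq> {..<n} \<Longrightarrow>
    g \<in> borel_measurable (PiM {..<n} (\<lambda>_. borel)) \<Longrightarrow> ignores T g \<Longrightarrow>
    (\<integral>\<^sup>+x. g x \<partial>uniform_measure (PiM {..<n} (\<lambda>_. lborel)) (shell n b e)) \<le> ennreal (C * real n powr q) * (\<integral>\<^sup>+x. g x \<partial>G n)"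
proof -
  obtain c q n0 where c: "c > 0" and low: "\<And>n e. n \<ge> n0 \<Longrightarrow> 0 < e \<Longrightarrow> e \<le> 1 \<Longrightarrow>
    near_prob n e (real n) (real n * b) \<ge> c * e\<^sup>2 * real n powr (- q)"
    by (rule sums_near_lower_bound) blast
  define k where "k = r + \<bar>s\<bar>"
  define C where "C = exp k * exp k * shell_const / c"
  have C: "C > 0" using shell_const_pos c by (simp add: C_def)
  have main: "(\<integral>\<^sup>+x. g x \<partial>uniform_measure (PiM {..<n} (\<lambda>_. lborel)) (shell n b e)) \<le> ennreal (C * real n powr q) * (\<integral>\<^sup>+x. g x \<partial>G n)"
    if n: "n \<ge> max 1 n0" and e: "0 < e" "e \<le> 1" and T: "card T = 3" "T \<subseteq> {..<n}"
    and gm: "g \<in> borel_measurable (PiM {..<n} (\<lambda>_. borel))" and dep: "ignores T g" for n e T g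
  proof -
    let ?\<Lambda> = "PiM {..<n} (\<lambda>_. lborel :: real measure)"
    have setsL: "sets ?\<Lambda> = sets (PiM {..<n} (\<lambda>_. borel))" by (rule sets_PiM_cong) auto
    note [measurable_cong] = setsL
    have [measurable]: "g \<in> borel_measurable ?\<Lambda>" "g \<in> borel_measurable (G n)"
      using gm by (simp_all cong: measurable_cong_sets add: setsL sets_G)
    have [measurable]: "shell n b e \<in> sets ?\<Lambda>" by (simp add: setsL)
    \<comment> \<open>The value of the density of \<open>G n\<close> on \<open>K n b\<close>.\<close>
    define w0 where "w0 = exp (- r * (real n * b) - s * real n) / normalizer ^ n"
    have w0: "w0 > 0" using normalizer_pos by (simp add: w0_def)
    define y where "y = c * e\<^sup>2 * real n powr (- q)"
    have y: "y > 0" using c e n by (simp add: y_def)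
    have dens: "(\<Prod>i<n. p (x i)) \<in> {w0 * exp (- k)..w0 * exp k}" if x: "x \<in> shell n b e" for x
    proof -
      have "(\<Prod>i<n. p (x i)) = (\<Prod>i<n. exp (- r * (x i)\<^sup>2 - s * x i) / normalizer)"
        using x by (intro prod.cong) (auto simp: p_eq gibbs_weight_def shell_def PiE_iff less_imp_le)
      also have "\<dots> = exp (\<Sum>i<n. - r * (x i)\<^sup>2 - s * x i) / normalizer ^ n"
        by (simp add: prod_dividef exp_sum)
      also have "(\<Sum>i<n. - r * (x i)\<^sup>2 - s * x i) = - r * (\<Sum>i<n. (x i)\<^sup>2) - s * (\<Sum>i<n. x i)"
        by (simp add: sum_subtractf sum_distrib_left sum_negf)
      also have "exp (- r * (\<Sum>i<n. (x i)\<^sup>2) - s * (\<Sum>i<n. x i)) / normalizer ^ n =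
        w0 * exp (- (r * ((\<Sum>i<n. (x i)\<^sup>2) - real n * b)) - s * ((\<Sum>i<n. x i) - real n))"
        by (simp add: w0_def exp_add[symmetric] algebra_simps)
      finally have eq: "(\<Prod>i<n. p (x i)) = w0 * exp (- (r * ((\<Sum>i<n. (x i)\<^sup>2) - real n * b)) - s * ((\<Sum>i<n. x i) - real n))" .
      have S: "\<bar>(\<Sum>i<n. (x i)\<^sup>2) - real n * b\<bar> \<le> 1" "\<bar>(\<Sum>i<n. x i) - real n\<bar> \<le> 1"
        using x e by (simp_all add: shell_def)
      have "\<bar>r * ((\<Sum>i<n. (x i)\<^sup>2) - real n * b)\<bar> \<le> r * 1"
        unfolding abs_mult using S(1) decay by (intro mult_mono) auto
      moreover have "\<bar>s * ((\<Sum>i<n. x i) - real n)\<bar> \<le> \<bar>s\<bar> * 1"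
        unfolding abs_mult using S(2) by (intro mult_mono) auto
      ultimately have "- k \<le> - (r * ((\<Sum>i<n. (x i)\<^sup>2) - real n * b)) - s * ((\<Sum>i<n. x i) - real n)"
        "- (r * ((\<Sum>i<n. (x i)\<^sup>2) - real n * b)) - s * ((\<Sum>i<n. x i) - real n) \<le> k"
        unfolding k_def by linarith+
      then show ?thesis using w0 by (simp add: eq)
    qed
    let ?X = "\<integral>\<^sup>+x. g x * indicator (shell n b e) x \<partial>?\<Lambda>"
    let ?l = "emeasure ?\<Lambda> (shell n b e)"
    have Gint: "(\<integral>\<^sup>+x. h x \<partial>G n) = (\<integral>\<^sup>+x. ennreal (\<Prod>i<n. p (x i)) * h x \<partial>?\<Lambda>)"
      if [measurable]: "h \<in> borel_measurable ?\<Lambda>" for h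
      unfolding G_density by (rule nn_integral_density) measurable
    have "ennreal (w0 * exp (- k)) * ?X = (\<integral>\<^sup>+x. ennreal (w0 * exp (- k)) * (g x * indicator (shell n b e) x) \<partial>?\<Lambda>)"
      by (rule nn_integral_cmult[symmetric]) measurable
    also have "\<dots> \<le> (\<integral>\<^sup>+x. ennreal (\<Prod>i<n. p (x i)) * (g x * indicator (shell n b e) x) \<partial>?\<Lambda>)"
    proof (rule nn_integral_mono)
      fix x
      show "ennreal (w0 * exp (- k)) * (g x * indicator (shell n b e) x) \<le> ennreal (\<Prod>i<n. p (x i)) * (g x * indicator (shell n b e) x)"
        using dens[of x] by (cases "x \<in> shell n b e") (auto intro!: mult_right_mono ennreal_leI)
    qed
    also have "\<dots> = (\<integral>\<^sup>+x. g x * indicator (shell n b e) x \<partial>G n)"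
      by (rule Gint[symmetric]) measurable
    also have "\<dots> \<le> (\<integral>\<^sup>+x. g x * indicator (sums_near n e (real n) (real n * b)) x \<partial>G n)"
      by (intro nn_integral_mono mult_left_mono) (auto simp: indicator_def shell_subset_sums_near)
    also have "\<dots> \<le> ennreal (4 * pi * pmax ^ 3 * e\<^sup>2) * (\<integral>\<^sup>+x. g x \<partial>G n)"
      using pmax e T dep by (intro sums_near_bound) auto
    also have "4 * pi * pmax ^ 3 * e\<^sup>2 = shell_const * e\<^sup>2" by (simp add: shell_const_def)
    finally have X: "ennreal (w0 * exp (- k)) * ?X \<le> ennreal (shell_const * e\<^sup>2) * (\<integral>\<^sup>+x. g x \<partial>G n)" .
    have "ennreal y \<le> emeasure (G n) (shell n b e)"
      unfolding emeasure_G_shell y_def using low n e by (intro ennreal_leI) auto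
    also have "\<dots> = (\<integral>\<^sup>+x. indicator (shell n b e) x \<partial>G n)"
      by (rule nn_integral_indicator[symmetric]) (simp add: sets_G)
    also have "\<dots> = (\<integral>\<^sup>+x. ennreal (\<Prod>i<n. p (x i)) * indicator (shell n b e) x \<partial>?\<Lambda>)"
      by (rule Gint) measurable
    also have "\<dots> \<le> (\<integral>\<^sup>+x. ennreal (w0 * exp k) * indicator (shell n b e) x \<partial>?\<Lambda>)"
    proof (rule nn_integral_mono)
      fix x
      show "ennreal (\<Prod>i<n. p (x i)) * indicator (shell n b e) x \<le> ennreal (w0 * exp k) * indicator (shell n b e) x"
        using dens[of x] by (cases "x \<in> shell n b e") (auto intro!: ennreal_leI)
    qed
    also have "\<dots> = ennreal (w0 * exp k) * ?l"
      by (rule nn_integral_cmult_indicator) measurable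
    finally have l: "ennreal y \<le> ennreal (w0 * exp k) * ?l" .
    have "ennreal (y / (w0 * exp k)) = ennreal (1 / (w0 * exp k)) * ennreal y"
      using y w0 by (subst ennreal_mult[symmetric]) auto
    also have "\<dots> \<le> ennreal (1 / (w0 * exp k)) * (ennreal (w0 * exp k) * ?l)"
      by (intro mult_left_mono l) simp
    also have "\<dots> = ?l"
      using w0 by (simp add: mult.assoc[symmetric] ennreal_mult[symmetric])
    finally have l': "ennreal (y / (w0 * exp k)) \<le> ?l" .
    have "?X = ennreal (1 / (w0 * exp (- k))) * (ennreal (w0 * exp (- k)) * ?X)"
      using w0 by (simp add: mult.assoc[symmetric] ennreal_mult[symmetric] exp_minus[symmetric])
    also have "\<dots> \<le> ennreal (1 / (w0 * exp (- k))) * (ennreal (shell_const * e\<^sup>2) * (\<integral>\<^sup>+x. g x \<partial>G n))"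
      by (intro mult_left_mono X) simp
    finally have X': "?X \<le> ennreal (1 / (w0 * exp (- k))) * (ennreal (shell_const * e\<^sup>2) * (\<integral>\<^sup>+x. g x \<partial>G n))" .
    have "(\<integral>\<^sup>+x. g x \<partial>uniform_measure ?\<Lambda> (shell n b e)) = ?X / ?l"
      by (rule nn_integral_uniform_measure) measurable
    also have "\<dots> \<le> ?X * inverse (ennreal (y / (w0 * exp k)))"
      unfolding divide_ennreal_def by (intro mult_left_mono ennreal_inverse_antimono l') simp
    also have "inverse (ennreal (y / (w0 * exp k))) = ennreal (w0 * exp k / y)"
      using y w0 by (subst inverse_ennreal) auto
    also have "?X * ennreal (w0 * exp k / y) \<le> ennreal (1 / (w0 * exp (- k))) * (ennreal (shell_const * e\<^sup>2) * (\<integral>\<^sup>+x. g x \<partial>G n)) * ennreal (w0 * exp k / y)"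
      by (intro mult_right_mono X') simp
    also have "\<dots> = ennreal (1 / (w0 * exp (- k)) * (shell_const * e\<^sup>2) * (w0 * exp k / y)) * (\<integral>\<^sup>+x. g x \<partial>G n)"
    proof -
      have gen: "ennreal a1 * (ennreal a2 * I) * ennreal a3 = ennreal (a1 * a2 * a3) * I"
        if "a1 \<ge> 0" "a2 \<ge> 0" "a3 \<ge> 0" for a1 a2 a3 I
        using that by (simp add: ennreal_mult ac_simps)
      show ?thesis using w0 shell_const_pos y by (intro gen) auto
    qed
    also have "1 / (w0 * exp (- k)) * (shell_const * e\<^sup>2) * (w0 * exp k / y) = C * real n powr q"
      using w0 e c n by (simp add: C_def y_def powr_minus exp_minus field_simps)
    finally show ?thesis .
  qed
  show thesis by (rule that[of C "max 1 n0" q]) (use C main in auto)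
qed

end

section \<open>Exchangeability of the uniform distribution\<close>
lemma measurable_continuous_PiM:
  fixes f :: "(nat \<Rightarrow> real) \<Rightarrow> real"
  assumes "continuous_on UNIV f"
  shows "f \<in> borel_measurable (PiM {..<n} (\<lambda>_. borel))"
proof -
  have "(\<lambda>x. x) \<in> measurable (PiM {..<n} (\<lambda>_. borel :: real measure)) (PiM UNIV (\<lambda>_. borel))"
  proof (rule measurable_PiM_single')
    fix i :: nat
    show "(\<lambda>x. x i) \<in> borel_measurable (PiM {..<n} (\<lambda>_. borel :: real measure))"
    proof (cases "i < n")
      case False
      have "(\<lambda>x. x i) \<in> borel_measurable (PiM {..<n} (\<lambda>_. borel :: real measure)) \<longleftrightarrow>
        (\<lambda>x. undefined :: real) \<in> borel_measurable (PiM {..<n} (\<lambda>_. borel :: real measure))"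
      proof (rule measurable_cong)
        fix x assume "x \<in> space (PiM {..<n} (\<lambda>_. borel :: real measure))"
        then show "x i = undefined" using False by (simp add: space_PiM PiE_iff extensional_def)
      qed
      then show ?thesis by simp
    qed (simp add: measurable_component_singleton)
  qed (simp add: PiE_iff)
  then have "(\<lambda>x. x) \<in> measurable (PiM {..<n} (\<lambda>_. borel :: real measure)) (borel :: (nat \<Rightarrow> real) measure)"
    by (simp cong: measurable_cong_sets add: sets_PiM_equal_borel)
  from measurable_compose[OF this borel_measurable_continuous_onI[OF assms]] show ?thesis .
qed

lemma continuous_on_block:
  fixes f :: "(nat \<Rightarrow> real) \<Rightarrow> real"
  assumes "continuous_on UNIV f"
  shows "continuous_on UNIV (\<lambda>x. f (block c k x))"
proof -
  have "continuous_on UNIV (block c k)"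
  proof (rule continuous_on_coordinatewise_then_product)
    fix i
    show "continuous_on UNIV (\<lambda>x. block c k x i)"
      by (cases "i < k") (auto simp: block_def intro: continuous_on_product_coordinates)
  qed
  from continuous_on_compose2[OF assms this] show ?thesis by simp
qed

lemma ignores_block:
  assumes "T \<inter> {c..<c + k} = {}"
  shows "ignores T (\<lambda>x. f (block c k x))"
  unfolding ignores_def
proof (intro allI impI)
  fix x y :: "nat \<Rightarrow> real" assume *: "\<forall>l. l \<notin> T \<longrightarrow> x l = y l"
  have "block c k x = block c k y"
  proof
    fix i
    have "i < k \<Longrightarrow> c + i \<notin> T" using assms by auto
    then show "block c k x i = block c k y i" using * by (simp add: block_def)
  qed
  then show "f (block c k x) = f (block c k y)" by simp
qed

definition involution_on :: "nat \<Rightarrow> (nat \<Rightarrow> nat) \<Rightarrow> bool" where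
  "involution_on n \<pi> \<longleftrightarrow> (\<forall>i. \<pi> (\<pi> i) = i) \<and> (\<forall>i<n. \<pi> i < n)"

lemma involution_onD:
  assumes "involution_on n \<pi>"
  shows "\<pi> (\<pi> i) = i" "\<pi> i < n \<longleftrightarrow> i < n"
proof -
  show inv: "\<pi> (\<pi> i) = i" for i using assms unfolding involution_on_def by blast
  have "i < n \<Longrightarrow> \<pi> i < n" for i using assms unfolding involution_on_def by blast
  from this[of i] this[of "\<pi> i"] show "\<pi> i < n \<longleftrightarrow> i < n" by (auto simp: inv)
qed

lemma sum_involution:
  assumes "involution_on n \<pi>"
  shows "(\<Sum>i<n. f (\<pi> i)) = (\<Sum>i<n. f i)"
  by (rule sum.reindex_bij_witness[of _ \<pi> \<pi>]) (auto simp: involution_onD[OF assms])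

text \<open>
  Composition with \<open>\<pi>\<close> maps a box to the box with permuted sides, which has the same volume.
\<close>
lemma distr_PiM_involution:
  assumes \<pi>: "involution_on n \<pi>"
  shows "distr (PiM {..<n} (\<lambda>_. lborel :: real measure)) (PiM {..<n} (\<lambda>_. lborel)) (\<lambda>x. x \<circ> \<pi>) = PiM {..<n} (\<lambda>_. lborel)"
    and "(\<lambda>x. x \<circ> \<pi>) \<in> measurable (PiM {..<n} (\<lambda>_. lborel :: real measure)) (PiM {..<n} (\<lambda>_. lborel))"
proof -
  interpret L: product_sigma_finite "\<lambda>_::nat. lborel :: real measure" ..
  let ?\<Lambda> = "PiM {..<n} (\<lambda>_. lborel :: real measure)"
  note inv = involution_onD[OF \<pi>]
  show meas: "(\<lambda>x. x \<circ> \<pi>) \<in> measurable ?\<Lambda> ?\<Lambda>"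
  proof (rule measurable_PiM_single')
    show "(\<lambda>x. x \<circ> \<pi>) \<in> space ?\<Lambda> \<rightarrow> {..<n} \<rightarrow>\<^sub>E space lborel"
      by (auto simp: space_PiM PiE_iff extensional_def inv)
    fix i assume "i \<in> {..<n}"
    then have "(\<lambda>x. x (\<pi> i)) \<in> measurable ?\<Lambda> lborel"
      by (intro measurable_component_singleton) (simp add: inv)
    then show "(\<lambda>x. (x \<circ> \<pi>) i) \<in> measurable ?\<Lambda> lborel" by (simp add: comp_def)
  qed
  show "distr ?\<Lambda> ?\<Lambda> (\<lambda>x. x \<circ> \<pi>) = ?\<Lambda>"
  proof (rule L.PiM_eqI)
    fix A assume A: "\<And>i. i \<in> {..<n} \<Longrightarrow> A i \<in> sets (lborel :: real measure)"
    have "(\<lambda>x. x \<circ> \<pi>) -` PiE {..<n} A \<inter> space ?\<Lambda> = PiE {..<n} (\<lambda>i. A (\<pi> i))"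
    proof (intro set_eqI iffI)
      fix x assume "x \<in> (\<lambda>x. x \<circ> \<pi>) -` PiE {..<n} A \<inter> space ?\<Lambda>"
      then have x: "\<And>i. i < n \<Longrightarrow> x (\<pi> i) \<in> A i" "x \<in> extensional {..<n}"
        by (auto simp: space_PiM PiE_iff)
      have "x i \<in> A (\<pi> i)" if "i < n" for i
        using x(1)[of "\<pi> i"] that by (simp add: inv)
      then show "x \<in> PiE {..<n} (\<lambda>i. A (\<pi> i))" using x(2) by (auto simp: PiE_iff)
    next
      fix x assume "x \<in> PiE {..<n} (\<lambda>i. A (\<pi> i))"
      then have x: "\<And>i. i < n \<Longrightarrow> x i \<in> A (\<pi> i)" "x \<in> extensional {..<n}"
        by (auto simp: PiE_iff)
      have "x (\<pi> i) \<in> A i" if "i < n" for i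
        using x(1)[of "\<pi> i"] that by (simp add: inv)
      then show "x \<in> (\<lambda>x. x \<circ> \<pi>) -` PiE {..<n} A \<inter> space ?\<Lambda>"
        using x(2) by (auto simp: space_PiM PiE_iff extensional_def inv)
    qed
    then have "emeasure (distr ?\<Lambda> ?\<Lambda> (\<lambda>x. x \<circ> \<pi>)) (PiE {..<n} A) = emeasure ?\<Lambda> (PiE {..<n} (\<lambda>i. A (\<pi> i)))"
      using meas A by (subst emeasure_distr) (auto intro!: sets_PiM_I_finite)
    also have "\<dots> = (\<Prod>i<n. emeasure lborel (A (\<pi> i)))"
      using A by (intro L.emeasure_PiM) (auto simp: inv)
    also have "\<dots> = (\<Prod>i<n. emeasure lborel (A i))"
      by (rule prod.reindex_bij_witness[of _ \<pi> \<pi>]) (auto simp: inv)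
    finally show "emeasure (distr ?\<Lambda> ?\<Lambda> (\<lambda>x. x \<circ> \<pi>)) (PiE {..<n} A) = (\<Prod>i<n. emeasure lborel (A i))" .
  qed auto
qed

lemma shell_involution:
  assumes \<pi>: "involution_on n \<pi>"
  shows "x \<circ> \<pi> \<in> shell n b e \<longleftrightarrow> x \<in> shell n b e"
proof -
  note inv = involution_onD[OF \<pi>]
  have "(\<Sum>i<n. x (\<pi> i)) = (\<Sum>i<n. x i)" "(\<Sum>i<n. (x (\<pi> i))\<^sup>2) = (\<Sum>i<n. (x i)\<^sup>2)"
    by (rule sum_involution[OF \<pi>])+
  moreover have "(\<forall>i\<in>{..<n}. x (\<pi> i) \<in> {0<..}) \<longleftrightarrow> (\<forall>i\<in>{..<n}. x i \<in> {0<..})"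
    using inv by (metis lessThan_iff)
  moreover have "x \<circ> \<pi> \<in> extensional {..<n} \<longleftrightarrow> x \<in> extensional {..<n}"
    unfolding extensional_def using inv by (simp) (metis)
  ultimately show ?thesis by (simp add: shell_def PiE_iff)
qed

lemma uniform_shell_involution:
  assumes \<pi>: "involution_on n \<pi>"
  defines "\<Lambda> \<equiv> PiM {..<n} (\<lambda>_. lborel :: real measure)"
  shows "distr (uniform_measure \<Lambda> (shell n b e)) \<Lambda> (\<lambda>x. x \<circ> \<pi>) = uniform_measure \<Lambda> (shell n b e)"
proof (rule measure_eqI)
  let ?s = "shell n b e" and ?U = "uniform_measure \<Lambda> (shell n b e)"
  have s: "?s \<in> sets \<Lambda>" unfolding \<Lambda>_def by (simp add: sets_PiM_lborel sets_shell)
  have m: "(\<lambda>x. x \<circ> \<pi>) \<in> measurable \<Lambda> \<Lambda>" and d: "distr \<Lambda> \<Lambda> (\<lambda>x. x \<circ> \<pi>) = \<Lambda>"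
    unfolding \<Lambda>_def by (rule distr_PiM_involution[OF \<pi>])+
  fix A assume "A \<in> sets (distr ?U \<Lambda> (\<lambda>x. x \<circ> \<pi>))"
  then have A: "A \<in> sets \<Lambda>" by simp
  let ?B = "(\<lambda>x. x \<circ> \<pi>) -` A \<inter> space \<Lambda>"
  have B: "?B \<in> sets \<Lambda>" using m A by (rule measurable_sets)
  have "emeasure (distr ?U \<Lambda> (\<lambda>x. x \<circ> \<pi>)) A = emeasure ?U ?B"
    using m A by (subst emeasure_distr) (auto cong: measurable_cong_sets)
  also have "\<dots> = emeasure \<Lambda> (?s \<inter> ?B) / emeasure \<Lambda> ?s"
    using s B by (rule emeasure_uniform_measure)
  also have "?s \<inter> ?B = (\<lambda>x. x \<circ> \<pi>) -` (?s \<inter> A) \<inter> space \<Lambda>"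
    using shell_involution[OF \<pi>] by auto
  also have "emeasure \<Lambda> \<dots> = emeasure (distr \<Lambda> \<Lambda> (\<lambda>x. x \<circ> \<pi>)) (?s \<inter> A)"
    using m s A by (subst emeasure_distr) auto
  also have "\<dots> / emeasure \<Lambda> ?s = emeasure ?U A"
    unfolding d using s A by (rule emeasure_uniform_measure[symmetric])
  finally show "emeasure (distr ?U \<Lambda> (\<lambda>x. x \<circ> \<pi>)) A = emeasure ?U A" .
qed simp

text \<open>
  The invariance holds for the normalized Lebesgue measure on each shell and passes to the weak limit.
\<close>
lemma uniform_on_K_involution:
  fixes f :: "(nat \<Rightarrow> real) \<Rightarrow> real"
  assumes \<nu>: "is_uniform_on_K n b \<nu>" and \<pi>: "involution_on n \<pi>"
    and f: "continuous_on UNIV f" "bounded (range f)"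
  shows "(\<integral>x. f (x \<circ> \<pi>) \<partial>\<nu>) = (\<integral>x. f x \<partial>\<nu>)"
proof -
  let ?\<Lambda> = "PiM {..<n} (\<lambda>_. lborel :: real measure)"
  let ?U = "\<lambda>e. uniform_measure ?\<Lambda> (shell n b e)"
  have conv: "((\<lambda>e. \<integral>x. g x \<partial>?U e) \<longlongrightarrow> (\<integral>x. g x \<partial>\<nu>)) (at_right 0)"
    if "continuous_on UNIV g" "bounded (range g)" for g :: "(nat \<Rightarrow> real) \<Rightarrow> real"
    using \<nu> that unfolding is_uniform_on_K_def converges_weakly_def by blast
  have "continuous_on UNIV (\<lambda>x::nat \<Rightarrow> real. x \<circ> \<pi>)"
    by (rule continuous_on_coordinatewise_then_product) (auto simp: comp_def intro: continuous_on_product_coordinates)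
  from continuous_on_compose2[OF f(1) this] have "continuous_on UNIV (\<lambda>x. f (x \<circ> \<pi>))" by simp
  moreover have "bounded (range (\<lambda>x. f (x \<circ> \<pi>)))" by (rule bounded_subset[OF f(2)]) auto
  ultimately have c1: "((\<lambda>e. \<integral>x. f (x \<circ> \<pi>) \<partial>?U e) \<longlongrightarrow> (\<integral>x. f (x \<circ> \<pi>) \<partial>\<nu>)) (at_right 0)"
    by (rule conv)
  have "(\<integral>x. f (x \<circ> \<pi>) \<partial>?U e) = (\<integral>x. f x \<partial>?U e)" for e
  proof -
    have "f \<in> borel_measurable ?\<Lambda>"
      using measurable_continuous_PiM[OF f(1), of n] by (simp add: sets_PiM_lborel cong: measurable_cong_sets)
    moreover have "(\<lambda>x. x \<circ> \<pi>) \<in> measurable (?U e) ?\<Lambda>"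
      using distr_PiM_involution(2)[OF \<pi>] by (simp cong: measurable_cong_sets)
    ultimately have "(\<integral>x. f x \<partial>distr (?U e) ?\<Lambda> (\<lambda>x. x \<circ> \<pi>)) = (\<integral>x. f (x \<circ> \<pi>) \<partial>?U e)"
      by (intro integral_distr)
    then show ?thesis by (simp add: uniform_shell_involution[OF \<pi>])
  qed
  with c1 have "((\<lambda>e. \<integral>x. f x \<partial>?U e) \<longlongrightarrow> (\<integral>x. f (x \<circ> \<pi>) \<partial>\<nu>)) (at_right 0)" by simp
  from tendsto_unique[OF _ this conv[OF f]] show ?thesis by simp
qed

text \<open>
  Exchanging the block at \<open>c\<close> with the first one is an involution of the coordinates, since the two
  are disjoint.
\<close>
lemma uniform_on_K_block:
  fixes f :: "(nat \<Rightarrow> real) \<Rightarrow> real"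
  assumes \<nu>: "is_uniform_on_K n b \<nu>" and f: "continuous_on UNIV f" "bounded (range f)"
    and c: "k \<le> c" "c + k \<le> n"
  shows "(\<integral>x. f (block c k x) \<partial>\<nu>) = (\<integral>x. f (block 0 k x) \<partial>\<nu>)"
proof -
  define \<pi> where "\<pi> = (\<lambda>i. if i < k then i + c else if c \<le> i \<and> i < c + k then i - c else i)"
  have \<pi>: "involution_on n \<pi>" unfolding involution_on_def \<pi>_def using c by auto
  have "block c k x = block 0 k (x \<circ> \<pi>)" for x
    by (auto simp: block_def \<pi>_def fun_eq_iff add.commute)
  moreover have "bounded (range (\<lambda>x. f (block 0 k x)))" by (rule bounded_subset[OF f(2)]) auto
  ultimately show ?thesis
    using uniform_on_K_involution[OF \<nu> \<pi> continuous_on_block[OF f(1)], of 0 k] by simp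
qed

section \<open>Estimates for the uniform distribution\<close>

text \<open>
  A continuous substitute for the indicator of \<open>{L..}\<close>: weak convergence only sees continuous
  functions.
\<close>
definition ramp :: "real \<Rightarrow> real \<Rightarrow> real" where
  "ramp L t = min 1 (max 0 (2 * t / L - 1))"

lemma ramp_bounds: "0 \<le> ramp L t" "ramp L t \<le> 1"
  by (auto simp: ramp_def)

lemma ramp_eq_1: "L > 0 \<Longrightarrow> t \<ge> L \<Longrightarrow> ramp L t = 1"
proof -
  assume "L > 0" "t \<ge> L"
  then have "2 * t / L \<ge> 2" by (simp add: le_divide_eq)
  then show ?thesis by (simp add: ramp_def)
qed

lemma ramp_le_indicator: "L > 0 \<Longrightarrow> ramp L t \<le> indicator {L / 2<..} t"
proof (cases "t > L / 2")
  case False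
  assume "L > 0"
  with False have "2 * t / L \<le> 1" by (simp add: divide_le_eq)
  then show ?thesis using False by (simp add: ramp_def)
qed (simp add: ramp_bounds)

lemma continuous_on_ramp:
  assumes "continuous_on S f"
  shows "continuous_on S (\<lambda>x. ramp L (f x))"
proof -
  have "continuous_on S (\<lambda>x. min 1 (max 0 ((2 / L) * f x - 1)))"
    using assms by (intro continuous_intros)
  then show ?thesis by (simp add: ramp_def)
qed

lemma measurable_ramp [measurable]: "ramp L \<in> borel_measurable borel"
  unfolding ramp_def[abs_def] by measurable

context gibbs
begin

text \<open>
  For functions that ignore three coordinates, conditioning on \<open>K n b\<close> costs at most the factor
  \<open>C n\<^bsup>q\<^esup>\<close>.
\<close>
definition comparison :: "real \<Rightarrow> real \<Rightarrow> nat \<Rightarrow> bool" where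
  "comparison C q n0 \<longleftrightarrow> C > 0 \<and> n0 > 0 \<and> (\<forall>n \<nu> T g. n \<ge> n0 \<longrightarrow> is_uniform_on_K n b \<nu> \<longrightarrow> card T = 3 \<longrightarrow> T \<subseteq> {..<n} \<longrightarrow>
     continuous_on UNIV g \<longrightarrow> (\<forall>x. g x \<in> {0..1}) \<longrightarrow> ignores T g \<longrightarrow>
     (\<integral>x. g x \<partial>\<nu>) \<le> C * real n powr q * (\<integral>x. g x \<partial>G n))"

lemma comparisonD:
  assumes "comparison C q n0" "n \<ge> n0" "is_uniform_on_K n b \<nu>" "card T = 3" "T \<subseteq> {..<n}"
    "continuous_on UNIV g" "\<And>x. g x \<in> {0..1}" "ignores T g"
  shows "(\<integral>x. g x \<partial>\<nu>) \<le> C * real n powr q * (\<integral>x. g x \<partial>G n)"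
  using assms(1)[unfolded comparison_def, THEN conjunct2, THEN conjunct2, rule_format, OF assms(2-6) _ assms(8)] assms(7)
  by simp

lemma measurable_continuous_G:
  fixes g :: "(nat \<Rightarrow> real) \<Rightarrow> real"
  shows "continuous_on UNIV g \<Longrightarrow> g \<in> borel_measurable (G n)"
  using measurable_continuous_PiM[of g n] by (simp add: sets_G cong: measurable_cong_sets)

text \<open>
  Let the thickness of the shell tend to 0 in \<open>uniform_shell_comparison\<close>; for continuous \<open>g\<close> the left-hand
  side converges to the integral over \<open>K n b\<close>.
\<close>
lemma comparison_exists: obtains C q n0 where "comparison C q n0"
proof -
  obtain C q n0 where C: "C > 0" "n0 > 0" and comp: "\<And>n e T g. n \<ge> n0 \<Longrightarrow> 0 < e \<Longrightarrow> e \<le> 1 \<Longrightarrow> card T = 3 \<Longrightarrow> T \<subseteq> {..<n} \<Longrightarrow>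
    g \<in> borel_measurable (PiM {..<n} (\<lambda>_. borel)) \<Longrightarrow> ignores T g \<Longrightarrow>
    (\<integral>\<^sup>+x. g x \<partial>uniform_measure (PiM {..<n} (\<lambda>_. lborel)) (shell n b e)) \<le> ennreal (C * real n powr q) * (\<integral>\<^sup>+x. g x \<partial>G n)"
    by (rule uniform_shell_comparison) blast
  have "(\<integral>x. g x \<partial>\<nu>) \<le> C * real n powr q * (\<integral>x. g x \<partial>G n)"
    if n: "n \<ge> n0" and \<nu>: "is_uniform_on_K n b \<nu>" and T: "card T = 3" "T \<subseteq> {..<n}"
      and g: "continuous_on UNIV g" "\<And>x. g x \<in> {0..1}" "ignores T g" for n \<nu> T and g :: "(nat \<Rightarrow> real) \<Rightarrow> real"
  proof -
    let ?U = "\<lambda>e. uniform_measure (PiM {..<n} (\<lambda>_. lborel :: real measure)) (shell n b e)"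
    have g0: "g x \<ge> 0" "g x \<le> 1" for x using g(2)[of x] by auto
    have gm: "g \<in> borel_measurable (PiM {..<n} (\<lambda>_. borel))" by (rule measurable_continuous_PiM) fact
    then have [measurable]: "g \<in> borel_measurable (G n)" "g \<in> borel_measurable (?U e)" for e
      by (simp_all cong: measurable_cong_sets add: sets_PiM_lborel sets_G)
    have intG: "integrable (G n) g" by (rule G.integrable_const_bound[where B=1]) (auto simp: g0)
    have dep: "ignores T (\<lambda>x. ennreal (g x))" unfolding ignores_def
    proof (intro allI impI)
      fix x y :: "nat \<Rightarrow> real" assume "\<forall>l. l \<notin> T \<longrightarrow> x l = y l"
      then have "g x = g y" by (intro ignoresD[OF g(3)]) auto
      then show "ennreal (g x) = ennreal (g y)" by simp
    qed
    have "bounded (range g)" unfolding bounded_iff using g0 by (intro exI[of _ 1]) auto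
    then have conv: "((\<lambda>e. \<integral>x. g x \<partial>?U e) \<longlongrightarrow> (\<integral>x. g x \<partial>\<nu>)) (at_right 0)"
      using \<nu> g(1) unfolding is_uniform_on_K_def converges_weakly_def by blast
    have "(\<integral>x. g x \<partial>?U e) \<le> C * real n powr q * (\<integral>x. g x \<partial>G n)" if e: "0 < e" "e \<le> 1" for e
    proof -
      have "(\<integral>\<^sup>+x. ennreal (g x) \<partial>?U e) \<le> ennreal (C * real n powr q) * (\<integral>\<^sup>+x. ennreal (g x) \<partial>G n)"
        using n e T gm dep by (intro comp) auto
      also have "(\<integral>\<^sup>+x. ennreal (g x) \<partial>G n) = ennreal (\<integral>x. g x \<partial>G n)"
        by (rule nn_integral_eq_integral[OF intG]) (simp add: g0)
      also have "ennreal (C * real n powr q) * \<dots> = ennreal (C * real n powr q * (\<integral>x. g x \<partial>G n))"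
        using C g0 by (subst ennreal_mult) (auto intro!: Bochner_Integration.integral_nonneg)
      finally have "enn2real (\<integral>\<^sup>+x. ennreal (g x) \<partial>?U e) \<le> C * real n powr q * (\<integral>x. g x \<partial>G n)"
        using C g0 by (intro enn2real_leI) (auto intro!: mult_nonneg_nonneg Bochner_Integration.integral_nonneg)
      moreover have "(\<integral>x. g x \<partial>?U e) = enn2real (\<integral>\<^sup>+x. ennreal (g x) \<partial>?U e)"
        by (rule integral_eq_nn_integral) (auto simp: g0)
      ultimately show ?thesis by simp
    qed
    then have "eventually (\<lambda>e. (\<integral>x. g x \<partial>?U e) \<le> C * real n powr q * (\<integral>x. g x \<partial>G n)) (at_right 0)"
      by (intro eventually_at_rightI[of 0 1]) auto
    from tendsto_upperbound[OF conv this] show ?thesis by simp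
  qed
  then have "comparison C q n0" unfolding comparison_def using C by (intro conjI allI impI) simp_all
  then show thesis by (rule that)
qed

lemma is_uniform_prob:
  assumes "is_uniform_on_K n b \<nu>"
  shows "prob_space \<nu>" "sets \<nu> = sets (PiM {..<n} (\<lambda>_. borel))" "AE x in \<nu>. x \<in> K n b"
  using assms unfolding is_uniform_on_K_def by auto

lemma integrable_continuous_bounded:
  fixes g :: "(nat \<Rightarrow> real) \<Rightarrow> real"
  assumes "is_uniform_on_K n b \<nu>" "continuous_on UNIV g" "\<And>x. \<bar>g x\<bar> \<le> B"
  shows "integrable \<nu> g"
proof -
  interpret prob_space \<nu> by (rule is_uniform_prob) fact
  have "g \<in> borel_measurable \<nu>"
    using measurable_continuous_PiM[OF assms(2), of n] is_uniform_prob(2)[OF assms(1)] by (simp cong: measurable_cong_sets)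
  then show ?thesis by (intro integrable_const_bound[where B=B]) (auto simp: assms(3))
qed

text \<open>
  A function of the single coordinate \<open>i\<close> leaves enough other coordinates free for the comparison.
\<close>
lemma tail_estimate:
  obtains A \<kappa> q n0 where "A > 0" "\<kappa> > 0" "\<And>n \<nu> i L. n \<ge> n0 \<Longrightarrow> is_uniform_on_K n b \<nu> \<Longrightarrow> i < n \<Longrightarrow> L > 0 \<Longrightarrow>
    (\<integral>x. ramp L (x i) \<partial>\<nu>) \<le> A * real n powr q * exp (- (r / 8) * L\<^sup>2 - \<kappa> * L)"
proof -
  obtain C q n0 where comp: "comparison C q n0" by (rule comparison_exists)
  then have C: "C > 0" unfolding comparison_def by auto
  obtain C' \<kappa> where C': "C' > 0" "\<kappa> > 0" and tail: "\<And>t. t \<ge> 0 \<Longrightarrow> measure \<mu> {t<..} \<le> C' * exp (- (r/2) * t\<^sup>2 - \<kappa> * t)"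
    by (rule \<mu>_tail) blast
  have "(\<integral>x. ramp L (x i) \<partial>\<nu>) \<le> (C * C') * real n powr q * exp (- (r / 8) * L\<^sup>2 - (\<kappa> / 2) * L)"
    if n: "n \<ge> max n0 4" and \<nu>: "is_uniform_on_K n b \<nu>" and i: "i < n" and L: "L > 0" for n \<nu> i L
  proof -
    have "card ({..<n} - {i}) = n - 1" using i by simp
    then have "card ({..<n} - {i}) \<ge> 3" using n by linarith
    then obtain T where T: "T \<subseteq> {..<n} - {i}" "card T = 3" by (meson obtain_subset_with_card_n)
    have "(\<integral>x. ramp L (x i) \<partial>\<nu>) \<le> C * real n powr q * (\<integral>x. ramp L (x i) \<partial>G n)"
    proof (rule comparisonD[OF comp _ \<nu> T(2)])
      show "continuous_on UNIV (\<lambda>x::nat \<Rightarrow> real. ramp L (x i))"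
        by (intro continuous_on_ramp continuous_on_product_coordinates)
      have "i \<notin> T" using T by auto
      then show "ignores T (\<lambda>x. ramp L (x i))" unfolding ignores_def by auto
    qed (use n T ramp_bounds in auto)
    also have "(\<integral>x. ramp L (x i) \<partial>G n) = (\<integral>z. ramp L z \<partial>\<mu>)"
      by (rule integral_coordinate[OF i]) measurable
    also have "(\<integral>z. ramp L z \<partial>\<mu>) \<le> (\<integral>z. indicator {L / 2<..} z \<partial>\<mu>)"
      by (intro integral_mono \<mu>.integrable_const_bound[where B=1]) (auto simp: ramp_bounds ramp_le_indicator[OF L])
    also have "\<dots> = measure \<mu> {L / 2<..}" by simp
    also have "\<dots> \<le> C' * exp (- (r/2) * (L/2)\<^sup>2 - \<kappa> * (L/2))" using L by (intro tail) simp
    also have "- (r/2) * (L/2)\<^sup>2 - \<kappa> * (L/2) = - (r / 8) * L\<^sup>2 - (\<kappa> / 2) * L"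
      by (simp add: power2_eq_square)
    finally show ?thesis using C by (simp add: mult_left_mono mult.assoc mult.left_commute)
  qed
  then show thesis using C C' by (intro that[of "C * C'" "\<kappa> / 2" "max n0 4"]) auto
qed

text \<open>
  By exchangeability, \<open>f\<close> of the first block may be replaced by the average of \<open>f\<close> over \<open>N\<close> disjoint
  blocks. Its deviation from the limit is at most \<open>\<eta>\<close>, or else at most \<open>2 B\<close>; the second case is
  estimated by comparison with \<open>G n\<close> and Hoeffding's inequality. The blocks start at \<open>3 + k\<close>, which leaves
  the coordinates 0, 1, 2 free and is disjoint from the first block.
\<close>
lemma block_average_estimate:
  fixes f :: "(nat \<Rightarrow> real) \<Rightarrow> real"
  assumes comp: "comparison C q n0" and n: "n \<ge> n0" and \<nu>: "is_uniform_on_K n b \<nu>"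
    and f: "continuous_on UNIV f" and B: "\<And>x. \<bar>f x\<bar> \<le> B" "B > 0"
    and N: "3 + k + k * N \<le> n" "N > 0" and \<eta>: "\<eta> > 0"
  shows "\<bar>(\<integral>x. f (block 0 k x) \<partial>\<nu>) - (\<integral>x. f x \<partial>G k)\<bar> \<le> \<eta> + 4 * B * C * real n powr q * exp (- (real N * \<eta>\<^sup>2 / (8 * B\<^sup>2)))"
proof -
  let ?m = "\<integral>x. f x \<partial>G k"
  have C: "C > 0" using comp unfolding comparison_def by auto
  interpret \<nu>: prob_space \<nu> by (rule is_uniform_prob[OF \<nu>])
  define avg where "avg = (\<lambda>x. (\<Sum>j<N. f (block (3 + k + k * j) k x)) / real N)"
  \<comment> \<open>Equal to 1 if the average is off by \<open>\<eta>\<close> or more, and 0 if it is off by at most \<open>\<eta> / 2\<close>.\<close>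
  define \<psi> where "\<psi> = (\<lambda>x. ramp \<eta> \<bar>avg x - ?m\<bar>)"
  have le: "3 + k + k * j + k \<le> n" if "j < N" for j
  proof -
    have "k * (j + 1) \<le> k * N" using that by (intro mult_left_mono) auto
    then show ?thesis using N by simp
  qed
  have fm: "f \<in> borel_measurable (PiM {..<k} (\<lambda>_. borel))" by (rule measurable_continuous_PiM[OF f])
  have fk: "integrable (G k) f"
    using B measurable_continuous_G[OF f] by (intro G.integrable_const_bound[where B=B]) auto
  have mB: "\<bar>?m\<bar> \<le> B"
  proof -
    have "\<bar>?m\<bar> \<le> (\<integral>x. \<bar>f x\<bar> \<partial>G k)" by (rule integral_abs_bound)
    also have "\<dots> \<le> (\<integral>x. B \<partial>G k)" using fk B by (intro integral_mono) auto
    finally show ?thesis by (simp add: G.prob_space)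
  qed
  have avgB: "\<bar>avg x\<bar> \<le> B" for x
  proof -
    have "\<bar>\<Sum>j<N. f (block (3 + k + k * j) k x)\<bar> \<le> (\<Sum>j<N. B)" by (rule order_trans[OF sum_abs sum_mono]) (rule B)
    then show ?thesis using N by (simp add: avg_def field_simps)
  qed
  have avg_cont: "continuous_on UNIV avg"
    unfolding avg_def using N by (intro continuous_on_divide continuous_on_sum continuous_on_block[OF f] continuous_on_const) auto
  have \<psi>_cont: "continuous_on UNIV \<psi>"
    unfolding \<psi>_def by (intro continuous_on_ramp continuous_intros avg_cont)
  have avg_int: "integrable \<nu> avg" by (rule integrable_continuous_bounded[OF \<nu> avg_cont avgB])
  have \<psi>_int: "integrable \<nu> \<psi>"
    by (rule integrable_continuous_bounded[OF \<nu> \<psi>_cont, of 1]) (simp add: \<psi>_def ramp_bounds)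
  have "(\<integral>x. avg x \<partial>\<nu>) = (\<Sum>j<N. \<integral>x. f (block (3 + k + k * j) k x) \<partial>\<nu>) / real N"
    unfolding avg_def using integrable_continuous_bounded[OF \<nu> continuous_on_block[OF f] B(1)]
    by (simp add: Bochner_Integration.integral_sum)
  also have "\<dots> = (\<Sum>j<N. \<integral>x. f (block 0 k x) \<partial>\<nu>) / real N"
  proof -
    have "bounded (range f)" unfolding bounded_iff using B by (intro exI[of _ B]) auto
    then show ?thesis using le by (intro arg_cong[where f="\<lambda>t. t / real N"] sum.cong uniform_on_K_block[OF \<nu> f]) auto
  qed
  also have "\<dots> = (\<integral>x. f (block 0 k x) \<partial>\<nu>)" using N by simp
  finally have avg_eq: "(\<integral>x. avg x \<partial>\<nu>) = (\<integral>x. f (block 0 k x) \<partial>\<nu>)" .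
  have "\<bar>(\<integral>x. avg x \<partial>\<nu>) - ?m\<bar> = \<bar>\<integral>x. avg x - ?m \<partial>\<nu>\<bar>"
    using avg_int by (subst Bochner_Integration.integral_diff) (auto simp: \<nu>.prob_space)
  also have "\<dots> \<le> (\<integral>x. \<bar>avg x - ?m\<bar> \<partial>\<nu>)" by (rule integral_abs_bound)
  also have "\<dots> \<le> (\<integral>x. \<eta> + 2 * B * \<psi> x \<partial>\<nu>)"
  proof (rule integral_mono)
    fix x
    show "\<bar>avg x - ?m\<bar> \<le> \<eta> + 2 * B * \<psi> x"
    proof (cases "\<bar>avg x - ?m\<bar> \<le> \<eta>")
      case True
      have "0 \<le> 2 * B * \<psi> x" using B(2) by (simp add: \<psi>_def ramp_bounds)
      with True show ?thesis by linarith
    next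
      case False
      then have "\<psi> x = 1" unfolding \<psi>_def using \<eta> by (intro ramp_eq_1) auto
      then show ?thesis using avgB[of x] mB \<eta> by (auto simp: abs_le_iff)
    qed
  qed (use avg_int \<psi>_int in auto)
  also have "\<dots> = \<eta> + 2 * B * (\<integral>x. \<psi> x \<partial>\<nu>)"
    using \<psi>_int by (simp add: \<nu>.prob_space)
  finally have main: "\<bar>(\<integral>x. avg x \<partial>\<nu>) - ?m\<bar> \<le> \<eta> + 2 * B * (\<integral>x. \<psi> x \<partial>\<nu>)" .
  have "(\<integral>x. \<psi> x \<partial>\<nu>) \<le> C * real n powr q * (\<integral>x. \<psi> x \<partial>G n)"
  proof (rule comparisonD[OF comp n \<nu> _ _ \<psi>_cont])
    show "\<psi> x \<in> {0..1}" for x by (simp add: \<psi>_def ramp_bounds)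
    show "card {0, 1, 2 :: nat} = 3" "{0, 1, 2} \<subseteq> {..<n}" using N by auto
    show "ignores {0, 1, 2} \<psi>"
      unfolding ignores_def
    proof (intro allI impI)
      fix x y :: "nat \<Rightarrow> real" assume *: "\<forall>l. l \<notin> {0, 1, 2} \<longrightarrow> x l = y l"
      have "f (block (3 + k + k * j) k x) = f (block (3 + k + k * j) k y)" for j
        by (rule ignoresD[OF ignores_block[of "{0, 1, 2}"]]) (use * in auto)
      then show "\<psi> x = \<psi> y" by (simp add: \<psi>_def avg_def)
    qed
  qed
  also have "\<dots> \<le> C * real n powr q * (2 * exp (- (real N * \<eta>\<^sup>2 / (8 * B\<^sup>2))))"
  proof (rule mult_left_mono)
    have [measurable]: "avg \<in> borel_measurable (G n)" "\<psi> \<in> borel_measurable (G n)"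
      using avg_cont \<psi>_cont by (auto intro: measurable_continuous_G)
    let ?E = "{x \<in> space (G n). \<bar>(\<Sum>j<N. f (block (3 + k + k * j) k x)) - real N * ?m\<bar> \<ge> real N * \<eta> / 2}"
    have E: "?E = {x \<in> space (G n). \<bar>avg x - ?m\<bar> \<ge> \<eta> / 2}"
    proof -
      have "\<bar>(\<Sum>j<N. f (block (3 + k + k * j) k x)) - real N * ?m\<bar> = real N * \<bar>avg x - ?m\<bar>" for x
      proof -
        have "(\<Sum>j<N. f (block (3 + k + k * j) k x)) - real N * ?m = real N * (avg x - ?m)"
          using N by (simp add: avg_def algebra_simps)
        then show ?thesis by (simp add: abs_mult)
      qed
      then show ?thesis using N by (simp add: field_simps)
    qed
    have "(\<integral>x. \<psi> x \<partial>G n) \<le> (\<integral>x. indicator ?E x \<partial>G n)"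
    proof (rule integral_mono)
      show "integrable (G n) \<psi>"
        by (rule G.integrable_const_bound[where B=1]) (auto simp: \<psi>_def ramp_bounds)
      show "integrable (G n) (indicator ?E :: _ \<Rightarrow> real)" unfolding E
        by (rule G.integrable_const_bound[where B=1]) auto
      fix x assume "x \<in> space (G n)"
      then show "\<psi> x \<le> indicator ?E x"
        using ramp_le_indicator[OF \<eta>, of "\<bar>avg x - ?m\<bar>"] unfolding E \<psi>_def by (auto simp: indicator_def ramp_bounds split: if_splits)
    qed
    also have "\<dots> = measure (G n) (?E \<inter> space (G n))" by (rule Bochner_Integration.integral_indicator)
    also have "?E \<inter> space (G n) = ?E" by blast
    also have "measure (G n) ?E \<le> 2 * exp (- 2 * (real N * \<eta> / 2)\<^sup>2 / (real N * (B - (- B))\<^sup>2))"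
      using N B \<eta> by (intro block_Hoeffding fm) (auto simp: abs_le_iff minus_le_iff)
    also have "- 2 * (real N * \<eta> / 2)\<^sup>2 / (real N * (B - (- B))\<^sup>2) = - (real N * \<eta>\<^sup>2 / (8 * B\<^sup>2))"
      using N B by (simp add: power2_eq_square field_simps)
    finally show "(\<integral>x. \<psi> x \<partial>G n) \<le> 2 * exp (- (real N * \<eta>\<^sup>2 / (8 * B\<^sup>2)))" .
  qed (use C in simp)
  finally have "2 * B * (\<integral>x. \<psi> x \<partial>\<nu>) \<le> 2 * B * (C * real n powr q * (2 * exp (- (real N * \<eta>\<^sup>2 / (8 * B\<^sup>2)))))"
    using B(2) by (intro mult_left_mono) auto
  also have "\<dots> = 4 * B * C * real n powr q * exp (- (real N * \<eta>\<^sup>2 / (8 * B\<^sup>2)))" by simp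
  finally show ?thesis using main unfolding avg_eq by linarith
qed

end

section \<open>Convergence in law and of moments\<close>
definition clip :: "real \<Rightarrow> real \<Rightarrow> real" where "clip L t = min L (max 0 t)"

lemma clip_bounds: "L \<ge> 0 \<Longrightarrow> 0 \<le> clip L t" "clip L t \<le> L"
  by (auto simp: clip_def)

lemma clip_eq: "0 \<le> t \<Longrightarrow> t \<le> L \<Longrightarrow> clip L t = t"
  by (simp add: clip_def)

lemma clip_le: "0 \<le> t \<Longrightarrow> clip L t \<le> t"
  by (simp add: clip_def)

lemma continuous_on_clip: "continuous_on S f \<Longrightarrow> continuous_on S (\<lambda>x. clip L (f x))"
  unfolding clip_def by (intro continuous_intros)

lemma K_coordinate_bounds:
  assumes "x \<in> K n b" "i < n"
  shows "0 < x i" "x i \<le> real n"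
proof -
  have pos: "\<And>j. j < n \<Longrightarrow> 0 < x j" and sum: "(\<Sum>j<n. x j) = real n"
    using assms(1) by (auto simp: K_def PiE_iff)
  show "0 < x i" using pos assms(2) by blast
  have "x i \<le> (\<Sum>j<n. x j)"
    using assms(2) pos by (intro member_le_sum) (auto intro: less_imp_le)
  then show "x i \<le> real n" by (simp add: sum)
qed

lemma block_count:
  fixes n k :: nat
  assumes "n \<ge> 6 + 4 * k"
  defines "N \<equiv> (n - 3 - k) div (k + 1)"
  shows "3 + k + k * N \<le> n" "N > 0" "real N \<ge> real n / (2 * real (k + 1))"
proof -
  have d: "(k + 1) * N + (n - 3 - k) mod (k + 1) = n - 3 - k"
    unfolding N_def by (rule mult_div_mod_eq)
  have m: "(n - 3 - k) mod (k + 1) \<le> k" by (simp add: less_Suc_eq_le[symmetric])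
  have le: "(k + 1) * N \<le> n - 3 - k" using d by linarith
  have ge: "(k + 1) * N \<ge> n - 3 - k - k" using d m by linarith
  have "k * N \<le> (k + 1) * N" by simp
  then show "3 + k + k * N \<le> n" using le assms(1) by linarith
  have "2 * ((k + 1) * N) \<ge> n" using ge assms(1) by linarith
  then have "real n \<le> real (2 * ((k + 1) * N))" by (simp only: of_nat_le_iff)
  then show "real N \<ge> real n / (2 * real (k + 1))" by (simp add: field_simps)
  have "(k + 1) * N > 0" using ge assms(1) by linarith
  then show "N > 0" by (cases N) simp_all
qed

context gibbs
begin

text \<open>
  The functions and their bounds may grow with \<open>n\<close>, as long as the exponential term beats every power
  of \<open>n\<close>. This covers both fixed bounded functions and truncated monomials.
\<close>
lemma block_limit:
  fixes F :: "nat \<Rightarrow> (nat \<Rightarrow> real) \<Rightarrow> real"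
  assumes \<nu>: "\<And>n. real n > b \<Longrightarrow> is_uniform_on_K n b (\<nu> n)"
    and F: "\<And>n. continuous_on UNIV (F n)" and B: "\<And>n x. \<bar>F n x\<bar> \<le> B n" "\<And>n. B n > 0"
    and lim: "(\<lambda>n. \<integral>x. F n x \<partial>G k) \<longlonglongrightarrow> m"
    and small: "\<And>q \<eta>. \<eta> > 0 \<Longrightarrow> (\<lambda>n. B n * real n powr q * exp (- (\<eta> * real n / (B n)\<^sup>2))) \<longlonglongrightarrow> 0"
  shows "(\<lambda>n. \<integral>x. F n (block 0 k x) \<partial>\<nu> n) \<longlonglongrightarrow> m"
proof -
  obtain C q n0 where comp: "comparison C q n0" by (rule comparison_exists)
  have "(\<lambda>n. (\<integral>x. F n (block 0 k x) \<partial>\<nu> n) - (\<integral>x. F n x \<partial>G k)) \<longlonglongrightarrow> 0"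
  proof (rule tendstoI)
    fix \<epsilon> :: real assume \<epsilon>: "\<epsilon> > 0"
    define \<eta> where "\<eta> = \<epsilon> / 2"
    have \<eta>: "\<eta> > 0" using \<epsilon> by (simp add: \<eta>_def)
    define h where "h = \<eta>\<^sup>2 / (16 * real (k + 1))"
    have h: "h > 0" using \<eta> by (simp add: h_def)
    have "(\<lambda>n. 4 * C * (B n * real n powr q * exp (- (h * real n / (B n)\<^sup>2)))) \<longlonglongrightarrow> 4 * C * 0"
      by (intro tendsto_mult tendsto_const small h)
    then have "eventually (\<lambda>n. 4 * C * (B n * real n powr q * exp (- (h * real n / (B n)\<^sup>2))) < \<epsilon> / 2) sequentially"
      using \<epsilon> by (intro order_tendstoD) auto
    moreover have "eventually (\<lambda>n. real n > b) sequentially" by real_asymp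
    ultimately show "eventually (\<lambda>n. dist ((\<integral>x. F n (block 0 k x) \<partial>\<nu> n) - (\<integral>x. F n x \<partial>G k)) 0 < \<epsilon>) sequentially"
      using eventually_ge_at_top[of n0] eventually_ge_at_top[of "6 + 4 * k"]
    proof eventually_elim
      case (elim n)
      define N where "N = (n - 3 - k) div (k + 1)"
      note N = block_count[OF elim(4), folded N_def]
      have "\<bar>(\<integral>x. F n (block 0 k x) \<partial>\<nu> n) - (\<integral>x. F n x \<partial>G k)\<bar>
        \<le> \<eta> + 4 * B n * C * real n powr q * exp (- (real N * \<eta>\<^sup>2 / (8 * (B n)\<^sup>2)))"
        by (rule block_average_estimate[OF comp elim(3) \<nu>[OF elim(2)] F B N(1,2) \<eta>])
      also have "\<dots> \<le> \<eta> + 4 * B n * C * real n powr q * exp (- (h * real n / (B n)\<^sup>2))"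
      proof -
        have "h * real n / (B n)\<^sup>2 = (real n / (2 * real (k + 1))) * \<eta>\<^sup>2 / (8 * (B n)\<^sup>2)"
        proof -
          have gen: "(u / (16 * v)) * w / y = (w / (2 * v)) * u / (8 * y)" for u v w y :: real
            by (simp add: mult_ac)
          show ?thesis unfolding h_def by (rule gen)
        qed
        also have "\<dots> \<le> real N * \<eta>\<^sup>2 / (8 * (B n)\<^sup>2)"
          using N(3) by (intro divide_right_mono mult_right_mono) auto
        finally have "exp (- (real N * \<eta>\<^sup>2 / (8 * (B n)\<^sup>2))) \<le> exp (- (h * real n / (B n)\<^sup>2))" by simp
        moreover have "0 \<le> 4 * B n * C * real n powr q"
          using comp B(2)[of n] by (simp add: comparison_def)
        ultimately show ?thesis by (intro add_left_mono mult_left_mono)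
      qed
      also have "\<dots> < \<epsilon>" using elim(1) by (simp add: \<eta>_def ac_simps)
      finally show ?case by (simp add: dist_real_def)
    qed
  qed
  from tendsto_add[OF this lim] show ?thesis by simp
qed

lemma law_limit:
  fixes f :: "(nat \<Rightarrow> real) \<Rightarrow> real"
  assumes \<nu>: "\<And>n. real n > b \<Longrightarrow> is_uniform_on_K n b (\<nu> n)"
    and f: "continuous_on UNIV f" "bounded (range f)"
  shows "(\<lambda>n. \<integral>x. f (block 0 k x) \<partial>\<nu> n) \<longlonglongrightarrow> (\<integral>x. f x \<partial>G k)"
proof -
  obtain B where B: "B > 0" "\<And>x. \<bar>f x\<bar> \<le> B"
    using f(2) by (auto simp: bounded_pos)
  show ?thesis
  proof (rule block_limit[OF \<nu> f(1) B(2) B(1)])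
    fix q \<eta> :: real assume "\<eta> > 0"
    then show "(\<lambda>n. B * real n powr q * exp (- (\<eta> * real n / B\<^sup>2))) \<longlonglongrightarrow> 0"
      using B(1) by real_asymp
  qed auto
qed

lemma integrable_monomial: "integrable (G k) (\<lambda>x. \<Prod>i<k. x i ^ \<alpha> i)"
  unfolding G_def by (rule prod.product_integrable_prod) auto

text \<open>
  Coordinates are truncated at \<open>1 + (ln n)\<^sup>2\<close>. The truncated monomials are bounded by a power of \<open>ln n\<close>,
  so their means converge by \<open>block_limit\<close>. On \<open>K n b\<close> all coordinates are at most \<open>n\<close>; hence
  truncation changes the monomial by at most a power of \<open>n\<close>, and only when some coordinate exceeds
  \<open>1 + (ln n)\<^sup>2\<close>, which has superpolynomially small probability.
\<close>
lemma moment_limit: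
  fixes \<alpha> :: "nat \<Rightarrow> nat"
  assumes \<nu>: "\<And>n. real n > b \<Longrightarrow> is_uniform_on_K n b (\<nu> n)"
  shows "(\<lambda>n. \<integral>x. (\<Prod>i<k. x i ^ \<alpha> i) \<partial>\<nu> n) \<longlonglongrightarrow> (\<integral>x. (\<Prod>i<k. x i ^ \<alpha> i) \<partial>G k)"
proof -
  define a where "a = (\<Sum>i<k. \<alpha> i)"
  define L where "L = (\<lambda>n::nat. 1 + (ln (real n))\<^sup>2)"
  define F where "F = (\<lambda>n x. \<Prod>i<k. clip (L n) (x i) ^ \<alpha> i)"
  have L1: "L n \<ge> 1" for n by (simp add: L_def)
  have L0: "L n \<ge> 0" for n using L1[of n] by linarith
  have F0: "0 \<le> F n x" for n x unfolding F_def using clip_bounds(1)[OF L0] by (intro prod_nonneg) auto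
  have FB: "F n x \<le> L n ^ a" for n x
  proof -
    have "F n x \<le> (\<Prod>i<k. L n ^ \<alpha> i)"
      unfolding F_def using clip_bounds(1)[OF L0] clip_bounds(2) by (intro prod_mono) (auto intro: power_mono)
    then show ?thesis by (simp add: a_def power_sum)
  qed
  have Fcont: "continuous_on UNIV (F n)" for n
    unfolding F_def by (intro continuous_intros continuous_on_clip continuous_on_product_coordinates)
  have limG: "(\<lambda>n. \<integral>x. F n x \<partial>G k) \<longlonglongrightarrow> (\<integral>x. (\<Prod>i<k. x i ^ \<alpha> i) \<partial>G k)"
  proof (rule integral_dominated_convergence)
    show "(\<lambda>x. \<Prod>i<k. x i ^ \<alpha> i) \<in> borel_measurable (G k)" "integrable (G k) (\<lambda>x. \<Prod>i<k. x i ^ \<alpha> i)"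
      using integrable_monomial by auto
    show "F n \<in> borel_measurable (G k)" for n by (rule measurable_continuous_G[OF Fcont])
    show "AE x in G k. (\<lambda>n. F n x) \<longlonglongrightarrow> (\<Prod>i<k. x i ^ \<alpha> i)"
      using AE_G_pos
    proof eventually_elim
      case (elim x)
      have "(\<lambda>n. clip (L n) (x i)) \<longlonglongrightarrow> x i" if i: "i < k" for i
      proof (rule tendsto_eventually)
        have "eventually (\<lambda>n. x i \<le> L n) sequentially" unfolding L_def by real_asymp
        then show "eventually (\<lambda>n. clip (L n) (x i) = x i) sequentially"
          by eventually_elim (use elim i in \<open>auto intro!: clip_eq less_imp_le\<close>)
      qed
      then show ?case unfolding F_def by (intro tendsto_prod tendsto_power) auto
    qed
    show "AE x in G k. norm (F n x) \<le> (\<Prod>i<k. x i ^ \<alpha> i)" for n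
      using AE_G_pos
    proof eventually_elim
      case (elim x)
      have "F n x \<le> (\<Prod>i<k. x i ^ \<alpha> i)"
        unfolding F_def
      proof (intro prod_mono conjI)
        fix i assume "i \<in> {..<k}"
        then have "0 \<le> x i" using elim by (auto intro: less_imp_le)
        then show "clip (L n) (x i) ^ \<alpha> i \<le> x i ^ \<alpha> i"
          using clip_bounds(1)[OF L0] by (intro power_mono clip_le)
      qed (simp add: clip_bounds(1)[OF L0])
      then show ?case using F0[of n x] by simp
    qed
  qed
  have lim1: "(\<lambda>n. \<integral>x. F n (block 0 k x) \<partial>\<nu> n) \<longlonglongrightarrow> (\<integral>x. (\<Prod>i<k. x i ^ \<alpha> i) \<partial>G k)"
  \<comment> \<open>The exponent \<open>a + 1\<close> instead of \<open>a\<close> keeps it positive, as the asymptotic estimate below requires.\<close>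
  proof (rule block_limit[where B="\<lambda>n. L n ^ (a + 1)", OF \<nu> Fcont _ _ limG])
    fix n x
    have "F n x \<le> L n ^ (a + 1)"
      by (rule order_trans[OF FB]) (rule power_increasing, use L1 in auto)
    then show "\<bar>F n x\<bar> \<le> L n ^ (a + 1)" using F0[of n x] by simp
    show "0 < L n ^ (a + 1)" using L1[of n] by (intro zero_less_power) linarith
  next
    fix q \<eta> :: real assume \<eta>: "\<eta> > 0"
    define A where "A = real (a + 1)"
    have "A > 0" by (simp add: A_def)
    have "(\<lambda>n::nat. (1 + (ln (real n))\<^sup>2) powr A * real n powr q * exp (- (\<eta> * real n / ((1 + (ln (real n))\<^sup>2) powr A)\<^sup>2))) \<longlonglongrightarrow> 0"
      using \<open>A > 0\<close> \<eta> by real_asymp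
    moreover have "(1 + (ln (real n))\<^sup>2) powr A = L n ^ (a + 1)" for n
      unfolding A_def by (subst powr_realpow) (auto simp: L_def intro: add_pos_nonneg)
    ultimately show "(\<lambda>n. L n ^ (a + 1) * real n powr q * exp (- (\<eta> * real n / (L n ^ (a + 1))\<^sup>2))) \<longlonglongrightarrow> 0"
      by simp
  qed auto
  obtain A \<kappa> q n0 where A: "A > 0" "\<kappa> > 0" and tail: "\<And>n \<nu> i L. n \<ge> n0 \<Longrightarrow> is_uniform_on_K n b \<nu> \<Longrightarrow> i < n \<Longrightarrow> L > 0 \<Longrightarrow>
    (\<integral>x. ramp L (x i) \<partial>\<nu>) \<le> A * real n powr q * exp (- (r / 8) * L\<^sup>2 - \<kappa> * L)"
    by (rule tail_estimate) blast
  have "(\<lambda>n. (\<integral>x. (\<Prod>i<k. x i ^ \<alpha> i) \<partial>\<nu> n) - (\<integral>x. F n (block 0 k x) \<partial>\<nu> n)) \<longlonglongrightarrow> 0"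
  proof (rule Lim_null_comparison)
    define a' where "a' = real a"
    have "(\<lambda>n::nat. real n powr a' * (real k * (A * real n powr q * exp (- \<kappa> * (1 + (ln (real n))\<^sup>2))))) \<longlonglongrightarrow> 0"
      using A by real_asymp
    then show "(\<lambda>n. real n powr a' * (real k * (A * real n powr q * exp (- \<kappa> * L n)))) \<longlonglongrightarrow> 0"
      by (simp add: L_def)
    have "eventually (\<lambda>n. real n > b) sequentially" by real_asymp
    then show "eventually (\<lambda>n. norm ((\<integral>x. (\<Prod>i<k. x i ^ \<alpha> i) \<partial>\<nu> n) - (\<integral>x. F n (block 0 k x) \<partial>\<nu> n))
        \<le> real n powr a' * (real k * (A * real n powr q * exp (- \<kappa> * L n)))) sequentially"
      using eventually_ge_at_top[of n0] eventually_ge_at_top[of k] eventually_ge_at_top[of 1]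
    proof eventually_elim
      case (elim n)
      note un = \<nu>[OF elim(1)]
      interpret \<nu>: prob_space "\<nu> n" by (rule is_uniform_prob[OF un])
      have sets[measurable_cong]: "sets (\<nu> n) = sets (PiM {..<n} (\<lambda>_. borel))" by (rule is_uniform_prob[OF un])
      have comp: "(\<lambda>x. x i) \<in> borel_measurable (\<nu> n)" if "i < n" for i
        using that by (simp add: measurable_component_singleton cong: measurable_cong_sets)
      have mono_le: "0 \<le> (\<Prod>i<k. x i ^ \<alpha> i)" "(\<Prod>i<k. x i ^ \<alpha> i) \<le> real n ^ a" if x: "x \<in> K n b" for x
      proof -
        have xi: "0 \<le> x i" "x i \<le> real n" if "i < k" for i
          using K_coordinate_bounds[OF x, of i] that elim(3) by auto
        show "0 \<le> (\<Prod>i<k. x i ^ \<alpha> i)" using xi by (intro prod_nonneg) auto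
        have "(\<Prod>i<k. x i ^ \<alpha> i) \<le> (\<Prod>i<k. real n ^ \<alpha> i)"
          using xi by (intro prod_mono) (auto intro: power_mono)
        then show "(\<Prod>i<k. x i ^ \<alpha> i) \<le> real n ^ a" by (simp add: a_def power_sum)
      qed
      have intM: "integrable (\<nu> n) (\<lambda>x. \<Prod>i<k. x i ^ \<alpha> i)"
      proof (rule \<nu>.integrable_const_bound[where B="real n ^ a"])
        show "AE x in \<nu> n. norm (\<Prod>i<k. x i ^ \<alpha> i) \<le> real n ^ a"
          using is_uniform_prob(3)[OF un] by eventually_elim (use mono_le in auto)
        show "(\<lambda>x. \<Prod>i<k. x i ^ \<alpha> i) \<in> borel_measurable (\<nu> n)"
          using comp elim(3) by (intro borel_measurable_prod borel_measurable_power) auto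
      qed
      have intF: "integrable (\<nu> n) (\<lambda>x. F n (block 0 k x))"
        using F0 FB by (intro integrable_continuous_bounded[OF un continuous_on_block[OF Fcont], where B="L n ^ a"]) auto
      have intR: "integrable (\<nu> n) (\<lambda>x. ramp (L n) (x i))" for i
        by (intro integrable_continuous_bounded[OF un, where B=1] continuous_on_ramp continuous_on_product_coordinates)
          (simp add: ramp_bounds)
      have "norm ((\<integral>x. (\<Prod>i<k. x i ^ \<alpha> i) \<partial>\<nu> n) - (\<integral>x. F n (block 0 k x) \<partial>\<nu> n))
        = \<bar>\<integral>x. (\<Prod>i<k. x i ^ \<alpha> i) - F n (block 0 k x) \<partial>\<nu> n\<bar>"
        using intM intF by (subst Bochner_Integration.integral_diff) auto
      also have "\<dots> \<le> (\<integral>x. \<bar>(\<Prod>i<k. x i ^ \<alpha> i) - F n (block 0 k x)\<bar> \<partial>\<nu> n)"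
        by (rule integral_abs_bound)
      also have "\<dots> \<le> (\<integral>x. real n ^ a * (\<Sum>i<k. ramp (L n) (x i)) \<partial>\<nu> n)"
      proof (rule integral_mono_AE)
        show "integrable (\<nu> n) (\<lambda>x. \<bar>(\<Prod>i<k. x i ^ \<alpha> i) - F n (block 0 k x)\<bar>)"
          using intM intF by auto
        show "integrable (\<nu> n) (\<lambda>x. real n ^ a * (\<Sum>i<k. ramp (L n) (x i)))" using intR by auto
        show "AE x in \<nu> n. \<bar>(\<Prod>i<k. x i ^ \<alpha> i) - F n (block 0 k x)\<bar> \<le> real n ^ a * (\<Sum>i<k. ramp (L n) (x i))"
          using is_uniform_prob(3)[OF un]
        proof eventually_elim
          case (elim x)
          have xi: "0 \<le> x i" if "i < k" for i
            using K_coordinate_bounds(1)[OF elim, of i] that \<open>k \<le> n\<close> by auto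
          have Fb: "F n (block 0 k x) = (\<Prod>i<k. clip (L n) (x i) ^ \<alpha> i)"
            unfolding F_def block_def by (intro prod.cong) auto
          have S: "0 \<le> (\<Sum>i<k. ramp (L n) (x i))" by (intro sum_nonneg) (simp add: ramp_bounds)
          show ?case
          proof (cases "\<forall>i<k. x i \<le> L n")
            case True
            then have "F n (block 0 k x) = (\<Prod>i<k. x i ^ \<alpha> i)"
              unfolding Fb using xi by (intro prod.cong) (auto simp: clip_eq)
            then show ?thesis using S by simp
          next
            case False
            then obtain j where j: "j < k" "x j > L n" by (auto simp: not_le)
            have "1 = ramp (L n) (x j)" using j L1[of n] by (subst ramp_eq_1) auto
            also have "\<dots> \<le> (\<Sum>i<k. ramp (L n) (x i))"
              using j by (intro member_le_sum) (auto simp: ramp_bounds)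
            finally have "real n ^ a * 1 \<le> real n ^ a * (\<Sum>i<k. ramp (L n) (x i))"
              by (intro mult_left_mono) auto
            moreover have "F n (block 0 k x) \<le> (\<Prod>i<k. x i ^ \<alpha> i)"
              unfolding Fb using xi clip_bounds(1)[OF L0]
              by (intro prod_mono) (auto intro!: power_mono clip_le)
            ultimately show ?thesis using mono_le[OF elim] F0[of n "block 0 k x"] by (auto simp: abs_le_iff)
          qed
        qed
      qed
      also have "\<dots> = real n ^ a * (\<Sum>i<k. \<integral>x. ramp (L n) (x i) \<partial>\<nu> n)"
        using intR by (simp add: Bochner_Integration.integral_sum)
      also have "\<dots> \<le> real n ^ a * (\<Sum>i<k. A * real n powr q * exp (- \<kappa> * L n))"
      proof (intro mult_left_mono sum_mono)
        fix i assume "i \<in> {..<k}"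
        then have "(\<integral>x. ramp (L n) (x i) \<partial>\<nu> n) \<le> A * real n powr q * exp (- (r / 8) * (L n)\<^sup>2 - \<kappa> * L n)"
          using elim L1[of n] by (intro tail un) auto
        also have "\<dots> \<le> A * real n powr q * exp (- \<kappa> * L n)"
          using A decay by (intro mult_left_mono) auto
        finally show "(\<integral>x. ramp (L n) (x i) \<partial>\<nu> n) \<le> A * real n powr q * exp (- \<kappa> * L n)" .
      qed simp
      also have "\<dots> = real n powr a' * (real k * (A * real n powr q * exp (- \<kappa> * L n)))"
        using elim(4) by (simp add: a'_def powr_realpow)
      finally show ?case .
    qed
  qed
  from tendsto_add[OF this lim1] show ?thesis by simp
qed

end

section \<open>Random vectors and the maximum\<close>
lemma integral_joint_law:
  fixes h :: "(nat \<Rightarrow> real) \<Rightarrow> real"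
  assumes "\<And>i. i < k \<Longrightarrow> Y i \<in> borel_measurable M" "h \<in> borel_measurable (PiM {..<k} (\<lambda>_. borel))"
  shows "(\<integral>x. h x \<partial>joint_law M k Y) = (\<integral>\<omega>. h (\<lambda>i\<in>{..<k}. Y i \<omega>) \<partial>M)"
  unfolding joint_law_def using assms by (intro integral_distr measurable_restrict) auto

lemma integral_joint_law_block:
  fixes f :: "(nat \<Rightarrow> real) \<Rightarrow> real"
  assumes "\<And>i. i < n \<Longrightarrow> Y i \<in> borel_measurable M" "k \<le> n" "continuous_on UNIV f"
  shows "(\<integral>x. f x \<partial>joint_law M k Y) = (\<integral>x. f (block 0 k x) \<partial>joint_law M n Y)"
proof -
  have "(\<integral>x. f (block 0 k x) \<partial>joint_law M n Y) = (\<integral>\<omega>. f (block 0 k (\<lambda>i\<in>{..<n}. Y i \<omega>)) \<partial>M)"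
    using assms by (intro integral_joint_law measurable_continuous_PiM continuous_on_block) auto
  also have "(\<lambda>\<omega>. f (block 0 k (\<lambda>i\<in>{..<n}. Y i \<omega>))) = (\<lambda>\<omega>. f (\<lambda>i\<in>{..<k}. Y i \<omega>))"
    using assms(2) by (intro ext arg_cong[where f=f]) (auto simp: block_def)
  also have "(\<integral>\<omega>. f (\<lambda>i\<in>{..<k}. Y i \<omega>) \<partial>M) = (\<integral>x. f x \<partial>joint_law M k Y)"
    using assms by (intro integral_joint_law[symmetric] measurable_continuous_PiM) auto
  finally show ?thesis ..
qed

lemma uniform_vectorsD:
  assumes "uniform_vectors b P X" "real n > b"
  shows "prob_space (P n)" "\<And>i. i < n \<Longrightarrow> X n i \<in> borel_measurable (P n)"
    "is_uniform_on_K n b (joint_law (P n) n (X n))"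
  using assms unfolding uniform_vectors_def uniform_vector_on_K_def by auto

lemma monomial_joint_law:
  fixes \<alpha> :: "nat \<Rightarrow> nat"
  assumes "\<And>i. i < n \<Longrightarrow> Y i \<in> borel_measurable M" "k \<le> n"
  shows "(\<integral>x. (\<Prod>i<k. x i ^ \<alpha> i) \<partial>joint_law M n Y) = (\<integral>\<omega>. (\<Prod>i<k. Y i \<omega> ^ \<alpha> i) \<partial>M)"
proof -
  have "(\<lambda>x. \<Prod>i<k. x i ^ \<alpha> i) \<in> borel_measurable (PiM {..<n} (\<lambda>_. borel :: real measure))"
    using assms(2) by (intro borel_measurable_prod borel_measurable_power measurable_component_singleton) auto
  then have "(\<integral>x. (\<Prod>i<k. x i ^ \<alpha> i) \<partial>joint_law M n Y) = (\<integral>\<omega>. (\<Prod>i<k. (\<lambda>i\<in>{..<n}. Y i \<omega>) i ^ \<alpha> i) \<partial>M)"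
    using assms(1) by (intro integral_joint_law) auto
  also have "\<dots> = (\<integral>\<omega>. (\<Prod>i<k. Y i \<omega> ^ \<alpha> i) \<partial>M)"
    using assms(2) by (intro Bochner_Integration.integral_cong prod.cong) auto
  finally show ?thesis .
qed

lemma integrable_monomial_uniform:
  fixes \<alpha> :: "nat \<Rightarrow> nat"
  assumes "uniform_vectors b P X" "real n > b" "k \<le> n"
  shows "integrable (P n) (\<lambda>\<omega>. \<Prod>i<k. X n i \<omega> ^ \<alpha> i)"
proof -
  note U = uniform_vectorsD[OF assms(1,2)]
  interpret prob_space "P n" by (rule U)
  have m: "(\<lambda>\<omega>. \<lambda>i\<in>{..<n}. X n i \<omega>) \<in> measurable (P n) (PiM {..<n} (\<lambda>_. borel))"
    using U(2) by (intro measurable_restrict) auto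
  have "AE x in joint_law (P n) n (X n). x \<in> K n b" using U(3) unfolding is_uniform_on_K_def by blast
  from AE_distrD[OF m this[unfolded joint_law_def]]
  have "AE \<omega> in P n. (\<lambda>i\<in>{..<n}. X n i \<omega>) \<in> K n b" .
  then have "AE \<omega> in P n. norm (\<Prod>i<k. X n i \<omega> ^ \<alpha> i) \<le> (\<Prod>i<k. real n ^ \<alpha> i)"
  proof eventually_elim
    case (elim \<omega>)
    have "0 \<le> X n i \<omega>" "X n i \<omega> \<le> real n" if "i < k" for i
      using K_coordinate_bounds[OF elim, of i] that assms(3) by auto
    then show ?case unfolding prod_norm[symmetric]
      by (intro prod_mono) (auto intro!: power_mono simp: power_abs)
  qed
  moreover have "(\<lambda>\<omega>. \<Prod>i<k. X n i \<omega> ^ \<alpha> i) \<in> borel_measurable (P n)"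
    using U(2) assms(3) by (intro borel_measurable_prod borel_measurable_power) auto
  ultimately show ?thesis by (rule integrable_const_bound)
qed

context gibbs
begin

lemma joint_law_iid:
  assumes "iid_with_density Q Z p"
  shows "joint_law Q k Z = G k"
proof -
  interpret Q: prob_space Q using assms by (simp add: iid_with_density_def)
  have ind: "Q.indep_vars (\<lambda>_. borel) Z UNIV" and dist: "distributed Q lborel (Z i) (\<lambda>x. ennreal (p x))" for i
    using assms by (auto simp: iid_with_density_def)
  have rv: "Z i \<in> borel_measurable Q" for i
    using distributed_measurable[OF dist[of i]] by simp
  have \<mu>: "distr Q borel (Z i) = \<mu>" for i
  proof -
    have "distr Q borel (Z i) = distr Q lborel (Z i)" by (rule distr_cong) auto
    then show ?thesis using distributed_distr_eq_density[OF dist[of i]] by (simp add: \<mu>_def)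
  qed
  show ?thesis
  proof (cases "k = 0")
    case True
    have m: "(\<lambda>\<omega>. \<lambda>i\<in>{}. Z i \<omega>) \<in> measurable Q (PiM {} (\<lambda>_. borel))" by (rule measurable_restrict) simp
    interpret J: prob_space "joint_law Q 0 Z"
      unfolding joint_law_def lessThan_0 using m by (rule Q.prob_space_distr)
    have "joint_law Q 0 Z = PiM {} (\<lambda>_. \<mu>)"
    proof (rule prod.PiM_eqI)
      show "sets (joint_law Q 0 Z) = sets (PiM {} (\<lambda>_. \<mu>))"
        unfolding joint_law_def by (simp, intro sets_PiM_cong) auto
      fix A :: "nat \<Rightarrow> real set"
      have "space (joint_law Q 0 Z) = PiE {} A" by (simp add: joint_law_def space_PiM)
      then show "emeasure (joint_law Q 0 Z) (PiE {} A) = (\<Prod>i\<in>{}. emeasure \<mu> (A i))"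
        using J.emeasure_space_1 by simp
    qed simp
    then show ?thesis using True by (simp add: G_def)
  next
    case False
    have "Q.indep_vars (\<lambda>_. borel) Z {..<k}" using ind by (rule Q.indep_vars_subset) simp
    then have "distr Q (PiM {..<k} (\<lambda>_. borel)) (\<lambda>x. \<lambda>i\<in>{..<k}. Z i x) = PiM {..<k} (\<lambda>i. distr Q borel (Z i))"
      using False rv by (subst (asm) Q.indep_vars_iff_distr_eq_PiM') auto
    then show ?thesis by (simp add: joint_law_def \<mu> G_def)
  qed
qed

lemma iid_measurable:
  assumes "iid_with_density Q Z p"
  shows "Z i \<in> borel_measurable Q"
  using assms distributed_measurable[of Q lborel "Z i"] by (auto simp: iid_with_density_def)

lemma converges_weakly_iid:
  assumes X: "uniform_vectors b P X" and Z: "iid_with_density Q Z p"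
  shows "converges_weakly (\<lambda>n. joint_law (P n) k (X n)) (joint_law Q k Z) sequentially"
  unfolding converges_weakly_def
proof (intro allI impI, elim conjE)
  fix f :: "(nat \<Rightarrow> real) \<Rightarrow> real" assume f: "continuous_on UNIV f" "bounded (range f)"
  have "(\<lambda>n. \<integral>x. f (block 0 k x) \<partial>joint_law (P n) n (X n)) \<longlonglongrightarrow> (\<integral>x. f x \<partial>G k)"
    by (rule law_limit[OF uniform_vectorsD(3)[OF X] f])
  moreover have "eventually (\<lambda>n. (\<integral>x. f (block 0 k x) \<partial>joint_law (P n) n (X n)) = integral\<^sup>L (joint_law (P n) k (X n)) f) sequentially"
  proof -
    have "eventually (\<lambda>n. real n > b) sequentially" by real_asymp
    then show ?thesis using eventually_ge_at_top[of k]
      by eventually_elim (rule integral_joint_law_block[OF uniform_vectorsD(2)[OF X] _ f(1), symmetric])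
  qed
  ultimately show "(\<lambda>n. integral\<^sup>L (joint_law (P n) k (X n)) f) \<longlonglongrightarrow> integral\<^sup>L (joint_law Q k Z) f"
    unfolding joint_law_iid[OF Z] by (rule Lim_transform_eventually)
qed

lemma integrable_monomial_iid:
  assumes Z: "iid_with_density Q Z p"
  shows "integrable Q (\<lambda>\<omega>. \<Prod>i<k. Z i \<omega> ^ \<alpha> i)"
proof -
  have "integrable (joint_law Q k Z) (\<lambda>x. \<Prod>i<k. x i ^ \<alpha> i)"
    unfolding joint_law_iid[OF Z] by (rule integrable_monomial)
  moreover have "(\<lambda>\<omega>. \<lambda>i\<in>{..<k}. Z i \<omega>) \<in> measurable Q (PiM {..<k} (\<lambda>_. borel))"
    using iid_measurable[OF Z] by (intro measurable_restrict)
  ultimately have "integrable Q (\<lambda>\<omega>. \<Prod>i<k. (\<lambda>i\<in>{..<k}. Z i \<omega>) i ^ \<alpha> i)"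
    unfolding joint_law_def by (rule integrable_distr[rotated])
  moreover have "(\<Prod>i<k. (\<lambda>i\<in>{..<k}. Z i \<omega>) i ^ \<alpha> i) = (\<Prod>i<k. Z i \<omega> ^ \<alpha> i)" for \<omega>
    by (rule prod.cong) auto
  ultimately show ?thesis by simp
qed

lemma moments_converge:
  assumes X: "uniform_vectors b P X" and Z: "iid_with_density Q Z p"
  shows "(\<lambda>n. LINT \<omega>|P n. (\<Prod>i<k. X n i \<omega> ^ \<alpha> i)) \<longlonglongrightarrow> (LINT \<omega>|Q. (\<Prod>i<k. Z i \<omega> ^ \<alpha> i))"
proof -
  have lim: "(\<lambda>n. \<integral>x. (\<Prod>i<k. x i ^ \<alpha> i) \<partial>joint_law (P n) n (X n)) \<longlonglongrightarrow> (\<integral>x. (\<Prod>i<k. x i ^ \<alpha> i) \<partial>G k)"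
    by (rule moment_limit[OF uniform_vectorsD(3)[OF X]])
  have eq: "eventually (\<lambda>n. (\<integral>x. (\<Prod>i<k. x i ^ \<alpha> i) \<partial>joint_law (P n) n (X n)) = (LINT \<omega>|P n. (\<Prod>i<k. X n i \<omega> ^ \<alpha> i))) sequentially"
  proof -
    have "eventually (\<lambda>n. real n > b) sequentially" by real_asymp
    then show ?thesis using eventually_ge_at_top[of k]
      by eventually_elim (rule monomial_joint_law[OF uniform_vectorsD(2)[OF X]])
  qed
  have "(\<integral>x. (\<Prod>i<k. x i ^ \<alpha> i) \<partial>G k) = (LINT \<omega>|Q. (\<Prod>i<k. Z i \<omega> ^ \<alpha> i))"
    using monomial_joint_law[where Y=Z and M=Q and n=k and k=k and \<alpha>=\<alpha>, OF iid_measurable[OF Z]] by (simp add: joint_law_iid[OF Z])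
  with Lim_transform_eventually[OF lim eq] show ?thesis by simp
qed

text \<open>
  Union bound, with a continuous majorant of the indicator of \<open>{L<..}\<close>.
\<close>
lemma max_tail:
  assumes X: "uniform_vectors b P X" and n: "real n > b" "n > 0" and L: "L > 0"
    and tail: "\<And>i. i < n \<Longrightarrow> (\<integral>x. ramp L (x i) \<partial>joint_law (P n) n (X n)) \<le> t"
  shows "measure (P n) {\<omega> \<in> space (P n). (MAX i\<in>{..<n}. X n i \<omega>) > L} \<le> real n * t"
proof -
  note U = uniform_vectorsD[OF X n(1)]
  interpret prob_space "P n" by (rule U)
  let ?E = "{\<omega> \<in> space (P n). (MAX i\<in>{..<n}. X n i \<omega>) > L}"
  have "(MAX i\<in>{..<n}. X n i \<omega>) > L \<longleftrightarrow> (\<exists>i\<in>{..<n}. X n i \<omega> > L)" for \<omega>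
    using n(2) by (subst Max_gr_iff) auto
  then have E: "?E = {\<omega> \<in> space (P n). \<exists>i\<in>{..<n}. X n i \<omega> > L}" by simp
  have Em: "?E \<in> sets (P n)"
    unfolding E by (intro sets.sets_Collect_finite_Ex) (use U(2) in \<open>auto intro: borel_measurable_less\<close>)
  have ir: "integrable (P n) (\<lambda>\<omega>. ramp L (X n i \<omega>))" if "i < n" for i
    using measurable_compose[OF U(2)[OF that] measurable_ramp]
    by (intro integrable_const_bound[where B=1]) (auto simp: ramp_bounds)
  have "measure (P n) ?E = (\<integral>\<omega>. indicator ?E \<omega> \<partial>P n)"
    using Em sets.sets_into_space by (simp add: Int_absorb2)
  also have "\<dots> \<le> (\<integral>\<omega>. (\<Sum>i<n. ramp L (X n i \<omega>)) \<partial>P n)"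
  proof (rule integral_mono)
    show "integrable (P n) (indicator ?E :: _ \<Rightarrow> real)"
      using Em by (intro integrable_const_bound[where B=1]) (auto simp: indicator_def)
    show "integrable (P n) (\<lambda>\<omega>. \<Sum>i<n. ramp L (X n i \<omega>))" using ir by auto
    fix \<omega>
    show "indicator ?E \<omega> \<le> (\<Sum>i<n. ramp L (X n i \<omega>))"
    proof (cases "\<omega> \<in> ?E")
      case True
      then obtain j where j: "j < n" "X n j \<omega> > L" unfolding E by auto
      have "1 = ramp L (X n j \<omega>)" using j L by (subst ramp_eq_1) auto
      also have "\<dots> \<le> (\<Sum>i<n. ramp L (X n i \<omega>))"
        using j by (intro member_le_sum) (auto simp: ramp_bounds)
      finally show ?thesis using True by simp
    next
      case False
      have "0 \<le> (\<Sum>i<n. ramp L (X n i \<omega>))" by (intro sum_nonneg) (simp add: ramp_bounds)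
      then show ?thesis by (simp only: indicator_simps(2)[OF False])
    qed
  qed
  also have "\<dots> = (\<Sum>i<n. \<integral>\<omega>. ramp L (X n i \<omega>) \<partial>P n)"
    using ir by (intro Bochner_Integration.integral_sum) auto
  also have "\<dots> = (\<Sum>i<n. \<integral>x. ramp L (x i) \<partial>joint_law (P n) n (X n))"
  proof (intro sum.cong refl)
    fix i assume "i \<in> {..<n}"
    then show "(\<integral>\<omega>. ramp L (X n i \<omega>) \<partial>P n) = (\<integral>x. ramp L (x i) \<partial>joint_law (P n) n (X n))"
      using U(2) by (subst integral_joint_law)
        (auto intro!: measurable_compose[OF _ measurable_ramp] measurable_component_singleton)
  qed
  also have "\<dots> \<le> (\<Sum>i<n. t)" using tail by (intro sum_mono) auto
  finally show ?thesis by simp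
qed

text \<open>
  The union bound is \<open>n\<close> times a power \<open>n\<^bsup>q\<^esup>\<close> times the tail of one coordinate, so a threshold works as soon as the
  tail is at most \<open>n\<^bsup>- q - 2\<^esup>\<close>. The Gaussian part of the tail achieves this at a multiple of \<open>\<surd>(ln n)\<close>, the
  exponential part at a multiple of \<open>ln n\<close>.
\<close>
lemma maximum_bounds:
  shows maximum_sqrt_log: "r > 0 \<Longrightarrow> \<exists>C :: real. \<forall>(P :: nat \<Rightarrow> 'p measure) X. uniform_vectors b P X \<longrightarrow>
      (\<lambda>n. measure (P n) {\<omega> \<in> space (P n). (MAX i\<in>{..<n}. X n i \<omega>) > C * sqrt (ln (real n))}) \<longlonglongrightarrow> 0"
    and maximum_log: "\<exists>C :: real. \<forall>(P :: nat \<Rightarrow> 'p measure) X. uniform_vectors b P X \<longrightarrow>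
      (\<lambda>n. measure (P n) {\<omega> \<in> space (P n). (MAX i\<in>{..<n}. X n i \<omega>) > C * ln (real n)}) \<longlonglongrightarrow> 0"
proof -
  obtain A \<kappa> q n0 where A: "A > 0" "\<kappa> > 0" and tail: "\<And>n \<nu> i L. n \<ge> n0 \<Longrightarrow> is_uniform_on_K n b \<nu> \<Longrightarrow> i < n \<Longrightarrow> L > 0 \<Longrightarrow>
    (\<integral>x. ramp L (x i) \<partial>\<nu>) \<le> A * real n powr q * exp (- (r / 8) * L\<^sup>2 - \<kappa> * L)"
    by (rule tail_estimate) blast
  define d where "d = \<bar>q\<bar> + 2"
  have d: "d > 0" by (simp add: d_def)
  have lim: "(\<lambda>n. measure (P n) {\<omega> \<in> space (P n). (MAX i\<in>{..<n}. X n i \<omega>) > L n}) \<longlonglongrightarrow> 0"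
    if X: "uniform_vectors b P X" and L: "\<And>n. n \<ge> 2 \<Longrightarrow> L n > 0 \<and> r / 8 * (L n)\<^sup>2 + \<kappa> * L n \<ge> d * ln (real n)"
    for P :: "nat \<Rightarrow> 'p measure" and X L
  proof (rule Lim_null_comparison)
    have "eventually (\<lambda>n. real n > b) sequentially" by real_asymp
    then show "eventually (\<lambda>n. norm (measure (P n) {\<omega> \<in> space (P n). (MAX i\<in>{..<n}. X n i \<omega>) > L n}) \<le> A / real n) sequentially"
      using eventually_ge_at_top[of n0] eventually_ge_at_top[of 2]
    proof eventually_elim
      case (elim n)
      note Ln = L[OF elim(3)]
      let ?t = "A * real n powr q * exp (- (r / 8) * (L n)\<^sup>2 - \<kappa> * L n)"
      have "measure (P n) {\<omega> \<in> space (P n). (MAX i\<in>{..<n}. X n i \<omega>) > L n} \<le> real n * ?t"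
        using elim Ln by (intro max_tail[OF X] tail uniform_vectorsD(3)[OF X]) auto
      also have "\<dots> \<le> real n * (A * real n powr q * exp (- d * ln (real n)))"
        using Ln A by (intro mult_left_mono) (auto simp: algebra_simps)
      also have "exp (- d * ln (real n)) = real n powr (- d)"
        using elim by (simp add: powr_def)
      also have "real n * (A * real n powr q * real n powr (- d)) = A * real n powr (1 + (q + - d))"
        using elim unfolding powr_add[of _ 1] powr_add[of _ q] by simp
      also have "\<dots> \<le> A * real n powr (- 1)"
        using elim A by (intro mult_left_mono powr_mono) (auto simp: d_def)
      also have "\<dots> = A / real n" using elim by (simp add: powr_minus_divide)
      finally show ?case by simp
    qed
    show "(\<lambda>n. A / real n) \<longlonglongrightarrow> 0" by real_asymp
  qed
  {
    assume r: "r > 0"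
    \<comment> \<open>Solves \<open>r C\<^sup>2 / 8 = d\<close>.\<close>
    define C where "C = sqrt (8 * d / r)"
    have C: "C > 0" "C\<^sup>2 = 8 * d / r" using r d by (auto simp: C_def)
    have "C * sqrt (ln (real n)) > 0 \<and> r / 8 * (C * sqrt (ln (real n)))\<^sup>2 + \<kappa> * (C * sqrt (ln (real n))) \<ge> d * ln (real n)"
      if "n \<ge> 2" for n
    proof -
      have ln: "ln (real n) > 0" using that by simp
      have "r / 8 * (C * sqrt (ln (real n)))\<^sup>2 = d * ln (real n)"
        using r ln by (simp add: power_mult_distrib C(2))
      then show ?thesis using C(1) A ln by simp
    qed
    then show "\<exists>C :: real. \<forall>(P :: nat \<Rightarrow> 'p measure) X. uniform_vectors b P X \<longrightarrow>
      (\<lambda>n. measure (P n) {\<omega> \<in> space (P n). (MAX i\<in>{..<n}. X n i \<omega>) > C * sqrt (ln (real n))}) \<longlonglongrightarrow> 0"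
      by (intro exI[of _ C] allI impI lim)
  }
  define C where "C = d / \<kappa>"
  have C: "C > 0" "\<kappa> * C = d" using A d by (auto simp: C_def)
  have "C * ln (real n) > 0 \<and> r / 8 * (C * ln (real n))\<^sup>2 + \<kappa> * (C * ln (real n)) \<ge> d * ln (real n)" if "n \<ge> 2" for n
  proof -
    have ln: "ln (real n) > 0" using that by simp
    have "r / 8 * (C * ln (real n))\<^sup>2 \<ge> 0" using decay by (intro mult_nonneg_nonneg) auto
    moreover have "\<kappa> * (C * ln (real n)) = d * ln (real n)" using C(2) by (simp add: mult.assoc[symmetric])
    ultimately have "r / 8 * (C * ln (real n))\<^sup>2 + \<kappa> * (C * ln (real n)) \<ge> d * ln (real n)" by linarith
    then show ?thesis using C(1) ln by (intro conjI mult_pos_pos)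
  qed
  then show "\<exists>C :: real. \<forall>(P :: nat \<Rightarrow> 'p measure) X. uniform_vectors b P X \<longrightarrow>
      (\<lambda>n. measure (P n) {\<omega> \<in> space (P n). (MAX i\<in>{..<n}. X n i \<omega>) > C * ln (real n)}) \<longlonglongrightarrow> 0"
    by (intro exI[of _ C] allI impI lim)
qed

end

theorem theorem1p1:
  fixes b :: real
  assumes "1 < b" and "b \<le> 2"
  shows
    "(\<exists>!rs. case rs of (r, s) \<Rightarrow> moment_match b r s) \<and>
     (\<forall>r s (Q :: 'q measure) Z (P :: nat \<Rightarrow> 'p measure) X.
        moment_match b r s \<and> iid_with_density Q Z (gibbs_density r s) \<and> uniform_vectors b P X \<longrightarrow>
        (\<forall>k. converges_weakly (\<lambda>n. joint_law (P n) k (X n)) (joint_law Q k Z) sequentially) \<and>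
        (\<forall>k (\<alpha> :: nat \<Rightarrow> nat).
           (\<forall>n. real n > b \<and> n \<ge> k \<longrightarrow> integrable (P n) (\<lambda>\<omega>. \<Prod>i<k. X n i \<omega> ^ \<alpha> i)) \<and>
           integrable Q (\<lambda>\<omega>. \<Prod>i<k. Z i \<omega> ^ \<alpha> i) \<and>
           (\<lambda>n. LINT \<omega>|P n. (\<Prod>i<k. X n i \<omega> ^ \<alpha> i))
             \<longlonglongrightarrow> (LINT \<omega>|Q. (\<Prod>i<k. Z i \<omega> ^ \<alpha> i)))) \<and>
     (b < 2 \<longrightarrow>
        (\<exists>C :: real. \<forall>(P :: nat \<Rightarrow> 'p measure) X. uniform_vectors b P X \<longrightarrow>
           (\<lambda>n. measure (P n)
                  {\<omega> \<in> space (P n). (MAX i\<in>{..<n}. X n i \<omega>) > C * sqrt (ln (real n))})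
             \<longlonglongrightarrow> 0)) \<and>
     (b = 2 \<longrightarrow>
        (\<exists>C :: real. \<forall>(P :: nat \<Rightarrow> 'p measure) X. uniform_vectors b P X \<longrightarrow>
           (\<lambda>n. measure (P n)
                  {\<omega> \<in> space (P n). (MAX i\<in>{..<n}. X n i \<omega>) > C * ln (real n)})
             \<longlonglongrightarrow> 0))"
proof -
  obtain r0 s0 where match: "moment_match b r0 s0" and sign: "if b < 2 then r0 > 0 else r0 = 0 \<and> s0 = 1"
    using moment_match_exists[OF assms] by blast
  interpret gibbs b r0 s0
  proof
    show "moment_match b r0 s0" by (rule match)
    show "r0 > 0 \<or> r0 = 0 \<and> s0 > 0" using sign by (cases "b < 2") simp_all
  qed
  have unique: "r = r0 \<and> s = s0" if "moment_match b r s" for r s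
    using moment_match_unique[OF that match] .
  have parameters: "\<exists>!rs. case rs of (r, s) \<Rightarrow> moment_match b r s"
  proof (rule ex1I[of _ "(r0, s0)"])
    show "case (r0, s0) of (r, s) \<Rightarrow> moment_match b r s" using match by simp
    fix rs assume "case rs of (r, s) \<Rightarrow> moment_match b r s"
    then show "rs = (r0, s0)" using unique[of "fst rs" "snd rs"] by (cases rs) simp
  qed
  have limits: "(\<forall>k. converges_weakly (\<lambda>n. joint_law (P n) k (X n)) (joint_law Q k Z) sequentially) \<and>
        (\<forall>k (\<alpha> :: nat \<Rightarrow> nat).
           (\<forall>n. real n > b \<and> n \<ge> k \<longrightarrow> integrable (P n) (\<lambda>\<omega>. \<Prod>i<k. X n i \<omega> ^ \<alpha> i)) \<and>
           integrable Q (\<lambda>\<omega>. \<Prod>i<k. Z i \<omega> ^ \<alpha> i) \<and>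
           (\<lambda>n. LINT \<omega>|P n. (\<Prod>i<k. X n i \<omega> ^ \<alpha> i)) \<longlonglongrightarrow> (LINT \<omega>|Q. (\<Prod>i<k. Z i \<omega> ^ \<alpha> i)))"
    if "moment_match b r s \<and> iid_with_density Q Z (gibbs_density r s) \<and> uniform_vectors b P X"
    for r s and Q :: "'q measure" and Z and P :: "nat \<Rightarrow> 'p measure" and X
  proof -
    have Z: "iid_with_density Q Z p" and X: "uniform_vectors b P X" using that unique[of r s] by simp_all
    show ?thesis
    proof (intro conjI allI impI)
      show "converges_weakly (\<lambda>n. joint_law (P n) k (X n)) (joint_law Q k Z) sequentially" for k
        by (rule converges_weakly_iid[OF X Z])
      show "integrable (P n) (\<lambda>\<omega>. \<Prod>i<k. X n i \<omega> ^ \<alpha> i)" if "real n > b \<and> n \<ge> k" for n k and \<alpha> :: "nat \<Rightarrow> nat"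
        using that by (intro integrable_monomial_uniform[OF X]) simp_all
      show "integrable Q (\<lambda>\<omega>. \<Prod>i<k. Z i \<omega> ^ \<alpha> i)" for k and \<alpha> :: "nat \<Rightarrow> nat"
        by (rule integrable_monomial_iid[OF Z])
      show "(\<lambda>n. LINT \<omega>|P n. (\<Prod>i<k. X n i \<omega> ^ \<alpha> i)) \<longlonglongrightarrow> (LINT \<omega>|Q. (\<Prod>i<k. Z i \<omega> ^ \<alpha> i))"
        for k and \<alpha> :: "nat \<Rightarrow> nat"
        by (rule moments_converge[OF X Z])
    qed
  qed
  have maximum: "b < 2 \<longrightarrow>
        (\<exists>C :: real. \<forall>(P :: nat \<Rightarrow> 'p measure) X. uniform_vectors b P X \<longrightarrow>
           (\<lambda>n. measure (P n)
                  {\<omega> \<in> space (P n). (MAX i\<in>{..<n}. X n i \<omega>) > C * sqrt (ln (real n))})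
             \<longlonglongrightarrow> 0)"
    using sign by (intro impI maximum_sqrt_log) simp
  show ?thesis
    by (rule conjI[OF parameters conjI[OF _ conjI[OF maximum]]])
      (intro allI impI limits, assumption, rule impI, rule maximum_log)
qed

end
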